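(* Let $\alpha$ be an infinite cardinal. For a compact abelian group $K$ the following conditions are equivalent: (a) $K$ is $c_\alpha$-extremal; (b) $K$ is $\alpha$-singular; (c) there exists no continuous surjective homomorphism of $K$ onto $S^I$, where $S$ is a metrizable compact non-torsion abelian group and $|I|>\alpha$.
   Context: All topological spaces and groups are assumed to be Tychonov (in particular Hausdorff). Let $\alpha$ be an infinite cardinal. A topological space $X$ is $\alpha$-pseudocompact if $f(X)$ is compact for every continuous function $f:X\to\mathbb{R}^\alpha$; subgroups carry the subspace topology. $r_0(A)$ denotes the free rank of an abelian group $A$, and $w(X)$ the weight of a space $X$ (minimum cardinality of a base). An $\alpha$-pseudocompact abelian group $G$ is $c_\alpha$-extremal if $r_0(G/D)<2^\alpha$ for every dense $\alpha$-pseudocompact subgroup $D$ of $G$. (Compact groups are $\alpha$-pseudocompact.) A topological abelian group $G$ is $\alpha$-singular if there exists a positive integer $m$ such that $w(mG)\leq\alpha$, where $mG=\{mx:x\in G\}$ has the subspace topology. An abelian group is non-torsion if it has at least one element of infinite order. $S^I$ is the product of $|I|$ copies of $S$ with the product topology. *)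

theory Defs
  imports "HOL-Analysis.Analysis" "HOL-Algebra.FiniteProduct" "HOL-Algebra.Product_Groups"
begin

text \<open>Cardinals are represented, as in the HOL cardinal library, by cardinal well-orders
  (of type \<^typ>\<open>'a rel\<close>) and compared across types by \<open>\<le>o\<close> and \<open><o\<close>. Groups are
  written multiplicatively, as in HOL-Algebra.\<close>

unbundle cardinal_syntax

definition tychonoff_space :: "'a topology \<Rightarrow> bool" where
  "tychonoff_space X \<longleftrightarrow> completely_regular_space X \<and> Hausdorff_space X"

definition topological_abelian_group :: "('g, 'b) monoid_scheme \<Rightarrow> 'g topology \<Rightarrow> bool" where
  "topological_abelian_group G T \<longleftrightarrow>
     comm_group G \<and> topspace T = carrier G \<and> tychonoff_space T \<and>
     continuous_map (prod_topology T T) T (\<lambda>(x, y). x \<otimes>\<^bsub>G\<^esub> y) \<and>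
     continuous_map T T (\<lambda>x. inv\<^bsub>G\<^esub> x)"

definition base_of_topology :: "'a topology \<Rightarrow> 'a set set \<Rightarrow> bool" where
  "base_of_topology X \<B> \<longleftrightarrow>
     (\<forall>V\<in>\<B>. openin X V) \<and> (\<forall>U x. openin X U \<and> x \<in> U \<longrightarrow> (\<exists>V\<in>\<B>. x \<in> V \<and> V \<subseteq> U))"

text \<open>A base of minimum cardinality exists because cardinals are well-ordered.\<close>

definition weight :: "'a topology \<Rightarrow> 'a set rel" where
  "weight X = |SOME \<B>. base_of_topology X \<B> \<and> (\<forall>\<C>. base_of_topology X \<C> \<longrightarrow> |\<B>| \<le>o |\<C>| )|"

definition alpha_pseudocompact :: "'c rel \<Rightarrow> 'a topology \<Rightarrow> bool" where
  "alpha_pseudocompact \<alpha> X \<longleftrightarrow>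
     (\<forall>f. continuous_map X (product_topology (\<lambda>_. euclideanreal) (Field \<alpha>)) f \<longrightarrow>
          compactin (product_topology (\<lambda>_. euclideanreal) (Field \<alpha>)) (f ` topspace X))"

definition independent_in :: "('g, 'b) monoid_scheme \<Rightarrow> 'g set \<Rightarrow> bool" where
  "independent_in G X \<longleftrightarrow>
     X \<subseteq> carrier G \<and>
     (\<forall>F (n :: 'g \<Rightarrow> int). finite F \<and> F \<subseteq> X \<and> finprod G (\<lambda>x. x [^]\<^bsub>G\<^esub> n x) F = \<one>\<^bsub>G\<^esub> \<longrightarrow>
        (\<forall>x\<in>F. n x = 0))"

text \<open>Independence is over the integers with all coefficients zero, so independent sets have
  only elements of infinite order; all maximal ones have the same cardinality.\<close>

definition free_rank :: "('g, 'b) monoid_scheme \<Rightarrow> 'g rel" where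
  "free_rank G =
     |SOME X. independent_in G X \<and> (\<forall>Y. independent_in G Y \<and> X \<subseteq> Y \<longrightarrow> Y = X)|"

definition c_extremal :: "'c rel \<Rightarrow> ('g, 'b) monoid_scheme \<Rightarrow> 'g topology \<Rightarrow> bool" where
  "c_extremal \<alpha> G T \<longleftrightarrow>
     topological_abelian_group G T \<and> alpha_pseudocompact \<alpha> T \<and>
     (\<forall>D. subgroup D G \<and> T closure_of D = topspace T \<and> alpha_pseudocompact \<alpha> (subtopology T D) \<longrightarrow>
          free_rank (G Mod D) <o ctwo ^c \<alpha>)"

definition alpha_singular :: "'c rel \<Rightarrow> ('g, 'b) monoid_scheme \<Rightarrow> 'g topology \<Rightarrow> bool" where
  "alpha_singular \<alpha> G T \<longleftrightarrow>
     topological_abelian_group G T \<and>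
     (\<exists>m::nat. m > 0 \<and> weight (subtopology T ((\<lambda>x. x [^]\<^bsub>G\<^esub> m) ` carrier G)) \<le>o \<alpha>)"

definition non_torsion :: "('g, 'b) monoid_scheme \<Rightarrow> bool" where
  "non_torsion G \<longleftrightarrow> (\<exists>x\<in>carrier G. \<forall>n::nat. n > 0 \<longrightarrow> x [^]\<^bsub>G\<^esub> n \<noteq> \<one>\<^bsub>G\<^esub>)"

text \<open>A continuous surjective homomorphism onto the power \<open>S\<^sup>I\<close> (a product of copies of \<open>S\<close>
  indexed by \<open>I\<close>), with the product topology.\<close>

definition cont_hom_onto_power ::
  "('g, 'b) monoid_scheme \<Rightarrow> 'g topology \<Rightarrow> ('s, 'c) monoid_scheme \<Rightarrow> 's topology \<Rightarrow> 'i set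
     \<Rightarrow> ('g \<Rightarrow> 'i \<Rightarrow> 's) \<Rightarrow> bool" where
  "cont_hom_onto_power K T S U I h \<longleftrightarrow>
     h \<in> hom K (product_group I (\<lambda>_. S)) \<and>
     continuous_map T (product_topology (\<lambda>_. U) I) h \<and>
     h ` carrier K = carrier (product_group I (\<lambda>_. S))"

end

theory Submission
  imports Defs "HOL-Algebra.Free_Abelian_Groups" "HOL-Complex_Analysis.Great_Picard"
begin

text \<open>
  The equivalence is proved along the cycle (b), (a), (c), (b).

  If \<open>w(mK) \<le> \<alpha>\<close>, then \<open>mK\<close> embeds in \<open>\<real>\<^sup>\<alpha>\<close>, so \<open>mD\<close> is compact for every dense
  \<open>\<alpha>\<close>-pseudocompact subgroup \<open>D\<close>; hence \<open>mK = mD \<subseteq> D\<close> and \<open>K/D\<close> is torsion.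

  If \<open>h\<close> maps \<open>K\<close> onto \<open>S\<^sup>I\<close>, take for \<open>D\<close> the elements whose image has support of size at most
  \<open>\<alpha>\<close>. The closure of a subset of \<open>D\<close> of size at most \<open>\<alpha>\<close> is contained in \<open>D\<close>, which forces
  \<open>\<alpha>\<close>-pseudocompactness, and \<open>2\<^sup>\<alpha>\<close> independent elements of \<open>K/D\<close> are indexed by the subsets of \<open>\<alpha>\<close>:
  each pair \<open>F \<subseteq> \<alpha>\<close>, \<open>B \<subseteq> F\<close> of finite sets owns more than \<open>\<alpha>\<close> coordinates, on which the element of
  \<open>A\<close> is a fixed non-torsion point of \<open>S\<close> if \<open>A \<inter> F = B\<close> and trivial otherwise.

  If \<open>K\<close> is not \<open>\<alpha>\<close>-singular, every multiple \<open>mX\<close> of the character group \<open>X\<close> has more than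
  \<open>\<alpha>\<close> elements, because characters separate points. Call \<open>k\<close> ample if every set of at most \<open>\<alpha>\<close>
  characters contains no non-trivial element of some cyclic group of order \<open>k\<close> (\<open>k = 0\<close> meaning infinite). No \<open>m > 0\<close>
  is divisible by all ample \<open>k\<close>, so the product \<open>S\<close> of the groups of \<open>k\<close>-th roots of unity over all
  ample \<open>k\<close> is not torsion; transfinite recursion yields independent characters of all ample orders
  indexed by \<open>\<alpha>\<^sup>+\<close>, and Kronecker's theorem turns them into a surjection onto \<open>S\<^sup>I\<close>.

  That characters separate points is proved without Haar measure. With an invariant mean \<open>M\<close> on all
  bounded functions, consider the convolutions \<open>u\<close> of a fixed continuous \<open>f\<close> with functions of norm at
  most 1, and their autocorrelations \<open>\<psi>(x) = M\<^sub>y u(xy) cnj (u y)\<close>. Let \<open>u\<close> maximise the \<open>L\<^sup>2\<close> norm of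
  \<open>\<psi>\<close>; the maximum is attained because \<open>f\<close> is almost periodic. By the parallelogram law \<open>\<psi>\<close> is the sum
  of the autocorrelations of \<open>(u \<plusminus> c u(a \<cdot>))/2\<close>, so equality holds in Minkowski's inequality and these are
  proportional: \<open>u\<close> is an eigenfunction of all translations, that is, a multiple of a character.
\<close>

subsection \<open>Invariant means\<close>

text \<open>A minimal proper filter below \<open>F\<close> exists by Zorn's lemma, because a chain
  of proper filters has a proper infimum. It decides every \<open>P\<close>, since meeting it with
  the principal filter of \<open>P\<close> gives either \<open>bot\<close> or, by minimality, the
  same filter.\<close>

lemma ultrafilter_below:
  fixes F :: "'i filter"
  assumes "F \<noteq> bot"
  obtains G where "G \<noteq> bot" "G \<le> F" "\<And>P. eventually P G \<or> eventually (\<lambda>x. \<not> P x) G"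
proof -
  define A where "A = {G. G \<noteq> bot \<and> G \<le> F}"
  have "\<exists>m\<in>A. \<forall>a\<in>A. a \<le> m \<longrightarrow> a = m"
  proof (rule predicate_Zorn[of A "\<lambda>x y. y \<le> x", simplified])
    show "partial_order_on A (relation_of (\<lambda>x y. y \<le> x) A)"
      by (rule partial_order_on_relation_ofI) auto
    fix C assume C: "C \<in> Chains (relation_of (\<lambda>x y. y \<le> x) A)"
    then have CA: "C \<subseteq> A" and lin: "\<And>x y. x \<in> C \<Longrightarrow> y \<in> C \<Longrightarrow> x \<le> y \<or> y \<le> x"
      by (auto simp: Chains_def relation_of_def)
    show "\<exists>u\<in>A. \<forall>a\<in>C. u \<le> a"
    proof (cases "C = {}")
      case True
      then show ?thesis using assms by (auto simp: A_def)
    next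
      case False
      have "Inf C \<noteq> bot"
      proof
        assume "Inf C = bot"
        then have "eventually (\<lambda>_. False) (Inf C)" by simp
        then obtain G where "G \<in> C" "eventually (\<lambda>_. False) G"
          using eventually_Inf_base[OF False, of "\<lambda>_. False"] lin by (metis inf.absorb1 inf.absorb2 order_refl)
        then show False using CA by (auto simp: A_def trivial_limit_def)
      qed
      moreover have "Inf C \<le> F"
        using False CA by (auto simp: A_def intro: Inf_lower2)
      ultimately show ?thesis by (auto simp: A_def Inf_lower intro!: bexI[of _ "Inf C"])
    qed
  qed
  then obtain G where G: "G \<noteq> bot" "G \<le> F" and min: "\<And>H. H \<noteq> bot \<Longrightarrow> H \<le> F \<Longrightarrow> H \<le> G \<Longrightarrow> H = G"
    by (auto simp: A_def)
  have "eventually P G \<or> eventually (\<lambda>x. \<not> P x) G" for P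
  proof (cases "inf G (principal {x. P x}) = bot")
    case True
    then show ?thesis
      by (auto simp: trivial_limit_def eventually_inf_principal elim: eventually_mono)
  next
    case False
    then have "inf G (principal {x. P x}) = G"
      using G by (intro min) (auto intro: le_infI1)
    then have "G \<le> principal {x. P x}" by (metis inf_le2)
    then show ?thesis by (simp add: le_principal)
  qed
  with G that show ?thesis by blast
qed

text \<open>If no point were a limit, every point would have an open neighbourhood that
  \<open>f\<close> eventually avoids, because \<open>G\<close> decides; finitely many of these cover
  the compact closure of the range.\<close>

lemma ultrafilter_tendsto:
  fixes f :: "'i \<Rightarrow> 'c::heine_borel"
  assumes "G \<noteq> bot" "\<And>P. eventually P G \<or> eventually (\<lambda>x. \<not> P x) G"
    and "bounded (range f)"
  shows "\<exists>l. (f \<longlongrightarrow> l) G"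
proof (rule ccontr)
  assume "\<nexists>l. (f \<longlongrightarrow> l) G"
  then have "\<exists>U. open U \<and> l \<in> U \<and> \<not> eventually (\<lambda>x. f x \<in> U) G" for l
    by (auto simp: tendsto_def)
  then obtain U where U: "\<And>l. open (U l)" "\<And>l. l \<in> U l" "\<And>l. \<not> eventually (\<lambda>x. f x \<in> U l) G"
    by metis
  have "compact (closure (range f))"
    using assms(3) by (simp add: compact_closure)
  then obtain D where D: "finite D" "closure (range f) \<subseteq> (\<Union>l\<in>D. U l)"
    by (rule compactE_image[where C = UNIV and f = U]) (use U(1,2) in blast)+
  have "eventually (\<lambda>x. \<forall>l\<in>D. f x \<notin> U l) G"
    using D(1) assms(2) U(3) by (subst eventually_ball_finite_distrib) blast+
  then have "eventually (\<lambda>_. False) G"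
  proof (rule eventually_mono)
    fix x assume "\<forall>l\<in>D. f x \<notin> U l"
    moreover have "f x \<in> closure (range f)" using closure_subset by fastforce
    ultimately show False using D(2) by blast
  qed
  with assms(1) show False by (simp add: trivial_limit_def)
qed

context comm_group
begin

definition bounded_fun :: "('a \<Rightarrow> complex) \<Rightarrow> bool" where
  "bounded_fun f \<longleftrightarrow> (\<exists>B. \<forall>x\<in>carrier G. norm (f x) \<le> B)"

lemma bounded_funI: "(\<And>x. x \<in> carrier G \<Longrightarrow> norm (f x) \<le> B) \<Longrightarrow> bounded_fun f"
  by (auto simp: bounded_fun_def)

lemma bounded_fun_const [simp, intro]: "bounded_fun (\<lambda>_. c)"
  by (rule bounded_funI[of _ "norm c"]) simp

lemma bounded_fun_add [simp, intro]: "bounded_fun f \<Longrightarrow> bounded_fun g \<Longrightarrow> bounded_fun (\<lambda>x. f x + g x)"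
  unfolding bounded_fun_def by (meson norm_triangle_mono)

lemma bounded_fun_mult [simp, intro]:
  assumes "bounded_fun f" "bounded_fun g" shows "bounded_fun (\<lambda>x. f x * g x)"
proof -
  obtain A B where "\<forall>x\<in>carrier G. norm (f x) \<le> A" "\<forall>x\<in>carrier G. norm (g x) \<le> B"
    using assms by (auto simp: bounded_fun_def)
  then have "\<forall>x\<in>carrier G. norm (f x * g x) \<le> A * B"
    by (metis mult_mono' norm_ge_zero norm_mult)
  then show ?thesis unfolding bounded_fun_def by blast
qed

lemma bounded_fun_cnj [simp, intro]: "bounded_fun f \<Longrightarrow> bounded_fun (\<lambda>x. cnj (f x))"
  by (simp add: bounded_fun_def)

lemma bounded_fun_minus [simp, intro]: "bounded_fun f \<Longrightarrow> bounded_fun (\<lambda>x. - f x)"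
  by (simp add: bounded_fun_def)

lemma bounded_fun_diff [simp, intro]: "bounded_fun f \<Longrightarrow> bounded_fun g \<Longrightarrow> bounded_fun (\<lambda>x. f x - g x)"
  using bounded_fun_add[of f "\<lambda>x. - g x"] by simp

lemma bounded_fun_power [simp, intro]: "bounded_fun f \<Longrightarrow> bounded_fun (\<lambda>x. f x ^ n)"
  by (induction n) auto

lemma bounded_fun_sum [simp, intro]: "(\<And>i. i \<in> I \<Longrightarrow> bounded_fun (f i)) \<Longrightarrow> bounded_fun (\<lambda>x. \<Sum>i\<in>I. f i x)"
  by (induction I rule: infinite_finite_induct) auto

lemma bounded_fun_prod [simp, intro]: "(\<And>i. i \<in> I \<Longrightarrow> bounded_fun (f i)) \<Longrightarrow> bounded_fun (\<lambda>x. \<Prod>i\<in>I. f i x)"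
  by (induction I rule: infinite_finite_induct) auto

lemma bounded_fun_translate [simp, intro]:
  "bounded_fun f \<Longrightarrow> a \<in> carrier G \<Longrightarrow> bounded_fun (\<lambda>x. f (a \<otimes> x))"
  unfolding bounded_fun_def by (meson m_closed)

lemma bounded_fun_translate' [simp, intro]:
  "bounded_fun f \<Longrightarrow> a \<in> carrier G \<Longrightarrow> bounded_fun (\<lambda>x. f (x \<otimes> a))"
  unfolding bounded_fun_def by (meson m_closed)

end

text \<open>A finitely additive, translation-invariant integral on all bounded functions, standing
  in for Haar measure. Functions are total on the type, so \<open>M_cong\<close> is what makes their
  values outside the carrier irrelevant.\<close>

locale mean = comm_group +
  fixes M :: "('a \<Rightarrow> complex) \<Rightarrow> complex"
  assumes M_add: "bounded_fun f \<Longrightarrow> bounded_fun g \<Longrightarrow> M (\<lambda>x. f x + g x) = M f + M g"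
    and M_scale: "bounded_fun f \<Longrightarrow> M (\<lambda>x. c * f x) = c * M f"
    and M_one: "M (\<lambda>_. 1) = 1"
    and M_cong: "(\<And>x. x \<in> carrier G \<Longrightarrow> f x = g x) \<Longrightarrow> M f = M g"
    and M_norm: "(\<And>x. x \<in> carrier G \<Longrightarrow> norm (f x) \<le> B) \<Longrightarrow> norm (M f) \<le> B"
    and M_cnj: "bounded_fun f \<Longrightarrow> M (\<lambda>x. cnj (f x)) = cnj (M f)"
    and M_pos: "bounded_fun f \<Longrightarrow> (\<And>x. x \<in> carrier G \<Longrightarrow> 0 \<le> Re (f x)) \<Longrightarrow> 0 \<le> Re (M f)"
    and M_inv: "bounded_fun f \<Longrightarrow> a \<in> carrier G \<Longrightarrow> M (\<lambda>x. f (a \<otimes> x)) = M f"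

context comm_group
begin

text \<open>Averages over the boxes of products of powers of the listed elements with all exponents
  below \<open>N\<close>, the Folner sets that make an abelian group amenable.\<close>

primrec iter_avg :: "nat \<Rightarrow> 'a list \<Rightarrow> ('a \<Rightarrow> complex) \<Rightarrow> 'a \<Rightarrow> complex" where
  "iter_avg N [] f = f"
| "iter_avg N (g # gs) f = iter_avg N gs (\<lambda>x. (\<Sum>j<N. f (g [^] j \<otimes> x)) / of_nat N)"

lemma iter_avg_add: "iter_avg N gs (\<lambda>x. f x + h x) = (\<lambda>x. iter_avg N gs f x + iter_avg N gs h x)"
  by (induction gs arbitrary: f h) (simp_all add: sum.distrib add_divide_distrib)

lemma iter_avg_scale: "iter_avg N gs (\<lambda>x. c * f x) = (\<lambda>x. c * iter_avg N gs f x)"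
proof (induction gs arbitrary: f)
  case (Cons g gs)
  have "(\<lambda>x. (\<Sum>j<N. c * f (g [^] j \<otimes> x)) / of_nat N) = (\<lambda>x. c * ((\<Sum>j<N. f (g [^] j \<otimes> x)) / of_nat N))"
    by (simp add: sum_distrib_left)
  then show ?case by (simp only: iter_avg.simps Cons.IH)
qed simp

lemma iter_avg_cnj: "iter_avg N gs (\<lambda>x. cnj (f x)) = (\<lambda>x. cnj (iter_avg N gs f x))"
proof (induction gs arbitrary: f)
  case (Cons g gs)
  have "(\<lambda>x. (\<Sum>j<N. cnj (f (g [^] j \<otimes> x))) / of_nat N) = (\<lambda>x. cnj ((\<Sum>j<N. f (g [^] j \<otimes> x)) / of_nat N))"
    by simp
  then show ?case by (simp only: iter_avg.simps Cons.IH)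
qed simp

lemma iter_avg_const: "N > 0 \<Longrightarrow> iter_avg N gs (\<lambda>_. c) = (\<lambda>_. c)"
  by (induction gs) simp_all

lemma iter_avg_cong:
  assumes "set gs \<subseteq> carrier G" "\<And>x. x \<in> carrier G \<Longrightarrow> f x = h x" "x \<in> carrier G"
  shows "iter_avg N gs f x = iter_avg N gs h x"
  using assms
proof (induction gs arbitrary: f h)
  case (Cons g gs)
  show ?case
    unfolding iter_avg.simps by (rule Cons.IH) (use Cons.prems in auto)
qed simp

lemma iter_avg_norm:
  assumes "N > 0" "set gs \<subseteq> carrier G" "\<And>x. x \<in> carrier G \<Longrightarrow> norm (f x) \<le> B" "x \<in> carrier G"
  shows "norm (iter_avg N gs f x) \<le> B"
  using assms
proof (induction gs arbitrary: f)
  case (Cons g gs)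
  have "norm ((\<Sum>j<N. f (g [^] j \<otimes> y)) / of_nat N) \<le> B" if "y \<in> carrier G" for y
  proof -
    have "norm (\<Sum>j<N. f (g [^] j \<otimes> y)) \<le> of_nat (card {..<N}) * B"
      using Cons.prems that by (intro sum_norm_bound) auto
    then show ?thesis using Cons.prems(1) by (simp add: norm_divide divide_simps mult.commute)
  qed
  then show ?case using Cons by simp
qed simp

lemma iter_avg_pos:
  assumes "set gs \<subseteq> carrier G" "\<And>x. x \<in> carrier G \<Longrightarrow> 0 \<le> Re (f x)" "x \<in> carrier G"
  shows "0 \<le> Re (iter_avg N gs f x)"
  using assms
proof (induction gs arbitrary: f)
  case (Cons g gs)
  have "0 \<le> Re ((\<Sum>j<N. f (g [^] j \<otimes> y)) / of_nat N)" if "y \<in> carrier G" for y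
    using Cons.prems that by (simp add: Re_divide_of_nat sum_nonneg)
  then show ?case using Cons by simp
qed simp

text \<open>Averages over \<open>N\<close> successive powers of \<open>g\<close> telescope: a shift
  by \<open>g\<close> alters only the two end terms. The averages over the other list elements
  commute with the shift and do not increase the bound.\<close>

lemma iter_avg_almost_inv:
  assumes "N > 0" "set gs \<subseteq> carrier G" "\<And>x. x \<in> carrier G \<Longrightarrow> norm (f x) \<le> B" "g \<in> set gs" "x \<in> carrier G"
  shows "norm (iter_avg N gs (\<lambda>x. f (g \<otimes> x)) x - iter_avg N gs f x) \<le> 2 * B / N"
  using assms
proof (induction gs arbitrary: f)
  case (Cons h gs)
  have g: "g \<in> carrier G" and h: "h \<in> carrier G" using Cons.prems by auto
  show ?case
  proof (cases "g = h")
    case True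
    \<comment> \<open>The difference of the shifted and the unshifted average, written as a sum with
      coefficient -1 so that \<open>iter_avg_add\<close> and \<open>iter_avg_scale\<close> can split
      it.\<close>
    let ?d = "\<lambda>x. (\<Sum>j<N. f (g \<otimes> (h [^] j \<otimes> x))) / of_nat N + (-1) * ((\<Sum>j<N. f (h [^] j \<otimes> x)) / of_nat N)"
    have "norm (?d y) \<le> 2 * B / N" if y: "y \<in> carrier G" for y
    proof -
      have "(\<Sum>j<N. f (g \<otimes> (h [^] j \<otimes> y))) = (\<Sum>j<N. f (h [^] Suc j \<otimes> y))"
        using True g y by (intro sum.cong) (auto simp: m_ac)
      then have "(\<Sum>j<N. f (g \<otimes> (h [^] j \<otimes> y))) - (\<Sum>j<N. f (h [^] j \<otimes> y)) = f (h [^] N \<otimes> y) - f y"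
        using sum_lessThan_telescope[of "\<lambda>j. f (h [^] j \<otimes> y)" N] h y
        by (simp add: sum_subtractf)
      moreover have "norm (f (h [^] N \<otimes> y) - f y) \<le> B + B"
        using Cons.prems(3) h y by (intro order_trans[OF norm_triangle_ineq4] add_mono) auto
      moreover have "?d y = ((\<Sum>j<N. f (g \<otimes> (h [^] j \<otimes> y))) - (\<Sum>j<N. f (h [^] j \<otimes> y))) / of_nat N"
        by (simp add: diff_divide_distrib)
      ultimately show ?thesis using Cons.prems(1) by (simp add: norm_divide divide_right_mono)
    qed
    then have "norm (iter_avg N gs ?d x) \<le> 2 * B / N"
      using Cons.prems by (intro iter_avg_norm) auto
    then show ?thesis unfolding iter_avg_add iter_avg_scale by simp
  next
    case False
    have eq: "iter_avg N gs (\<lambda>x. (\<Sum>j<N. f (g \<otimes> (h [^] j \<otimes> x))) / of_nat N) x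
       = iter_avg N gs (\<lambda>x. (\<lambda>x. (\<Sum>j<N. f (h [^] j \<otimes> x)) / of_nat N) (g \<otimes> x)) x"
      by (rule iter_avg_cong) (use Cons.prems g h in \<open>auto simp: m_lcomm\<close>)
    have B: "norm ((\<Sum>j<N. f (h [^] j \<otimes> y)) / of_nat N) \<le> B" if "y \<in> carrier G" for y
      using iter_avg_norm[of N "[h]" f B y] Cons.prems that by simp
    show ?thesis unfolding iter_avg.simps eq
      by (rule Cons.IH) (use Cons.prems False B in auto)
  qed
qed simp

definition late :: "'a \<Rightarrow> nat \<Rightarrow> 'a list \<times> nat \<Rightarrow> bool" where
  "late g n q \<longleftrightarrow> set (fst q) \<subseteq> carrier G \<and> g \<in> set (fst q) \<and> n < snd q"

text \<open>Finitely many conditions \<open>late g n\<close> hold together for a list of all those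
  \<open>g\<close> and an \<open>N\<close> above all those \<open>n\<close>, so they generate a
  proper filter.\<close>

lemma invariance_filter:
  obtains F :: "('a list \<times> nat) filter"
  where "F \<noteq> bot"
    and "\<And>g n. g \<in> carrier G \<Longrightarrow> eventually (late g n) F"
proof -
  define E where "E p = Collect (late (fst p) (snd p))" for p :: "'a \<times> nat"
  define F where "F = Inf ((\<lambda>p. principal (E p)) ` (carrier G \<times> UNIV))"
  have "F \<noteq> bot"
    unfolding F_def
  proof (rule INF_filter_not_bot)
    fix X assume X: "X \<subseteq> carrier G \<times> (UNIV::nat set)" "finite X"
    obtain gs where gs: "set gs = fst ` X" using finite_list[OF finite_imageI[OF X(2)]] ..
    define N where "N = Suc (Max (insert 0 (snd ` X)))"
    have "(gs, N) \<in> E p" if p: "p \<in> X" for p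
    proof -
      have "snd p \<le> Max (insert 0 (snd ` X))" using X(2) p by (intro Max_ge) auto
      moreover have "fst p \<in> set gs" "set gs \<subseteq> carrier G" using p X(1) gs by auto
      ultimately show ?thesis by (simp add: N_def E_def late_def)
    qed
    then have "(gs, N) \<in> \<Inter> (E ` X)"
      by auto
    moreover have "Inf ((\<lambda>p. principal (E p)) ` X) = principal (\<Inter> (E ` X))"
      using X(2) by (rule INF_principal_finite)
    ultimately show "Inf ((\<lambda>p. principal (E p)) ` X) \<noteq> bot"
      by (simp only: principal_eq_bot_iff) blast
  qed
  moreover have "eventually (late g n) F"
    if "g \<in> carrier G" for g n
  proof -
    have "F \<le> principal (E (g, n))" using that by (auto simp: F_def intro: INF_lower)
    then show ?thesis by (simp add: E_def le_principal)
  qed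
  ultimately show ?thesis using that by blast
qed

text \<open>The mean is the limit of the iterated averages, taken at \<open>\<one>\<close>, along an
  ultrafilter finer than the invariance filter. The defect of invariance is at most
  \<open>2 * B / N\<close>, and \<open>N\<close> exceeds every bound along the filter.\<close>

theorem ex_mean: "\<exists>M. mean G M"
proof -
  obtain F where F: "F \<noteq> bot"
    and evF: "\<And>g n. g \<in> carrier G \<Longrightarrow> eventually (late g n) F"
    using invariance_filter by blast
  obtain U where U: "U \<noteq> bot" "U \<le> F" "\<And>P. eventually P U \<or> eventually (\<lambda>x. \<not> P x) U"
    using ultrafilter_below[OF F] by blast
  have evU: "eventually (late g n) U"
    if "g \<in> carrier G" for g n
    using evF[OF that] U(2) by (rule filter_leD[rotated])
  have ev0: "eventually (\<lambda>q. set (fst q) \<subseteq> carrier G \<and> snd q > 0) U"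
    by (rule eventually_mono[OF evU[OF one_closed, of 0]]) (auto simp: late_def)
  \<comment> \<open>The value 0 on inadmissible pairs keeps \<open>A f\<close> bounded on all pairs,
    as \<open>ultrafilter_tendsto\<close> demands; along \<open>U\<close> the pairs are eventually
    admissible.\<close>
  define A where "A = (\<lambda>f p. if set (fst p) \<subseteq> carrier G \<and> snd p > 0 then iter_avg (snd p) (fst p) f \<one> else 0)"
  have Alim: "\<exists>l. (A f \<longlongrightarrow> l) U" if f: "bounded_fun f" for f
  proof (rule ultrafilter_tendsto[OF U(1) U(3)])
    obtain B where B: "\<And>x. x \<in> carrier G \<Longrightarrow> norm (f x) \<le> B" using f by (auto simp: bounded_fun_def)
    have "0 \<le> B" using B[OF one_closed] norm_ge_zero order_trans by blast
    then have "norm (A f p) \<le> B" for p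
      using B by (auto simp: A_def intro!: iter_avg_norm)
    then show "bounded (range (A f))" by (auto simp: bounded_iff)
  qed
  define M where "M = (\<lambda>f. Lim U (A f))"
  have M: "(A f \<longlongrightarrow> M f) U" if "bounded_fun f" for f
    using Alim[OF that] U(1) by (auto simp: M_def tendsto_Lim)
  have ev: "eventually P U" if "\<And>gs N. set gs \<subseteq> carrier G \<Longrightarrow> N > 0 \<Longrightarrow> P (gs, N)" for P
    by (rule eventually_mono[OF ev0]) (use that in auto)
  have Meq: "M f = l" if "bounded_fun f" "(A f \<longlongrightarrow> l) U" for f l
    using tendsto_unique[OF U(1) M] that by blast
  have "mean G M"
  proof (intro mean.intro mean_axioms.intro comm_group_axioms)
    fix f g :: "'a \<Rightarrow> complex" and c a B
    show "M (\<lambda>x. f x + g x) = M f + M g" if "bounded_fun f" "bounded_fun g"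
    proof (rule Meq)
      have "A (\<lambda>x. f x + g x) = (\<lambda>p. A f p + A g p)" by (auto simp: A_def iter_avg_add)
      then show "(A (\<lambda>x. f x + g x) \<longlongrightarrow> M f + M g) U" using M that by (auto intro: tendsto_add)
    qed (use that in simp)
    show "M (\<lambda>x. c * f x) = c * M f" if "bounded_fun f"
    proof (rule Meq)
      have "A (\<lambda>x. c * f x) = (\<lambda>p. c * A f p)" by (auto simp: A_def iter_avg_scale)
      then show "(A (\<lambda>x. c * f x) \<longlongrightarrow> c * M f) U" using M that by (auto intro: tendsto_mult)
    qed (use that in simp)
    show "M (\<lambda>_. 1) = 1"
      by (rule Meq) (auto intro!: tendsto_eventually ev simp: A_def iter_avg_const)
    show eq: "M f = M g" if "\<And>x. x \<in> carrier G \<Longrightarrow> f x = g x" for f g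
    proof -
      have "A f = A g" using iter_avg_cong[of _ f g \<one>] that by (auto simp: A_def fun_eq_iff)
      then show ?thesis by (simp add: M_def)
    qed
    show "norm (M f) \<le> B" if B: "\<And>x. x \<in> carrier G \<Longrightarrow> norm (f x) \<le> B"
    proof (rule Lim_norm_ubound[OF U(1) M])
      show "bounded_fun f" using B by (rule bounded_funI)
      show "\<forall>\<^sub>F p in U. norm (A f p) \<le> B"
        by (rule ev) (use B in \<open>auto simp: A_def intro!: iter_avg_norm\<close>)
    qed
    show "M (\<lambda>x. cnj (f x)) = cnj (M f)" if "bounded_fun f"
    proof (rule Meq)
      have "A (\<lambda>x. cnj (f x)) = (\<lambda>p. cnj (A f p))" by (auto simp: A_def iter_avg_cnj)
      then show "(A (\<lambda>x. cnj (f x)) \<longlongrightarrow> cnj (M f)) U" using M[OF that] by (auto intro: tendsto_cnj)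
    qed (use that in simp)
    show "0 \<le> Re (M f)" if "bounded_fun f" "\<And>x. x \<in> carrier G \<Longrightarrow> 0 \<le> Re (f x)"
    proof (rule tendsto_lowerbound[OF tendsto_Re[OF M[OF that(1)]] _ U(1)])
      show "\<forall>\<^sub>F p in U. 0 \<le> Re (A f p)"
        by (rule ev) (use that in \<open>auto simp: A_def intro!: iter_avg_pos\<close>)
    qed
    show "M (\<lambda>x. f (a \<otimes> x)) = M f" if f: "bounded_fun f" and a: "a \<in> carrier G"
    proof -
      obtain B where B: "\<And>x. x \<in> carrier G \<Longrightarrow> norm (f x) \<le> B" using f by (auto simp: bounded_fun_def)
      have lim: "((\<lambda>p. A (\<lambda>x. f (a \<otimes> x)) p - A f p) \<longlongrightarrow> M (\<lambda>x. f (a \<otimes> x)) - M f) U"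
        using f a by (intro tendsto_diff M) auto
      have "norm (M (\<lambda>x. f (a \<otimes> x)) - M f) \<le> 2 * B / real (Suc n)" for n
      proof (rule Lim_norm_ubound[OF U(1) lim])
        show "\<forall>\<^sub>F p in U. norm (A (\<lambda>x. f (a \<otimes> x)) p - A f p) \<le> 2 * B / real (Suc n)"
        proof (rule eventually_mono[OF evU[OF a, of "Suc n"]], clarsimp simp: late_def)
          fix gs N assume gs: "set gs \<subseteq> carrier G" "a \<in> set gs" "Suc n < N"
          have "0 \<le> B" using B[OF one_closed] norm_ge_zero order_trans by blast
          have "norm (A (\<lambda>x. f (a \<otimes> x)) (gs, N) - A f (gs, N)) \<le> 2 * B / N"
            using iter_avg_almost_inv[of N gs f B a \<one>] gs B by (auto simp: A_def)
          also have "\<dots> \<le> 2 * B / real (Suc n)"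
            using gs \<open>0 \<le> B\<close> by (intro divide_left_mono) auto
          finally show "cmod (A (\<lambda>x. f (a \<otimes> x)) (gs, N) - A f (gs, N)) \<le> 2 * B / (1 + real n)"
            by simp
        qed
      qed
      moreover have "(\<lambda>n. 2 * B / real (Suc n)) \<longlonglongrightarrow> 0"
        using tendsto_mult_right[OF LIMSEQ_inverse_real_of_nat, of "2 * B"] by (simp add: divide_inverse mult.commute)
      ultimately have "norm (M (\<lambda>x. f (a \<otimes> x)) - M f) \<le> 0"
        by (intro LIMSEQ_le_const) auto
      then show ?thesis by simp
    qed
  qed
  then show ?thesis by blast
qed

end

subsection \<open>Compact abelian groups\<close>

locale compact_abelian_group = comm_group +
  fixes T :: "'a topology"
  assumes top_ab: "topological_abelian_group G T"
    and compact: "compact_space T"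
begin

lemma topspace: "topspace T = carrier G"
  and Hausdorff: "Hausdorff_space T"
  and creg: "completely_regular_space T"
  and mult_cont: "continuous_map (prod_topology T T) T (\<lambda>(x, y). x \<otimes> y)"
  using top_ab by (auto simp: topological_abelian_group_def tychonoff_space_def)

abbreviation cfun :: "('a \<Rightarrow> complex) \<Rightarrow> bool" where
  "cfun \<equiv> continuous_map T euclidean"

lemma cfun_eq:
  "cfun f \<longleftrightarrow> (\<forall>x\<in>carrier G. \<forall>\<epsilon>>0. \<exists>V. openin T V \<and> x \<in> V \<and> (\<forall>y\<in>V. norm (f y - f x) < \<epsilon>))"
  using Met_TC.continuous_map_to_metric[of T f]
  by (simp add: topspace dist_norm norm_minus_commute)

lemma mult_cont2:
  assumes "continuous_map X T f" "continuous_map X T g"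
  shows "continuous_map X T (\<lambda>x. f x \<otimes> g x)"
proof -
  have "continuous_map X T ((\<lambda>(x, y). x \<otimes> y) \<circ> (\<lambda>x. (f x, g x)))"
    by (rule continuous_map_compose[OF _ mult_cont]) (simp add: continuous_map_paired assms)
  then show ?thesis by (simp add: o_def)
qed

lemma translate_cont: "a \<in> carrier G \<Longrightarrow> continuous_map T T (\<lambda>x. a \<otimes> x)"
  by (rule mult_cont2) (auto simp: topspace)

lemma cfun_translate: "cfun f \<Longrightarrow> a \<in> carrier G \<Longrightarrow> cfun (\<lambda>x. f (a \<otimes> x))"
  using continuous_map_compose[OF translate_cont] by (fastforce simp: o_def)

lemma cfun_bounded: "cfun f \<Longrightarrow> bounded_fun f"
proof -
  assume f: "cfun f"
  have "compactin euclidean (f ` carrier G)"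
    using image_compactin[OF _ f] compact topspace compact_space_def by metis
  then have "bounded (f ` carrier G)" by (simp add: compact_imp_bounded)
  then show ?thesis by (auto simp: bounded_iff bounded_fun_def)
qed

text \<open>The tube lemma: the open set of pairs \<open>(x, y)\<close> at which
  \<open>f (x \<otimes> y)\<close> is close to \<open>f (x0 \<otimes> y)\<close> contains
  \<open>{x0}\<close> times the compact group, hence also a neighbourhood of \<open>x0\<close> times
  the group.\<close>

lemma cfun_equicontinuous:
  assumes f: "cfun f" and x0: "x0 \<in> carrier G" and e: "\<epsilon> > 0"
  obtains V where "openin T V" "x0 \<in> V" "\<And>x y. x \<in> V \<Longrightarrow> y \<in> carrier G \<Longrightarrow> norm (f (x \<otimes> y) - f (x0 \<otimes> y)) < \<epsilon>"
proof -
  define F where "F p = f (fst p \<otimes> snd p) - f (x0 \<otimes> snd p)" for p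
  have 1: "continuous_map (prod_topology T T) T (\<lambda>p. fst p \<otimes> snd p)"
    using mult_cont by (simp add: case_prod_unfold)
  have 2: "continuous_map (prod_topology T T) T (\<lambda>p. x0 \<otimes> snd p)"
    by (rule mult_cont2) (auto simp: topspace x0 continuous_map_snd)
  have "continuous_map (prod_topology T T) euclidean F"
    unfolding F_def
    using continuous_map_compose[OF 1 f] continuous_map_compose[OF 2 f]
    by (intro continuous_map_diff) (auto simp: o_def)
  then have W: "openin (prod_topology T T) {p \<in> topspace (prod_topology T T). F p \<in> ball 0 \<epsilon>}"
    by (rule openin_continuous_map_preimage) (simp add: open_openin[symmetric])
  define W where "W = {p \<in> topspace (prod_topology T T). F p \<in> ball 0 \<epsilon>}"
  have sub: "{x0} \<times> topspace T \<subseteq> W"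
    using x0 e by (auto simp: topspace F_def W_def)
  have "compactin T (topspace T)" "x0 \<in> topspace T"
    using compact x0 by (auto simp: compact_space_def topspace)
  from tube_lemma_right[OF W[folded W_def] this sub]
  obtain U V where UV: "openin T U" "x0 \<in> U" "topspace T \<subseteq> V" "U \<times> V \<subseteq> W"
    by blast
  show ?thesis
  proof (rule that[OF UV(1,2)])
    fix x y assume "x \<in> U" "y \<in> carrier G"
    then have "(x, y) \<in> U \<times> V" using UV(3) topspace by auto
    then have "F (x, y) \<in> ball 0 \<epsilon>" using UV(4) by (auto simp: W_def)
    then show "norm (f (x \<otimes> y) - f (x0 \<otimes> y)) < \<epsilon>" by (simp add: F_def)
  qed
qed

lemma finite_subcover:
  assumes "\<And>x. x \<in> carrier G \<Longrightarrow> openin T (V x)" "\<And>x. x \<in> carrier G \<Longrightarrow> x \<in> V x"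
  obtains X where "finite X" "X \<subseteq> carrier G" "carrier G \<subseteq> (\<Union>x\<in>X. V x)"
proof -
  have "compactin T (carrier G)" using compact by (simp add: compact_space_def topspace)
  then have "\<exists>\<F>. finite \<F> \<and> \<F> \<subseteq> V ` carrier G \<and> carrier G \<subseteq> \<Union>\<F>"
    by (rule compactinD) (use assms in auto)
  then show ?thesis using that by (metis finite_subset_image)
qed

text \<open>Finitely many of the neighbourhoods of equicontinuity cover the group, so the translates
  of \<open>f\<close> are totally bounded in the supremum norm. This is the compactness behind the
  attained maximum.\<close>

lemma cfun_almost_periodic:
  assumes f: "cfun f" and e: "\<epsilon> > 0"
  obtains X where "finite X" "X \<subseteq> carrier G"
    "\<And>x. x \<in> carrier G \<Longrightarrow> \<exists>x'\<in>X. \<forall>y\<in>carrier G. norm (f (x \<otimes> y) - f (x' \<otimes> y)) < \<epsilon>"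
proof -
  have "\<exists>V. openin T V \<and> x0 \<in> V \<and> (\<forall>x\<in>V. \<forall>y\<in>carrier G. norm (f (x \<otimes> y) - f (x0 \<otimes> y)) < \<epsilon>)"
    if "x0 \<in> carrier G" for x0
    using cfun_equicontinuous[OF f that e] by metis
  then obtain V where V: "\<And>x0. x0 \<in> carrier G \<Longrightarrow> openin T (V x0)" "\<And>x0. x0 \<in> carrier G \<Longrightarrow> x0 \<in> V x0"
    "\<And>x0 x y. x0 \<in> carrier G \<Longrightarrow> x \<in> V x0 \<Longrightarrow> y \<in> carrier G \<Longrightarrow> norm (f (x \<otimes> y) - f (x0 \<otimes> y)) < \<epsilon>"
    by metis
  obtain X where X: "finite X" "X \<subseteq> carrier G" "carrier G \<subseteq> (\<Union>x\<in>X. V x)"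
    using finite_subcover[of V] V(1,2) by metis
  show ?thesis
  proof (rule that[OF X(1,2)])
    fix x assume "x \<in> carrier G"
    then obtain x' where "x' \<in> X" "x \<in> V x'" using X(3) by auto
    then show "\<exists>x'\<in>X. \<forall>y\<in>carrier G. norm (f (x \<otimes> y) - f (x' \<otimes> y)) < \<epsilon>"
      using V(3) X(2) by blast
  qed
qed

end

section \<open>The semi-inner product of a mean and autocorrelations\<close>

context mean
begin

lemma M_diff: "bounded_fun f \<Longrightarrow> bounded_fun g \<Longrightarrow> M (\<lambda>x. f x - g x) = M f - M g"
  using M_add[of f "\<lambda>x. - 1 * g x"] M_scale[of g "- 1"] by simp

lemma M_sum: "finite I \<Longrightarrow> (\<And>i. i \<in> I \<Longrightarrow> bounded_fun (f i)) \<Longrightarrow> M (\<lambda>x. \<Sum>i\<in>I. f i x) = (\<Sum>i\<in>I. M (f i))"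
proof (induction I rule: finite_induct)
  case empty
  show ?case using M_scale[of "\<lambda>_. 1" 0] by simp
next
  case (insert i I)
  then show ?case by (simp add: M_add)
qed

lemma M_const: "M (\<lambda>_. c) = c"
  using M_scale[of "\<lambda>_. 1" c] M_one by simp

text \<open>The L2 form of the mean. On bounded functions it is only positive semidefinite;
  \<open>sq_eq_0\<close> will show it definite on continuous functions on a compact group.\<close>

definition ip :: "('a \<Rightarrow> complex) \<Rightarrow> ('a \<Rightarrow> complex) \<Rightarrow> complex" where
  "ip u v = M (\<lambda>x. u x * cnj (v x))"

definition sq :: "('a \<Rightarrow> complex) \<Rightarrow> real" where
  "sq u = Re (ip u u)"

lemma ip_self: "bounded_fun u \<Longrightarrow> ip u u = of_real (sq u)"
proof -
  assume u: "bounded_fun u"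
  have "cnj (ip u u) = ip u u"
    unfolding ip_def using u by (subst M_cnj[symmetric]) (auto simp: mult.commute)
  then show ?thesis by (simp add: sq_def complex_eq_iff)
qed

lemma ip_commute: "bounded_fun u \<Longrightarrow> bounded_fun v \<Longrightarrow> ip v u = cnj (ip u v)"
  unfolding ip_def by (subst M_cnj[symmetric]) (auto simp: mult.commute)

lemma sq_nonneg: "bounded_fun u \<Longrightarrow> 0 \<le> sq u"
  unfolding sq_def ip_def by (rule M_pos) auto

lemma sq_comb:
  assumes p: "bounded_fun p" and q: "bounded_fun q"
  shows "sq (\<lambda>x. a * p x + b * q x) = (norm a)\<^sup>2 * sq p + (norm b)\<^sup>2 * sq q + 2 * Re (a * cnj b * ip p q)"
proof -
  have "ip (\<lambda>x. a * p x + b * q x) (\<lambda>x. a * p x + b * q x)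
      = M (\<lambda>x. ((a * cnj a) * (p x * cnj (p x)) + (b * cnj b) * (q x * cnj (q x)))
             + ((a * cnj b) * (p x * cnj (q x)) + (b * cnj a) * (q x * cnj (p x))))"
    unfolding ip_def by (rule M_cong) (simp add: algebra_simps)
  also have "\<dots> = (a * cnj a) * ip p p + (b * cnj b) * ip q q + (a * cnj b * ip p q + b * cnj a * ip q p)"
    unfolding ip_def using p q by (simp add: M_add M_scale bounded_fun_mult)
  also have "b * cnj a * ip q p = cnj (a * cnj b * ip p q)"
    using p q by (simp add: ip_commute[of p q])
  also have "a * cnj a * ip p p = of_real ((norm a)\<^sup>2 * sq p)"
    using p by (simp only: ip_self complex_norm_square of_real_mult)
  also have "b * cnj b * ip q q = of_real ((norm b)\<^sup>2 * sq q)"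
    using q by (simp only: ip_self complex_norm_square of_real_mult)
  finally show ?thesis
    unfolding sq_def[of "\<lambda>x. a * p x + b * q x"]
    by (simp only: plus_complex.simps cnj.simps Re_complex_of_real)
qed

lemma sq_scale: "bounded_fun p \<Longrightarrow> sq (\<lambda>x. a * p x) = (norm a)\<^sup>2 * sq p"
  using sq_comb[of p p a 0] by simp

lemma sq_le: "bounded_fun u \<Longrightarrow> (\<And>x. x \<in> carrier G \<Longrightarrow> norm (u x) \<le> C) \<Longrightarrow> sq u \<le> C\<^sup>2"
proof -
  assume "bounded_fun u" and C: "\<And>x. x \<in> carrier G \<Longrightarrow> norm (u x) \<le> C"
  have "norm (ip u u) \<le> C\<^sup>2"
    unfolding ip_def
  proof (rule M_norm)
    fix x assume "x \<in> carrier G"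
    then have "norm (u x) * norm (u x) \<le> C * C" by (intro mult_mono' C) auto
    then show "norm (u x * cnj (u x)) \<le> C\<^sup>2" by (simp add: norm_mult power2_eq_square)
  qed
  then show ?thesis unfolding sq_def using complex_Re_le_cmod order_trans by blast
qed

text \<open>Cauchy-Schwarz, from the non-negativity of \<open>sq\<close> on a combination of
  \<open>g\<close> and \<open>cnj h\<close>. It turns a bound on the seminorm of \<open>g\<close>
  into uniform bounds on convolutions with \<open>g\<close>.\<close>

lemma M_mult_le:
  assumes g: "bounded_fun g" "sq g \<le> 1" and h: "\<And>x. x \<in> carrier G \<Longrightarrow> norm (h x) \<le> C" and C: "C > 0"
  shows "norm (M (\<lambda>x. h x * g x)) \<le> C"
proof -
  define p where "p = (\<lambda>x. cnj (h x))"
  have hb: "bounded_fun h" using h by (rule bounded_funI)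
  then have p: "bounded_fun p" by (simp add: p_def bounded_fun_cnj)
  define z where "z = M (\<lambda>x. h x * g x)"
  have z: "ip g p = z" unfolding ip_def z_def p_def by (simp add: mult.commute)
  \<comment> \<open>This \<open>c\<close> minimises the upper bound obtained by replacing
    \<open>sq p\<close> with \<open>C^2\<close> in the expansion below.\<close>
  define c where "c = - z / of_real (C\<^sup>2)"
  have "0 \<le> sq (\<lambda>x. 1 * g x + c * p x)" using g p by (intro sq_nonneg) (auto intro!: bounded_fun_mult bounded_fun_add)
  also have "\<dots> = sq g + (norm c)\<^sup>2 * sq p + 2 * Re (cnj c * z)"
    using sq_comb[OF g(1) p, of 1 c] z by simp
  also have "cnj c * z = of_real (- ((norm z)\<^sup>2 / C\<^sup>2))"
    using complex_norm_square[of z] by (simp add: c_def mult.commute)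
  also have "(norm c)\<^sup>2 * sq p \<le> (norm c)\<^sup>2 * C\<^sup>2"
    using h p by (intro mult_left_mono sq_le) (auto simp: p_def)
  also have "(norm c)\<^sup>2 * C\<^sup>2 = (norm z)\<^sup>2 / C\<^sup>2"
    using C by (simp add: c_def norm_divide power_divide field_simps power2_eq_square norm_mult)
  finally have "(norm z)\<^sup>2 / C\<^sup>2 \<le> 1" using g(2) by simp
  then have "(norm z)\<^sup>2 \<le> C\<^sup>2" using C by (simp add: divide_simps)
  then show ?thesis unfolding z_def[symmetric] by (rule power2_le_imp_le) (use C in simp)
qed

lemma norm_ip_le:
  assumes "bounded_fun p" "bounded_fun q" "sq p = r" "sq q = r"
  shows "norm (ip p q) \<le> r"
proof (cases "ip p q = 0")
  case True
  then show ?thesis using assms sq_nonneg by auto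
next
  case False
  \<comment> \<open>The phase of \<open>ip p q\<close>: turning \<open>q\<close> by it makes the
    inner product real and non-negative, and the square of \<open>p - z q\<close> then gives the
    bound.\<close>
  define z where "z = ip p q / of_real (norm (ip p q))"
  have nz: "norm z = 1" using False by (simp add: z_def norm_divide)
  have "cnj z * ip p q = of_real (norm (ip p q))"
  proof -
    have "cnj z * ip p q = of_real ((norm (ip p q))\<^sup>2) / of_real (norm (ip p q))"
      by (simp only: z_def complex_norm_square) (simp add: mult.commute)
    then show ?thesis using False by (simp add: power2_eq_square)
  qed
  moreover have "0 \<le> sq (\<lambda>x. 1 * p x + (- z) * q x)"
    using assms by (intro sq_nonneg bounded_fun_add bounded_fun_mult) auto
  ultimately show ?thesis
    using sq_comb[OF assms(1,2), of 1 "- z"] nz assms(3,4) by simp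
qed

lemma M_tendsto:
  assumes "\<And>n. bounded_fun (f n)" "bounded_fun g" "uniform_limit (carrier G) f g sequentially"
  shows "(\<lambda>n. M (f n)) \<longlonglongrightarrow> M g"
proof (rule tendstoI)
  fix e :: real assume "e > 0"
  then have "\<forall>\<^sub>F n in sequentially. \<forall>x\<in>carrier G. dist (f n x) (g x) < e / 2"
    using assms(3) unfolding uniform_limit_iff by (meson half_gt_zero)
  then show "\<forall>\<^sub>F n in sequentially. dist (M (f n)) (M g) < e"
  proof eventually_elim
    case (elim n)
    have "norm (M (\<lambda>x. f n x - g x)) \<le> e / 2"
      using elim by (intro M_norm) (auto simp: dist_norm less_imp_le)
    then show ?case using M_diff[OF assms(1)[of n] assms(2)] \<open>e > 0\<close> by (simp add: dist_norm)
  qed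
qed

lemma M_uniform_limit:
  assumes "\<And>n p. p \<in> P \<Longrightarrow> bounded_fun (f n p)" "\<And>p. p \<in> P \<Longrightarrow> bounded_fun (g p)"
    and lim: "uniform_limit (P \<times> carrier G) (\<lambda>n q. f n (fst q) (snd q)) (\<lambda>q. g (fst q) (snd q)) sequentially"
  shows "uniform_limit P (\<lambda>n p. M (f n p)) (\<lambda>p. M (g p)) sequentially"
proof (rule uniform_limitI)
  fix e :: real assume "e > 0"
  then have "\<forall>\<^sub>F n in sequentially. \<forall>q\<in>P \<times> carrier G. dist (f n (fst q) (snd q)) (g (fst q) (snd q)) < e / 2"
    using lim unfolding uniform_limit_iff by (meson half_gt_zero)
  then show "\<forall>\<^sub>F n in sequentially. \<forall>p\<in>P. dist (M (f n p)) (M (g p)) < e"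
  proof eventually_elim
    case (elim n)
    show ?case
    proof
      fix p assume p: "p \<in> P"
      have "norm (M (\<lambda>x. f n p x - g p x)) \<le> e / 2"
        using elim p by (intro M_norm) (auto simp: dist_norm less_imp_le)
      then show "dist (M (f n p)) (M (g p)) < e"
        using M_diff[OF assms(1)[OF p, of n] assms(2)[OF p]] \<open>e > 0\<close> by (simp add: dist_norm)
    qed
  qed
qed

definition corr :: "('a \<Rightarrow> complex) \<Rightarrow> 'a \<Rightarrow> complex" where
  "corr u x = M (\<lambda>y. u (x \<otimes> y) * cnj (u y))"

lemma corr_bounded:
  assumes "\<And>x. x \<in> carrier G \<Longrightarrow> norm (u x) \<le> C" "x \<in> carrier G"
  shows "norm (corr u x) \<le> C * C"
  unfolding corr_def
proof (rule M_norm)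
  fix y assume "y \<in> carrier G"
  then show "norm (u (x \<otimes> y) * cnj (u y)) \<le> C * C"
    unfolding norm_mult complex_mod_cnj using assms by (intro mult_mono' assms) auto
qed

lemma bounded_fun_corr: "bounded_fun u \<Longrightarrow> bounded_fun (corr u)"
  unfolding bounded_fun_def using corr_bounded[of u] unfolding bounded_fun_def by metis

lemma corr_one: "corr u \<one> = ip u u"
  unfolding corr_def ip_def by (rule M_cong) simp

lemma sq_translate: "bounded_fun u \<Longrightarrow> a \<in> carrier G \<Longrightarrow> sq (\<lambda>x. u (a \<otimes> x)) = sq u"
  unfolding sq_def ip_def using M_inv[of "\<lambda>x. u x * cnj (u x)" a] by auto

lemma M_comb:
  assumes "bounded_fun A" "bounded_fun A'" "bounded_fun B" "bounded_fun C"
  shows "M (\<lambda>y. k * ((A y + A' y) + (c * B y + d * C y))) = k * ((M A + M A') + (c * M B + d * M C))"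
  using assms by (simp add: M_scale M_add)

text \<open>The two diagonal products both give \<open>corr u x\<close>, by invariance and
  \<open>c * cnj c = 1\<close>; the mixed ones correlate \<open>u\<close> with its translates, which
  produces the arguments \<open>x \<otimes> a\<close> and \<open>x \<otimes> inv a\<close>.\<close>

lemma corr_comb:
  assumes u: "bounded_fun u" and a: "a \<in> carrier G" and c: "norm c = 1" and x: "x \<in> carrier G"
  shows "corr (\<lambda>x. (u x + c * u (a \<otimes> x)) / 2) x
    = (2 * corr u x + c * corr u (x \<otimes> a) + cnj c * corr u (x \<otimes> inv a)) / 4"
proof -
  have cc: "c * cnj c = 1" using c by (metis complex_norm_square of_real_1 one_power2)
  let ?A = "\<lambda>y. u (x \<otimes> y) * cnj (u y)"
  let ?B = "\<lambda>y. u (x \<otimes> a \<otimes> y) * cnj (u y)"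
  let ?C = "\<lambda>y. u (x \<otimes> inv a \<otimes> y) * cnj (u y)"
  have b: "bounded_fun ?A" "bounded_fun ?B" "bounded_fun ?C"
    using u a x by (auto intro!: bounded_fun_mult bounded_fun_translate)
  have ba: "bounded_fun (\<lambda>y. ?A (a \<otimes> y))" "bounded_fun (\<lambda>y. ?C (a \<otimes> y))"
    using b a by (auto intro: bounded_fun_translate[of ?A] bounded_fun_translate[of ?C])
  have "corr (\<lambda>x. (u x + c * u (a \<otimes> x)) / 2) x
      = M (\<lambda>y. (1/4) * ((?A y + ?A (a \<otimes> y)) + (c * ?B y + cnj c * ?C (a \<otimes> y))))"
    unfolding corr_def
  proof (rule M_cong)
    fix y assume y: "y \<in> carrier G"
    have 1: "x \<otimes> inv a \<otimes> (a \<otimes> y) = x \<otimes> y"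
      using a x y by (metis inv_closed m_assoc m_closed r_inv r_one l_inv)
    have 2: "a \<otimes> (x \<otimes> y) = x \<otimes> a \<otimes> y" "x \<otimes> (a \<otimes> y) = x \<otimes> a \<otimes> y" using a x y by (simp_all add: m_ac)
    have "(u (x \<otimes> y) + c * u (a \<otimes> (x \<otimes> y))) / 2 * cnj ((u y + c * u (a \<otimes> y)) / 2)
      = (1/4) * ((u (x \<otimes> y) * cnj (u y) + (c * cnj c) * (u (x \<otimes> a \<otimes> y) * cnj (u (a \<otimes> y))))
          + (c * (u (x \<otimes> a \<otimes> y) * cnj (u y)) + cnj c * (u (x \<otimes> y) * cnj (u (a \<otimes> y)))))"
      unfolding 2 by (simp add: algebra_simps)
    then show "(u (x \<otimes> y) + c * u (a \<otimes> (x \<otimes> y))) / 2 * cnj ((u y + c * u (a \<otimes> y)) / 2)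
       = (1/4) * ((?A y + ?A (a \<otimes> y)) + (c * ?B y + cnj c * ?C (a \<otimes> y)))"
      unfolding 1 2 cc by simp
  qed
  also have "\<dots> = (1/4) * ((M ?A + M (\<lambda>y. ?A (a \<otimes> y))) + (c * M ?B + cnj c * M (\<lambda>y. ?C (a \<otimes> y))))"
    by (rule M_comb) (fact b ba)+
  also have "M (\<lambda>y. ?A (a \<otimes> y)) = M ?A" using M_inv[OF b(1) a] .
  also have "M (\<lambda>y. ?C (a \<otimes> y)) = M ?C" using M_inv[OF b(3) a] .
  finally show ?thesis unfolding corr_def by simp
qed

text \<open>Translation preserves \<open>sq\<close> and \<open>norm c = 1\<close>, so the diagonal
  terms add up to \<open>sq g\<close>, while the cross terms for \<open>c\<close> and
  \<open>- c\<close> cancel.\<close>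

lemma parallelogram:
  assumes "bounded_fun g" "a \<in> carrier G" "norm c = 1"
  shows "sq (\<lambda>x. (g x + c * g (a \<otimes> x)) / 2) + sq (\<lambda>x. (g x + - c * g (a \<otimes> x)) / 2) = sq g"
proof -
  have *: "sq (\<lambda>x. (g x + d * g (a \<otimes> x)) / 2)
      = sq g / 4 + (norm d)\<^sup>2 * sq g / 4 + 2 * Re ((1/2) * cnj (d/2) * ip g (\<lambda>x. g (a \<otimes> x)))" for d
  proof -
    have "sq (\<lambda>x. (g x + d * g (a \<otimes> x)) / 2) = sq (\<lambda>x. (1/2) * g x + (d/2) * g (a \<otimes> x))"
      by (simp add: add_divide_distrib)
    also have "\<dots> = sq g / 4 + (norm d)\<^sup>2 * sq g / 4 + 2 * Re ((1/2) * cnj (d/2) * ip g (\<lambda>x. g (a \<otimes> x)))"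
      using assms(1,2) by (subst sq_comb) (auto simp: sq_translate norm_divide power_divide)
    finally show ?thesis .
  qed
  show ?thesis unfolding *[of c] *[of "- c"] using assms(3) by simp
qed

end

text \<open>Arzela-Ascoli, with finite nets that serve all \<open>n\<close> at once. A diagonal
  subsequence converges on the countable union of the nets for \<open>1 / (m + 1)\<close>, and the
  nets make it uniformly Cauchy.\<close>

lemma uniformly_convergent_subsequence:
  fixes v :: "nat \<Rightarrow> 'a \<Rightarrow> complex"
  assumes bound: "\<And>n x. x \<in> S \<Longrightarrow> norm (v n x) \<le> C"
    and tb: "\<And>\<epsilon>. \<epsilon> > 0 \<Longrightarrow> \<exists>X. finite X \<and> X \<subseteq> S \<and> (\<forall>x\<in>S. \<exists>x'\<in>X. \<forall>n. norm (v n x - v n x') \<le> \<epsilon>)"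
  obtains k l where "strict_mono (k :: nat \<Rightarrow> nat)" "uniform_limit S (\<lambda>n. v (k n)) l sequentially"
proof -
  have "\<exists>X. finite X \<and> X \<subseteq> S \<and> (\<forall>x\<in>S. \<exists>x'\<in>X. \<forall>n. norm (v n x - v n x') \<le> 1 / real (Suc m))" for m
    using tb[of "1 / real (Suc m)"] by simp
  then obtain X where X: "\<And>m. finite (X m)" "\<And>m. X m \<subseteq> S"
    "\<And>m x. x \<in> S \<Longrightarrow> \<exists>x'\<in>X m. \<forall>n. norm (v n x - v n x') \<le> 1 / real (Suc m)"
    by metis
  have "countable (\<Union>m. X m)" using X(1) by (simp add: countable_finite)
  moreover have "norm (v n x) \<le> C" if "x \<in> (\<Union>m. X m)" for n x using that X(2) bound by blast
  ultimately obtain k where k: "strict_mono (k :: nat \<Rightarrow> nat)"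
    "\<And>x. x \<in> (\<Union>m. X m) \<Longrightarrow> \<exists>l. (\<lambda>n. v (k n) x) \<longlonglongrightarrow> l"
    using function_convergent_subsequence[of "\<Union>m. X m" v C] by metis
  have "uniformly_Cauchy_on S (\<lambda>n. v (k n))"
  proof (rule uniformly_Cauchy_onI)
    fix e :: real assume e: "e > 0"
    obtain m where m: "1 / real (Suc m) < e / 3"
      using nat_approx_posE[of "e / 3"] e by auto
    have "\<exists>N. \<forall>i\<ge>N. \<forall>j\<ge>N. dist (v (k i) x) (v (k j) x) < e / 3" if "x \<in> X m" for x
    proof -
      have "Cauchy (\<lambda>n. v (k n) x)" using k(2)[of x] that by (auto intro: LIMSEQ_imp_Cauchy)
      then show ?thesis using e unfolding Cauchy_def by (meson zero_less_divide_iff zero_less_numeral)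
    qed
    then obtain N where N: "\<And>x i j. x \<in> X m \<Longrightarrow> i \<ge> N x \<Longrightarrow> j \<ge> N x \<Longrightarrow> dist (v (k i) x) (v (k j) x) < e / 3"
      by metis
    define N0 where "N0 = Max (insert 0 (N ` X m))"
    have N0: "N x \<le> N0" if "x \<in> X m" for x
      unfolding N0_def by (rule Max_ge) (use that X(1) in auto)
    show "\<exists>M. \<forall>x\<in>S. \<forall>i\<ge>M. \<forall>j\<ge>M. dist (v (k i) x) (v (k j) x) < e"
    proof (intro exI[of _ N0] ballI allI impI)
      fix x i j assume x: "x \<in> S" and ij: "i \<ge> N0" "j \<ge> N0"
      obtain x' where x': "x' \<in> X m" "\<And>n. norm (v n x - v n x') \<le> 1 / real (Suc m)"
        using X(3)[OF x, of m] by blast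
      have "dist (v (k i) x') (v (k j) x') < e / 3"
        using N[OF x'(1), of i j] N0[OF x'(1)] ij by simp
      moreover have "dist (v (k i) x) (v (k i) x') < e / 3" "dist (v (k j) x) (v (k j) x') < e / 3"
        using x'(2)[of "k i"] x'(2)[of "k j"] m by (auto simp: dist_norm)
      ultimately show "dist (v (k i) x) (v (k j) x) < e"
        using dist_triangle[of "v (k i) x" "v (k j) x" "v (k i) x'"]
          dist_triangle[of "v (k i) x'" "v (k j) x" "v (k j) x'"]
        by (simp add: dist_commute)
    qed
  qed
  then have "uniformly_convergent_on S (\<lambda>n. v (k n))" by (rule Cauchy_uniformly_convergent)
  then show ?thesis using that k(1) unfolding uniformly_convergent_on_def by blast
qed

subsection \<open>Continuous characters separate points\<close>

context mean
begin

abbreviation nrm :: "('a \<Rightarrow> complex) \<Rightarrow> real" where "nrm u \<equiv> sqrt (sq u)"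

text \<open>Convolution of \<open>f\<close> with the reflection of \<open>g\<close>. Taking
  \<open>x \<otimes> y\<close> in place of \<open>x \<otimes> inv y\<close> keeps inversion out,
  since \<open>M\<close> is only assumed invariant under translations.\<close>

definition cnv :: "('a \<Rightarrow> complex) \<Rightarrow> ('a \<Rightarrow> complex) \<Rightarrow> 'a \<Rightarrow> complex" where
  "cnv f g x = M (\<lambda>y. f (x \<otimes> y) * g y)"

text \<open>Substitute \<open>a \<otimes> y\<close> for \<open>y\<close>. A translate of a
  convolution is thus the convolution with a function of the same seminorm, so the class in which
  the maximum is sought is closed under translations.\<close>

lemma cnv_translate:
  assumes "bounded_fun f" "bounded_fun g" "a \<in> carrier G" "x \<in> carrier G"
  shows "cnv f (\<lambda>y. g (inv a \<otimes> y)) x = cnv f g (a \<otimes> x)"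
proof -
  have "cnv f (\<lambda>y. g (inv a \<otimes> y)) x = M (\<lambda>y. f (x \<otimes> (a \<otimes> y)) * g (inv a \<otimes> (a \<otimes> y)))"
    unfolding cnv_def using assms
    by (intro M_inv[symmetric, of "\<lambda>y. f (x \<otimes> y) * g (inv a \<otimes> y)"] bounded_fun_mult bounded_fun_translate) auto
  also have "\<dots> = cnv f g (a \<otimes> x)"
    unfolding cnv_def
  proof (rule M_cong)
    fix y assume "y \<in> carrier G"
    then show "f (x \<otimes> (a \<otimes> y)) * g (inv a \<otimes> (a \<otimes> y)) = f (a \<otimes> x \<otimes> y) * g y"
      using assms by (simp add: m_assoc[symmetric]) (simp add: m_comm)
  qed
  finally show ?thesis .
qed

lemma cnv_comb:
  assumes "bounded_fun f" "bounded_fun g" "bounded_fun h" "x \<in> carrier G"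
  shows "cnv f (\<lambda>y. (g y + c * h y) / 2) x = (cnv f g x + c * cnv f h x) / 2"
proof -
  have "cnv f (\<lambda>y. (g y + c * h y) / 2) x = M (\<lambda>y. (1/2) * (f (x \<otimes> y) * g y) + (c / 2) * (f (x \<otimes> y) * h y))"
    unfolding cnv_def by (rule M_cong) (simp add: algebra_simps)
  also have "\<dots> = (1/2) * cnv f g x + (c/2) * cnv f h x"
    unfolding cnv_def using assms by (subst M_add) (auto simp only: M_scale bounded_fun_mult bounded_fun_const bounded_fun_translate)
  finally show ?thesis by (simp add: add_divide_distrib)
qed

lemma cnv_scale:
  assumes "bounded_fun f" "bounded_fun g" "x \<in> carrier G"
  shows "cnv f (\<lambda>y. c * g y) x = c * cnv f g x"
proof -
  have "cnv f (\<lambda>y. c * g y) x = M (\<lambda>y. c * (f (x \<otimes> y) * g y))"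
    unfolding cnv_def by (rule M_cong) simp
  then show ?thesis unfolding cnv_def using assms by (simp add: M_scale)
qed

lemma bounded_fun_cnv:
  assumes "bounded_fun f" "bounded_fun g" shows "bounded_fun (cnv f g)"
proof -
  obtain A B where A: "\<And>x. x \<in> carrier G \<Longrightarrow> norm (f x) \<le> A" and B: "\<And>x. x \<in> carrier G \<Longrightarrow> norm (g x) \<le> B"
    using assms unfolding bounded_fun_def by metis
  show ?thesis
  proof (rule bounded_funI)
    fix x assume "x \<in> carrier G"
    then show "norm (cnv f g x) \<le> A * B"
      unfolding cnv_def norm_mult by (intro M_norm) (auto simp: norm_mult intro!: mult_mono' A B)
  qed
qed

lemma corr_cong: "(\<And>x. x \<in> carrier G \<Longrightarrow> u x = v x) \<Longrightarrow> x \<in> carrier G \<Longrightarrow> corr u x = corr v x"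
  unfolding corr_def by (rule M_cong) auto

lemma sq_cong: "(\<And>x. x \<in> carrier G \<Longrightarrow> u x = v x) \<Longrightarrow> sq u = sq v"
  unfolding sq_def ip_def by (rule arg_cong[where f = Re], rule M_cong) auto

lemma corr_scale:
  assumes "bounded_fun u" "x \<in> carrier G"
  shows "corr (\<lambda>x. c * u x) x = of_real ((norm c)\<^sup>2) * corr u x"
proof -
  have "corr (\<lambda>x. c * u x) x = M (\<lambda>y. (c * cnj c) * (u (x \<otimes> y) * cnj (u y)))"
    unfolding corr_def by (rule M_cong) (simp add: algebra_simps)
  then show ?thesis unfolding corr_def complex_norm_square using assms by (simp add: M_scale)
qed

lemma corr_uniform_limit:
  assumes u: "\<And>n. bounded_fun (u n)" "bounded_fun v"
    and lim: "uniform_limit (carrier G) u v sequentially"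
  shows "uniform_limit (carrier G) (\<lambda>n. corr (u n)) (corr v) sequentially"
  unfolding corr_def
proof (rule M_uniform_limit)
  have 1: "uniform_limit (carrier G \<times> carrier G) (\<lambda>n q. u n (fst q \<otimes> snd q)) (\<lambda>q. v (fst q \<otimes> snd q)) sequentially"
    using uniform_limit_compose'[OF lim, of "\<lambda>q. fst q \<otimes> snd q" "carrier G \<times> carrier G"] by (auto simp: Pi_iff)
  have "uniform_limit (carrier G \<times> carrier G) (\<lambda>n q. u n (snd q)) (\<lambda>q. v (snd q)) sequentially"
    using uniform_limit_compose'[OF lim, of "snd" "carrier G \<times> carrier G"] by (auto simp: Pi_iff)
  then have 2: "uniform_limit (carrier G \<times> carrier G) (\<lambda>n q. cnj (u n (snd q))) (\<lambda>q. cnj (v (snd q))) sequentially"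
    unfolding uniform_limit_iff dist_norm complex_cnj_diff[symmetric] complex_mod_cnj .
  obtain C where C: "\<And>x. x \<in> carrier G \<Longrightarrow> norm (v x) \<le> C" using u(2) unfolding bounded_fun_def by blast
  show "uniform_limit (carrier G \<times> carrier G) (\<lambda>n q. u n (fst q \<otimes> snd q) * cnj (u n (snd q)))
     (\<lambda>q. v (fst q \<otimes> snd q) * cnj (v (snd q))) sequentially"
    by (rule uniform_lim_mult[OF 1 2]) (use C in \<open>auto intro!: boundedI[of _ C]\<close>)
qed (use u in \<open>auto intro!: bounded_fun_mult\<close>)

lemma sq_tendsto:
  assumes u: "\<And>n. bounded_fun (u n)" "bounded_fun v"
    and lim: "uniform_limit (carrier G) u v sequentially"
  shows "(\<lambda>n. sq (u n)) \<longlonglongrightarrow> sq v"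
  unfolding sq_def ip_def
proof (intro tendsto_Re M_tendsto)
  have 2: "uniform_limit (carrier G) (\<lambda>n q. cnj (u n q)) (\<lambda>q. cnj (v q)) sequentially"
    using lim unfolding uniform_limit_iff dist_norm complex_cnj_diff[symmetric] complex_mod_cnj .
  obtain C where C: "\<And>x. x \<in> carrier G \<Longrightarrow> norm (v x) \<le> C" using u(2) unfolding bounded_fun_def by blast
  show "uniform_limit (carrier G) (\<lambda>n q. u n q * cnj (u n q)) (\<lambda>q. v q * cnj (v q)) sequentially"
    by (rule uniform_lim_mult[OF lim 2]) (use C in \<open>auto intro!: boundedI[of _ C]\<close>)
qed (use u in auto)

end

section \<open>Means of continuous functions and the extremal problem\<close>

locale compact_mean = compact_abelian_group + mean
begin

text \<open>If \<open>v x0 \<noteq> 0\<close>, then \<open>|v| > e\<close> on an open set, finitely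
  many translates of which cover the group. The sum of the translated \<open>|v|^2\<close> is at
  least \<open>e^2\<close> everywhere, and so is its mean, yet each summand has mean 0.\<close>

lemma sq_eq_0:
  assumes v: "cfun v" and s: "sq v = 0" and x0: "x0 \<in> carrier G"
  shows "v x0 = 0"
proof (rule ccontr)
  assume nz: "v x0 \<noteq> 0"
  define e where "e = norm (v x0) / 2"
  have e: "e > 0" using nz by (simp add: e_def)
  \<comment> \<open>Translation by \<open>a x\<close> carries \<open>x\<close> to \<open>x0\<close>,
    so \<open>V x\<close> is a neighbourhood of \<open>x\<close>.\<close>
  define a where "a x = x0 \<otimes> inv x" for x
  have a: "a x \<in> carrier G" "a x \<otimes> x = x0" if "x \<in> carrier G" for x
    using that x0 by (auto simp: a_def m_assoc)
  define V where "V x = {y \<in> topspace T. v (a x \<otimes> y) \<in> - cball 0 e}" for x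
  obtain X where X: "finite X" "X \<subseteq> carrier G" "carrier G \<subseteq> (\<Union>x\<in>X. V x)"
  proof (rule finite_subcover[of V])
    fix x assume x: "x \<in> carrier G"
    show "openin T (V x)" unfolding V_def
      by (rule openin_continuous_map_preimage[OF cfun_translate[OF v a(1)[OF x]]]) (simp add: open_openin[symmetric] open_Compl)
    show "x \<in> V x" using x a[OF x] nz by (auto simp: V_def topspace e_def)
  qed
  let ?f = "\<lambda>x y. v (a x \<otimes> y) * cnj (v (a x \<otimes> y))"
  have vb: "bounded_fun v" using v by (rule cfun_bounded)
  have fb: "bounded_fun (?f x)" if "x \<in> X" for x
    using that X(2) a(1) vb by (auto intro!: bounded_fun_mult)
  have "0 \<le> Re (M (\<lambda>y. (\<Sum>x\<in>X. ?f x y) - of_real (e\<^sup>2)))"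
  proof (rule M_pos)
    show "bounded_fun (\<lambda>y. (\<Sum>x\<in>X. ?f x y) - of_real (e\<^sup>2))" using fb by auto
    fix y assume y: "y \<in> carrier G"
    then obtain x where x: "x \<in> X" "y \<in> V x" using X(3) by auto
    have re: "Re (?f x y) = (norm (v (a x \<otimes> y)))\<^sup>2" for x
      by (metis complex_norm_square Re_complex_of_real)
    have "e\<^sup>2 \<le> (norm (v (a x \<otimes> y)))\<^sup>2" using x(2) e by (intro power_mono) (auto simp: V_def)
    also have "\<dots> \<le> (\<Sum>x\<in>X. (norm (v (a x \<otimes> y)))\<^sup>2)"
      using X(1) x(1) by (intro member_le_sum) auto
    finally show "0 \<le> Re ((\<Sum>x\<in>X. ?f x y) - of_real (e\<^sup>2))" using re by simp
  qed
  also have "M (\<lambda>y. (\<Sum>x\<in>X. ?f x y) - of_real (e\<^sup>2)) = (\<Sum>x\<in>X. M (?f x)) - of_real (e\<^sup>2)"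
    using fb X(1) by (subst M_diff) (auto simp: M_sum M_const)
  also have "Re \<dots> = (\<Sum>x\<in>X. sq (\<lambda>y. v (a x \<otimes> y))) - e\<^sup>2" by (simp add: sq_def ip_def)
  also have "(\<Sum>x\<in>X. sq (\<lambda>y. v (a x \<otimes> y))) = 0"
    using X(2) a(1) vb s by (intro sum.neutral) (auto simp: sq_translate)
  finally show False using e by simp
qed

text \<open>Continuity comes from the equicontinuity of the translates of \<open>f\<close>;
  \<open>g\<close> enters only through a bound.\<close>

lemma cnv_cont:
  assumes f: "cfun f" and g: "bounded_fun g" shows "cfun (cnv f g)"
  unfolding cfun_eq
proof (intro ballI allI impI)
  fix x \<epsilon> assume x: "x \<in> carrier G" and e: "\<epsilon> > (0::real)"
  obtain C' where "\<And>x. x \<in> carrier G \<Longrightarrow> norm (g x) \<le> C'" using g unfolding bounded_fun_def by blast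
  then obtain C where C: "\<And>x. x \<in> carrier G \<Longrightarrow> norm (g x) \<le> C" "C > 0"
    by (meson less_eq_real_def linorder_le_less_linear order_trans zero_less_one)
  obtain V where V: "openin T V" "x \<in> V" "\<And>z y. z \<in> V \<Longrightarrow> y \<in> carrier G \<Longrightarrow> norm (f (z \<otimes> y) - f (x \<otimes> y)) < \<epsilon> / (2 * C)"
    using cfun_equicontinuous[OF f x, of "\<epsilon> / (2 * C)"] e C(2) by (metis divide_pos_pos mult_pos_pos zero_less_numeral)
  have "norm (cnv f g z - cnv f g x) < \<epsilon>" if z: "z \<in> V" for z
  proof -
    have zc: "z \<in> carrier G" using z V(1) openin_subset topspace by blast
    have fb: "bounded_fun f" using f by (rule cfun_bounded)
    have "cnv f g z - cnv f g x = M (\<lambda>y. f (z \<otimes> y) * g y - f (x \<otimes> y) * g y)"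
      unfolding cnv_def using zc x fb g by (subst M_diff) auto
    also have "norm \<dots> \<le> \<epsilon> / (2 * C) * C"
    proof (rule M_norm)
      fix y assume y: "y \<in> carrier G"
      show "norm (f (z \<otimes> y) * g y - f (x \<otimes> y) * g y) \<le> \<epsilon> / (2 * C) * C"
        unfolding left_diff_distrib[symmetric] norm_mult using V(3)[OF z y] C(1)[OF y] by (intro mult_mono') auto
    qed
    also have "\<dots> < \<epsilon>" using C(2) e by simp
    finally show ?thesis .
  qed
  then show "\<exists>V. openin T V \<and> x \<in> V \<and> (\<forall>y\<in>V. norm (cnv f g y - cnv f g x) < \<epsilon>)"
    using V(1,2) by blast
qed

lemma corr_cont: "cfun u \<Longrightarrow> cfun (corr u)"
  using cnv_cont[of u "\<lambda>y. cnj (u y)"] cfun_bounded unfolding cnv_def corr_def[abs_def] by blast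

lemma cfun_uniform_limit:
  assumes "\<And>n. cfun (u n)" "uniform_limit (carrier G) u v sequentially"
  shows "cfun v"
  unfolding cfun_eq
proof (intro ballI allI impI)
  fix x \<epsilon> assume x: "x \<in> carrier G" and e: "\<epsilon> > (0::real)"
  have "\<forall>\<^sub>F n in sequentially. \<forall>x\<in>carrier G. dist (u n x) (v x) < \<epsilon> / 3"
    using assms(2) e unfolding uniform_limit_iff by (meson divide_pos_pos zero_less_numeral)
  then obtain n where n: "\<And>x. x \<in> carrier G \<Longrightarrow> dist (u n x) (v x) < \<epsilon> / 3"
    by (auto simp: eventually_sequentially)
  obtain V where V: "openin T V" "x \<in> V" "\<And>y. y \<in> V \<Longrightarrow> norm (u n y - u n x) < \<epsilon> / 3"
    using assms(1)[of n] x e unfolding cfun_eq by (meson divide_pos_pos zero_less_numeral)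
  have "norm (v y - v x) < \<epsilon>" if y: "y \<in> V" for y
  proof -
    have "y \<in> carrier G" using y V(1) openin_subset topspace by blast
    then show ?thesis
      using n[of y] n[OF x] V(3)[OF y] dist_triangle[of "v y" "v x" "u n y"] dist_triangle[of "u n y" "v x" "u n x"]
      by (simp add: dist_norm norm_minus_commute)
  qed
  then show "\<exists>V. openin T V \<and> x \<in> V \<and> (\<forall>y\<in>V. norm (v y - v x) < \<epsilon>)" using V(1,2) by blast
qed

text \<open>\<open>s\<close> is the supremum of \<open>J\<close> over the unit ball of
  \<open>sq\<close>, and \<open>g\<close> a maximising sequence. Since \<open>J\<close> scales
  quadratically, the bound on the ball becomes \<open>J h \<le> s * sq h\<close>, the form that
  combines with the parallelogram law.\<close>

lemma corr_sup:
  assumes f: "cfun f" and x0: "x0 \<in> carrier G" "f x0 \<noteq> 0"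
  obtains s g where "s > 0" "\<And>n. bounded_fun (g n)" "\<And>n. sq (g n) \<le> 1"
    "(\<lambda>n::nat. nrm (corr (cnv f (g n)))) \<longlonglongrightarrow> s"
    "\<And>h. bounded_fun h \<Longrightarrow> nrm (corr (cnv f h)) \<le> s * sq h"
proof -
  have fb: "bounded_fun f" using f by (rule cfun_bounded)
  define J where "J h = nrm (corr (cnv f h))" for h
  define B where "B = {h. bounded_fun h \<and> sq h \<le> 1}"
  have J0: "0 \<le> J h" if "bounded_fun h" for h
    unfolding J_def using that fb by (simp add: sq_nonneg bounded_fun_corr bounded_fun_cnv)
  obtain C' where "\<And>x. x \<in> carrier G \<Longrightarrow> norm (f x) \<le> C'" using fb unfolding bounded_fun_def by blast
  then obtain C where C: "\<And>x. x \<in> carrier G \<Longrightarrow> norm (f x) \<le> C" "C > 0"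
    by (meson less_eq_real_def linorder_le_less_linear order_trans zero_less_one)
  have JB: "J h \<le> C * C" if "h \<in> B" for h
  proof -
    have h: "bounded_fun h" "sq h \<le> 1" using that by (auto simp: B_def)
    have "norm (cnv f h x) \<le> C" if "x \<in> carrier G" for x
      unfolding cnv_def using that C by (intro M_mult_le[OF h]) auto
    then have "norm (corr (cnv f h) x) \<le> C * C" if "x \<in> carrier G" for x
      using that by (intro corr_bounded)
    then have "sq (corr (cnv f h)) \<le> (C * C)\<^sup>2"
      using h fb by (intro sq_le bounded_fun_corr bounded_fun_cnv) auto
    then show ?thesis unfolding J_def using C(2) by (intro real_le_lsqrt) auto
  qed
  have bdd: "bdd_above (J ` B)" using JB by (auto simp: bdd_above_def)
  have "sq (\<lambda>_. 0) = 0" using sq_scale[of "\<lambda>_. 0" 0] by simp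
  then have ne: "(\<lambda>_. 0) \<in> B" by (simp add: B_def)
  define s where "s = Sup (J ` B)"
  have le_s: "J h \<le> s" if "h \<in> B" for h
    unfolding s_def using that bdd by (intro cSup_upper) auto
  have "\<exists>h\<in>B. s - 1 / real (Suc n) < J h" for n
  proof -
    have "s - 1 / real (Suc n) < Sup (J ` B)" by (simp add: s_def)
    then show ?thesis using less_cSup_iff[of "J ` B"] ne bdd by auto
  qed
  then obtain g where g: "\<And>n. g n \<in> B" "\<And>n. s - 1 / real (Suc n) < J (g n)" by metis
  have lim: "(\<lambda>n. J (g n)) \<longlonglongrightarrow> s"
  proof (rule tendsto_sandwich[of "\<lambda>n. s - 1 / real (Suc n)" _ _ "\<lambda>_. s"])
    show "(\<lambda>n. s - 1 / real (Suc n)) \<longlonglongrightarrow> s"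
      using tendsto_diff[OF tendsto_const LIMSEQ_inverse_real_of_nat, of s] by (simp add: inverse_eq_divide)
  qed (use g le_s in \<open>auto intro!: always_eventually less_imp_le\<close>)
  have Js: "J (\<lambda>y. of_real c * h y) = c\<^sup>2 * J h" if h: "bounded_fun h" for c h
  proof -
    have "sq (corr (cnv f (\<lambda>y. of_real c * h y))) = sq (\<lambda>x. of_real (c\<^sup>2) * corr (cnv f h) x)"
    proof (rule sq_cong)
      fix x assume x: "x \<in> carrier G"
      have "corr (cnv f (\<lambda>y. of_real c * h y)) x = corr (\<lambda>x. of_real c * cnv f h x) x"
        using x h fb by (intro corr_cong cnv_scale)
      also have "\<dots> = of_real (c\<^sup>2) * corr (cnv f h) x"
        using x h fb by (subst corr_scale) (auto simp: bounded_fun_cnv)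
      finally show "corr (cnv f (\<lambda>y. of_real c * h y)) x = of_real (c\<^sup>2) * corr (cnv f h) x" .
    qed
    also have "\<dots> = (c\<^sup>2)\<^sup>2 * sq (corr (cnv f h))"
      using h fb by (subst sq_scale) (auto simp: bounded_fun_cnv bounded_fun_corr norm_power)
    finally show ?thesis unfolding J_def by (simp only: real_sqrt_mult real_sqrt_abs abs_power2)
  qed
  have hom: "J h \<le> s * sq h" if h: "bounded_fun h" for h
  proof -
    have s0: "0 \<le> s" using le_s[OF ne] J0[of "\<lambda>_. 0"] by simp
    \<comment> \<open>\<open>sq h\<close> may vanish, so \<open>h\<close> is normalised by
      \<open>sq h + \<epsilon>\<close>, and \<open>\<epsilon>\<close> is removed afterwards.\<close>
    have "J h \<le> s * (sq h + \<epsilon>)" if e: "\<epsilon> > 0" for \<epsilon>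
    proof -
      define t where "t = sq h + \<epsilon>"
      have t: "t > 0" using e sq_nonneg[OF h] by (simp add: t_def)
      define c where "c = 1 / sqrt t"
      have c2: "c\<^sup>2 = 1 / t" using t by (simp add: c_def power_divide)
      have "sq (\<lambda>y. of_real c * h y) = c\<^sup>2 * sq h" using h by (simp add: sq_scale)
      also have "\<dots> \<le> 1" using t e by (simp add: c2 t_def)
      finally have "(\<lambda>y. of_real c * h y) \<in> B" using h by (auto simp: B_def)
      then have "c\<^sup>2 * J h \<le> s" using le_s Js[OF h] by metis
      then have "J h \<le> s * t" using t by (simp add: c2 field_simps)
      then show ?thesis by (simp only: t_def)
    qed
    then have "J h \<le> s * sq h + \<epsilon>'" if "\<epsilon>' > 0" for \<epsilon>'
    proof (cases "s = 0")
      case True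
      then show ?thesis using \<open>\<And>\<epsilon>. \<epsilon> > 0 \<Longrightarrow> J h \<le> s * (sq h + \<epsilon>)\<close>[of 1] that by simp
    next
      case False
      then show ?thesis using \<open>\<And>\<epsilon>. \<epsilon> > 0 \<Longrightarrow> J h \<le> s * (sq h + \<epsilon>)\<close>[of "\<epsilon>' / s"] that s0 by (simp add: distrib_left)
    qed
    then show ?thesis by (rule field_le_epsilon)
  qed
  \<comment> \<open>Test with the conjugate of \<open>f\<close>: definiteness on continuous
    functions leads from the vanishing correlation to the vanishing convolution, whose value at
    \<open>\<one>\<close> is \<open>ip f f\<close>, and from there to
    \<open>f x0 = 0\<close>.\<close>
  have "s \<noteq> 0"
  proof
    assume s: "s = 0"
    let ?h = "\<lambda>y. cnj (f y)"
    have hb: "bounded_fun ?h" using fb by auto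
    have cc: "cfun (cnv f ?h)" using f hb by (rule cnv_cont)
    have "J ?h = 0" using hom[OF hb] J0[OF hb] s by simp
    then have "sq (corr (cnv f ?h)) = 0" by (simp add: J_def)
    then have "corr (cnv f ?h) \<one> = 0" by (rule sq_eq_0[OF corr_cont[OF cc]]) simp
    then have "sq (cnv f ?h) = 0" by (simp add: corr_one sq_def)
    then have "cnv f ?h \<one> = 0" by (rule sq_eq_0[OF cc]) simp
    moreover have "cnv f ?h \<one> = ip f f" unfolding cnv_def ip_def by (rule M_cong) simp
    ultimately have "sq f = 0" by (simp add: sq_def)
    then show False using sq_eq_0[OF f _ x0(1)] x0(2) by simp
  qed
  moreover have "0 \<le> s" using le_s[OF ne] J0[of "\<lambda>_. 0"] by simp
  ultimately show ?thesis
    using that[of s g] g(1) lim hom unfolding J_def B_def by auto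
qed

end

lemma (in comm_group) bounded_fun_divide: "bounded_fun f \<Longrightarrow> bounded_fun (\<lambda>x. f x / c)"
  using bounded_fun_mult[OF _ bounded_fun_const, of f "inverse c"] by (simp add: divide_inverse)

context compact_abelian_group
begin

lemma cfun_add: "cfun f \<Longrightarrow> cfun g \<Longrightarrow> cfun (\<lambda>x. f x + g x)"
  by (rule continuous_map_add)

lemma cfun_diff: "cfun f \<Longrightarrow> cfun g \<Longrightarrow> cfun (\<lambda>x. f x - g x)"
  by (rule continuous_map_diff)

lemma cfun_scale: "cfun f \<Longrightarrow> cfun (\<lambda>x. c * f x)"
  using continuous_map_compose[of T euclidean f euclidean "\<lambda>z. c * z"]
  by (simp add: o_def continuous_on_mult_left)

end

context compact_mean
begin

text \<open>\<open>ext\<close> forces equality in Minkowski's inequality for the two halves of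
  \<open>\<psi> = p + q\<close>, so both are multiples of \<open>\<psi>\<close>. Hence
  \<open>\<psi>\<close> is an eigenfunction of every translation, and dividing it by its value at
  \<open>\<one>\<close> gives the character.\<close>

lemma translation_eigenfunction:
  assumes u: "cfun u" and s: "s > 0" "nrm (corr u) = s"
    and ext: "\<And>a c. a \<in> carrier G \<Longrightarrow> norm c = 1 \<Longrightarrow>
      nrm (corr (\<lambda>x. (u x + c * u (a \<otimes> x)) / 2)) + nrm (corr (\<lambda>x. (u x + - c * u (a \<otimes> x)) / 2)) \<le> s"
  obtains ch where "cfun ch" "\<And>x. x \<in> carrier G \<Longrightarrow> norm (ch x) = 1"
    "\<And>x y. x \<in> carrier G \<Longrightarrow> y \<in> carrier G \<Longrightarrow> ch (x \<otimes> y) = ch x * ch y"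
    "\<And>a x. a \<in> carrier G \<Longrightarrow> x \<in> carrier G \<Longrightarrow> u (a \<otimes> x) = ch a * u x" "sq u > 0"
proof -
  define \<psi> where "\<psi> = corr u"
  have ub: "bounded_fun u" and psib: "bounded_fun \<psi>" and psic: "cfun \<psi>"
    using u corr_cont cfun_bounded by (auto simp: \<psi>_def)
  have sq_psi: "sq \<psi> = s\<^sup>2" using s sq_nonneg[OF psib] by (auto simp: \<psi>_def)
  have su: "sq u > 0"
  proof (rule ccontr)
    assume "\<not> sq u > 0"
    then have "sq u = 0" using sq_nonneg[OF ub] by simp
    then have "u x = 0" if "x \<in> carrier G" for x using sq_eq_0[OF u _ that] by blast
    then have "sq \<psi> \<le> 0\<^sup>2"
      using corr_bounded[of u 0] by (intro sq_le[OF psib]) (auto simp: \<psi>_def)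
    then show False using sq_psi s by simp
  qed
  have psi1: "\<psi> \<one> = of_real (sq u)" using ub by (simp add: \<psi>_def corr_one ip_self)
  have shift: "\<exists>\<tau>::complex. \<forall>x\<in>carrier G. c * \<psi> (x \<otimes> a) + cnj c * \<psi> (x \<otimes> inv a) = \<tau> * \<psi> x"
    if a: "a \<in> carrier G" and c: "norm c = 1" for a c
  proof -
    define p where "p = corr (\<lambda>x. (u x + c * u (a \<otimes> x)) / 2)"
    define q where "q = corr (\<lambda>x. (u x + - c * u (a \<otimes> x)) / 2)"
    have cu: "cfun (\<lambda>x. (u x + d * u (a \<otimes> x)) / 2)" for d
      using cfun_scale[OF cfun_add[OF u cfun_scale[OF cfun_translate[OF u a], of d]], of "1/2"] by simp
    have pc: "cfun p" and qc: "cfun q" unfolding p_def q_def by (intro corr_cont cu)+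
    have pb: "bounded_fun p" and qb: "bounded_fun q" using pc qc cfun_bounded by auto
    have p: "p x = (2 * \<psi> x + c * \<psi> (x \<otimes> a) + cnj c * \<psi> (x \<otimes> inv a)) / 4" if "x \<in> carrier G" for x
      unfolding p_def \<psi>_def by (rule corr_comb[OF ub a c that])
    have q: "q x = (2 * \<psi> x - c * \<psi> (x \<otimes> a) - cnj c * \<psi> (x \<otimes> inv a)) / 4" if "x \<in> carrier G" for x
      using corr_comb[OF ub a _ that, of "- c"] c unfolding q_def \<psi>_def by simp
    have pq: "p x + q x = \<psi> x" if "x \<in> carrier G" for x
      unfolding p[OF that] q[OF that] by (simp add: add_divide_distrib diff_divide_distrib)
    define A B where "A = nrm p" and "B = nrm q"
    have AB: "A \<ge> 0" "B \<ge> 0" "A\<^sup>2 = sq p" "B\<^sup>2 = sq q"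
      using sq_nonneg[OF pb] sq_nonneg[OF qb] by (auto simp: A_def B_def)
    have ABs: "A + B \<le> s" unfolding A_def B_def p_def q_def by (rule ext[OF a c])
    have "s\<^sup>2 = sq (\<lambda>x. 1 * p x + 1 * q x)"
      unfolding sq_psi[symmetric] by (rule sq_cong) (simp add: pq)
    also have "\<dots> = A\<^sup>2 + B\<^sup>2 + 2 * Re (ip p q)" using sq_comb[OF pb qb, of 1 1] AB by simp
    finally have s2: "s\<^sup>2 = A\<^sup>2 + B\<^sup>2 + 2 * Re (ip p q)" .
    moreover have "(A + B)\<^sup>2 \<le> s\<^sup>2" using ABs AB by (intro power_mono) auto
    ultimately have ipAB: "A * B \<le> Re (ip p q)" by (simp add: power2_sum)
    \<comment> \<open>The equality case of Cauchy-Schwarz: with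
      \<open>A * B \<le> Re (ip p q)\<close> this square is at most 0, and definiteness makes
      \<open>B p = A q\<close> pointwise.\<close>
    have "sq (\<lambda>x. of_real B * p x + (- of_real A) * q x) = B\<^sup>2 * A\<^sup>2 + A\<^sup>2 * B\<^sup>2 - 2 * (A * B) * Re (ip p q)"
      using sq_comb[OF pb qb, of "of_real B" "- of_real A"] AB by simp
    also have "\<dots> \<le> B\<^sup>2 * A\<^sup>2 + A\<^sup>2 * B\<^sup>2 - 2 * (A * B) * (A * B)"
      using ipAB AB by (intro diff_left_mono mult_left_mono) auto
    also have "\<dots> = 0" by (simp add: power2_eq_square)
    finally have "sq (\<lambda>x. of_real B * p x + (- of_real A) * q x) = 0"
      using sq_nonneg[of "\<lambda>x. of_real B * p x + (- of_real A) * q x"] pb qb by auto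
    moreover have "cfun (\<lambda>x. of_real B * p x + (- of_real A) * q x)"
      by (rule cfun_add[OF cfun_scale[OF pc] cfun_scale[OF qc]])
    ultimately have Bp: "of_real B * p x = of_real A * q x" if "x \<in> carrier G" for x
      using sq_eq_0[OF _ _ that] by force
    have ABpos: "A + B > 0"
    proof (rule ccontr)
      assume "\<not> A + B > 0"
      then have "A = 0" "B = 0" using AB by auto
      then have "sq p = 0" "sq q = 0" using AB by auto
      then have "p \<one> = 0" "q \<one> = 0" using sq_eq_0[OF pc] sq_eq_0[OF qc] by auto
      then show False using pq[of \<one>] psi1 su by simp
    qed
    show ?thesis
    proof (intro exI ballI)
      fix x assume x: "x \<in> carrier G"
      have "of_real (A + B) * p x = of_real A * (p x + q x)"
        using Bp[OF x] by (simp add: algebra_simps)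
      then have "p x = of_real (A / (A + B)) * \<psi> x"
        using ABpos pq[OF x] by (simp add: field_simps flip: of_real_add)
      moreover have "c * \<psi> (x \<otimes> a) + cnj c * \<psi> (x \<otimes> inv a) = 4 * p x - 2 * \<psi> x"
        unfolding p[OF x] by (simp add: add_divide_distrib)
      ultimately show "c * \<psi> (x \<otimes> a) + cnj c * \<psi> (x \<otimes> inv a) = (4 * of_real (A / (A + B)) - 2) * \<psi> x"
        by (simp only: left_diff_distrib mult.assoc)
    qed
  qed
  have mult: "\<psi> (x \<otimes> a) * \<psi> \<one> = \<psi> x * \<psi> a" if a: "a \<in> carrier G" and x: "x \<in> carrier G" for a x
  proof -
    \<comment> \<open>The choices \<open>c = 1\<close> and \<open>c = \<i>\<close> give the sum and,
      up to the factor \<open>\<i>\<close>, the difference of the two translates; together they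
      isolate \<open>\<psi> (x \<otimes> a)\<close>.\<close>
    obtain \<tau>1 \<tau>2 where t1: "\<And>x. x \<in> carrier G \<Longrightarrow> \<psi> (x \<otimes> a) + \<psi> (x \<otimes> inv a) = \<tau>1 * \<psi> x"
      and t2: "\<And>x. x \<in> carrier G \<Longrightarrow> \<i> * \<psi> (x \<otimes> a) + - \<i> * \<psi> (x \<otimes> inv a) = \<tau>2 * \<psi> x"
      using shift[OF a, of 1] shift[OF a, of \<i>] by auto
    define \<kappa> where "\<kappa> = (\<tau>1 - \<i> * \<tau>2) / 2"
    have "\<psi> (x \<otimes> a) = \<kappa> * \<psi> x" if "x \<in> carrier G" for x
    proof -
      have "2 * \<psi> (x \<otimes> a) = (\<psi> (x \<otimes> a) + \<psi> (x \<otimes> inv a)) - \<i> * (\<i> * \<psi> (x \<otimes> a) + - \<i> * \<psi> (x \<otimes> inv a))"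
        by (simp add: algebra_simps)
      then show ?thesis unfolding t1[OF that] t2[OF that] \<kappa>_def by (simp add: algebra_simps)
    qed
    from this[OF x] this[OF one_closed] show ?thesis using a by simp
  qed
  define ch where "ch x = \<psi> x / \<psi> \<one>" for x
  have nz: "\<psi> \<one> \<noteq> 0" using psi1 su by simp
  have hom: "ch (x \<otimes> y) = ch x * ch y" if "x \<in> carrier G" "y \<in> carrier G" for x y
    using mult[OF that(2,1)] nz by (simp add: ch_def field_simps)
  have psi_ip: "\<psi> a = ip (\<lambda>y. u (a \<otimes> y)) u" for a unfolding \<psi>_def corr_def ip_def ..
  have le1: "norm (ch x) \<le> 1" if x: "x \<in> carrier G" for x
  proof -
    have "norm (\<psi> x) \<le> sq u"
      unfolding psi_ip by (rule norm_ip_le) (use x ub in \<open>auto simp: sq_translate\<close>)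
    then show ?thesis using su by (simp add: ch_def psi1 norm_divide)
  qed
  have n1: "norm (ch x) = 1" if x: "x \<in> carrier G" for x
  proof -
    have "ch x * ch (inv x) = 1" using hom[of x "inv x"] x nz by (simp add: ch_def)
    then have "norm (ch x) * norm (ch (inv x)) = 1" by (metis norm_mult norm_one)
    moreover have "norm (ch x) * norm (ch (inv x)) \<le> norm (ch x) * 1"
      using le1[of "inv x"] x by (intro mult_left_mono) auto
    ultimately show ?thesis using le1[OF x] by simp
  qed
  have eig: "u (a \<otimes> x) = ch a * u x" if a: "a \<in> carrier G" and x: "x \<in> carrier G" for a x
  proof -
    have ab: "bounded_fun (\<lambda>y. u (a \<otimes> y))" using ub a by auto
    \<comment> \<open>This is the cross term that makes the square of
      \<open>u (a \<otimes> y) - ch a * u y\<close> equal to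
      \<open>2 * sq u - 2 * sq u = 0\<close>.\<close>
    have "cnj (ch a) * \<psi> a = of_real (sq u)"
    proof -
      have "cnj (ch a) * \<psi> a = (ch a * cnj (ch a)) * \<psi> \<one>" using nz by (simp add: ch_def)
      then show ?thesis by (simp only: complex_norm_square[symmetric] n1[OF a] psi1) simp
    qed
    then have "sq (\<lambda>y. 1 * u (a \<otimes> y) + (- ch a) * u y) = 0"
      using sq_comb[OF ab ub, of 1 "- ch a"] n1[OF a] ub a by (simp add: psi_ip[symmetric] sq_translate)
    moreover have "cfun (\<lambda>y. 1 * u (a \<otimes> y) + (- ch a) * u y)"
      by (rule cfun_add[OF cfun_scale[OF cfun_translate[OF u a]] cfun_scale[OF u]])
    ultimately show ?thesis using sq_eq_0[OF _ _ x] by force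
  qed
  have "cfun ch"
    using cfun_scale[OF psic, of "inverse (\<psi> \<one>)"] by (simp add: ch_def[abs_def] divide_inverse mult.commute)
  then show ?thesis using that n1 hom eig su by blast
qed

text \<open>The extremal problem is posed for a difference \<open>f\<close> of \<open>f0\<close>
  under translation by \<open>b\<close>. Its convolutions and their limit \<open>u\<close> are again
  such differences of bounded functions, and a non-zero one cannot be \<open>b\<close>-invariant; so
  the character belonging to \<open>u\<close> is not 1 at \<open>b\<close>.\<close>

theorem ex_separating_character:
  assumes b: "b \<in> carrier G" "b \<noteq> \<one>"
  obtains ch where "cfun ch" "\<And>x. x \<in> carrier G \<Longrightarrow> norm (ch x) = 1"
    "\<And>x y. x \<in> carrier G \<Longrightarrow> y \<in> carrier G \<Longrightarrow> ch (x \<otimes> y) = ch x * ch y" "ch b \<noteq> 1"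
proof -
  have "closedin T {\<one>}"
    by (rule closedin_Hausdorff_singleton[OF Hausdorff]) (simp add: topspace)
  moreover have "b \<in> topspace T - {\<one>}" using b by (simp add: topspace)
  ultimately obtain \<phi> where phi: "continuous_map T (top_of_set {0..1::real}) \<phi>" "\<phi> b = 0" "\<phi> ` {\<one>} \<subseteq> {1}"
    using creg unfolding completely_regular_space_def by metis
  define f0 :: "'a \<Rightarrow> complex" where "f0 x = of_real (\<phi> x)" for x
  have "continuous_map T euclideanreal \<phi>" using phi(1) by (rule continuous_map_into_fulltopology)
  then have f0: "cfun f0"
    unfolding f0_def using continuous_map_compose[of T euclidean \<phi> euclidean complex_of_real]
    by (auto simp: o_def continuous_on_of_real_id)
  define f where "f x = f0 (b \<otimes> x) - f0 x" for x
  have f: "cfun f" unfolding f_def by (rule cfun_diff[OF cfun_translate[OF f0 b(1)] f0])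
  have f0b: "bounded_fun f0" and fb: "bounded_fun f" using f0 f cfun_bounded by auto
  have f1: "f \<one> \<noteq> 0" using phi b by (simp add: f_def f0_def)
  obtain s g where s: "s > 0" and gb: "\<And>n. bounded_fun (g n)" and g1: "\<And>n. sq (g n) \<le> 1"
    and lim: "(\<lambda>n::nat. nrm (corr (cnv f (g n)))) \<longlonglongrightarrow> s"
    and hom: "\<And>h. bounded_fun h \<Longrightarrow> nrm (corr (cnv f h)) \<le> s * sq h"
    using corr_sup[OF f one_closed f1] by metis
  obtain C' where "\<And>x. x \<in> carrier G \<Longrightarrow> norm (f0 x) \<le> C'" using f0b unfolding bounded_fun_def by blast
  then obtain C where C: "\<And>x. x \<in> carrier G \<Longrightarrow> norm (f0 x) \<le> C" "C > 0"
    by (meson less_eq_real_def linorder_le_less_linear order_trans zero_less_one)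
  \<comment> \<open>The subsequence is extracted from convolutions with \<open>f0\<close> rather
    than \<open>f\<close>, so that the limit \<open>u\<close> is exhibited as a difference of the
    bounded function \<open>u0\<close>.\<close>
  define w where "w n = cnv f0 (g n)" for n
  have wC: "norm (w n x) \<le> C" if "x \<in> carrier G" for n x
    unfolding w_def cnv_def using that C by (intro M_mult_le gb g1) auto
  have diff: "norm (w n x - w n x') \<le> e"
    if "x \<in> carrier G" "x' \<in> carrier G" "\<And>y. y \<in> carrier G \<Longrightarrow> norm (f0 (x \<otimes> y) - f0 (x' \<otimes> y)) \<le> e" "e > 0" for n x x' e
  proof -
    have "w n x - w n x' = M (\<lambda>y. (f0 (x \<otimes> y) - f0 (x' \<otimes> y)) * g n y)"
      unfolding w_def cnv_def left_diff_distrib using that f0b gb by (subst M_diff) auto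
    then show ?thesis using that M_mult_le[OF gb g1, of "\<lambda>y. f0 (x \<otimes> y) - f0 (x' \<otimes> y)" e n] by simp
  qed
  \<comment> \<open>One net for the translates of \<open>f0\<close> serves all \<open>w n\<close>,
    because \<open>M_mult_le\<close> carries uniform closeness over to convolutions with
    \<open>sq (g n) \<le> 1\<close>.\<close>
  have "\<exists>X. finite X \<and> X \<subseteq> carrier G \<and> (\<forall>x\<in>carrier G. \<exists>x'\<in>X. \<forall>n. norm (w n x - w n x') \<le> e)" if e: "e > 0" for e
  proof -
    obtain X where X: "finite X" "X \<subseteq> carrier G"
      "\<And>x. x \<in> carrier G \<Longrightarrow> \<exists>x'\<in>X. \<forall>y\<in>carrier G. norm (f0 (x \<otimes> y) - f0 (x' \<otimes> y)) < e"
      using cfun_almost_periodic[OF f0 e] by metis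
    have "\<exists>x'\<in>X. \<forall>n. norm (w n x - w n x') \<le> e" if x: "x \<in> carrier G" for x
    proof -
      obtain x' where x': "x' \<in> X" "\<And>y. y \<in> carrier G \<Longrightarrow> norm (f0 (x \<otimes> y) - f0 (x' \<otimes> y)) < e"
        using X(3)[OF x] by blast
      then have "\<forall>n. norm (w n x - w n x') \<le> e" using diff[OF x _ _ e, of x'] X(2) by (meson less_imp_le subsetD)
      then show ?thesis using x'(1) by blast
    qed
    then show ?thesis using X(1,2) by blast
  qed
  then obtain k u0 where k: "strict_mono (k :: nat \<Rightarrow> nat)"
    and u0: "uniform_limit (carrier G) (\<lambda>n. w (k n)) u0 sequentially"
    using uniformly_convergent_subsequence[of "carrier G" w C, OF wC] by metis
  have u0c: "cfun u0"
    by (rule cfun_uniform_limit[OF _ u0]) (auto simp: w_def intro: cnv_cont f0 gb)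
  define u where "u x = u0 (b \<otimes> x) - u0 x" for x
  have uc: "cfun u" unfolding u_def by (rule cfun_diff[OF cfun_translate[OF u0c b(1)] u0c])
  have ub: "bounded_fun u" using uc by (rule cfun_bounded)
  have cnv_f: "cnv f (g n) x = w n (b \<otimes> x) - w n x" if x: "x \<in> carrier G" for n x
  proof -
    have "cnv f (g n) x = M (\<lambda>y. f0 (b \<otimes> x \<otimes> y) * g n y - f0 (x \<otimes> y) * g n y)"
      unfolding cnv_def f_def using x b by (intro M_cong) (simp add: m_assoc algebra_simps)
    then show ?thesis unfolding w_def cnv_def using x b f0b gb by (subst (asm) M_diff) auto
  qed
  define v where "v n = cnv f (g (k n))" for n
  have vb: "bounded_fun (v n)" for n unfolding v_def using fb gb by (rule bounded_fun_cnv)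
  have translate_limit: "uniform_limit (carrier G) (\<lambda>n x. y n (a \<otimes> x)) (\<lambda>x. z (a \<otimes> x)) sequentially"
    if "uniform_limit (carrier G) y z sequentially" "a \<in> carrier G" for y :: "nat \<Rightarrow> 'a \<Rightarrow> complex" and z a
    using uniform_limit_compose'[OF that(1), of "\<lambda>x. a \<otimes> x" "carrier G"] that(2) by (auto simp: Pi_iff)
  have vu: "uniform_limit (carrier G) v u sequentially"
  proof -
    have "uniform_limit (carrier G) (\<lambda>n x. w (k n) (b \<otimes> x) - w (k n) x) (\<lambda>x. u0 (b \<otimes> x) - u0 x) sequentially"
      by (intro uniform_limit_intros translate_limit u0 b)
    then show ?thesis
      unfolding u_def by (rule uniform_limit_cong'[THEN iffD1, rotated -1]) (auto simp: v_def cnv_f)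
  qed
  have nrm_lim: "(\<lambda>n. nrm (corr (y n))) \<longlonglongrightarrow> nrm (corr z)"
    if "\<And>n. bounded_fun (y n)" "bounded_fun z" "uniform_limit (carrier G) y z sequentially" for y :: "nat \<Rightarrow> 'a \<Rightarrow> complex" and z
    using that by (intro tendsto_real_sqrt sq_tendsto corr_uniform_limit bounded_fun_corr)
  have us: "nrm (corr u) = s"
  proof (rule LIMSEQ_unique)
    show "(\<lambda>n. nrm (corr (v n))) \<longlonglongrightarrow> nrm (corr u)" by (rule nrm_lim[OF vb ub vu])
    show "(\<lambda>n. nrm (corr (v n))) \<longlonglongrightarrow> s"
      using LIMSEQ_subseq_LIMSEQ[OF lim k] by (simp add: v_def o_def)
  qed
  \<comment> \<open>Before the limit, the two halves are convolutions of \<open>f\<close> with the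
    functions \<open>(h y \<plusminus> c * h (inv a \<otimes> y)) / 2\<close>. Their norms are at
    most \<open>s\<close> times the values of \<open>sq\<close> on these, which add up to
    \<open>sq h \<le> 1\<close> by the parallelogram law.\<close>
  have ext: "nrm (corr (\<lambda>x. (u x + c * u (a \<otimes> x)) / 2)) + nrm (corr (\<lambda>x. (u x + - c * u (a \<otimes> x)) / 2)) \<le> s"
    if a: "a \<in> carrier G" and c: "norm c = 1" for a c
  proof -
    have part: "(\<lambda>n. nrm (corr (\<lambda>x. (v n x + d * v n (a \<otimes> x)) / 2))) \<longlonglongrightarrow> nrm (corr (\<lambda>x. (u x + d * u (a \<otimes> x)) / 2))" for d
    proof (rule nrm_lim)
      show "bounded_fun (\<lambda>x. (v n x + d * v n (a \<otimes> x)) / 2)" for n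
        by (rule bounded_fun_divide[OF bounded_fun_add[OF vb bounded_fun_mult[OF bounded_fun_const bounded_fun_translate[OF vb a]]]])
      show "bounded_fun (\<lambda>x. (u x + d * u (a \<otimes> x)) / 2)"
        by (rule bounded_fun_divide[OF bounded_fun_add[OF ub bounded_fun_mult[OF bounded_fun_const bounded_fun_translate[OF ub a]]]])
      have "uniform_limit (carrier G) (\<lambda>n x. (1/2) * (v n x + d * v n (a \<otimes> x))) (\<lambda>x. (1/2) * (u x + d * u (a \<otimes> x))) sequentially"
        by (rule bounded_linear.uniform_limit[OF bounded_linear_mult_right
              uniform_limit_add[OF vu bounded_linear.uniform_limit[OF bounded_linear_mult_right translate_limit[OF vu a]]]])
      then show "uniform_limit (carrier G) (\<lambda>n x. (v n x + d * v n (a \<otimes> x)) / 2) (\<lambda>x. (u x + d * u (a \<otimes> x)) / 2) sequentially"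
        by simp
    qed
    have le: "nrm (corr (\<lambda>x. (v n x + c * v n (a \<otimes> x)) / 2)) + nrm (corr (\<lambda>x. (v n x + - c * v n (a \<otimes> x)) / 2)) \<le> s" for n
    proof -
      define h where "h = g (k n)"
      have h: "bounded_fun h" "sq h \<le> 1" using gb g1 by (auto simp: h_def)
      have ha: "bounded_fun (\<lambda>y. h (inv a \<otimes> y))" using h a by auto
      have eq: "nrm (corr (\<lambda>x. (v n x + d * v n (a \<otimes> x)) / 2)) \<le> s * sq (\<lambda>y. (h y + d * h (inv a \<otimes> y)) / 2)" for d
      proof -
        have "sq (corr (\<lambda>x. (v n x + d * v n (a \<otimes> x)) / 2)) = sq (corr (cnv f (\<lambda>y. (h y + d * h (inv a \<otimes> y)) / 2)))"
          by (intro sq_cong corr_cong)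
             (simp_all add: cnv_comb[OF fb h(1) ha] cnv_translate[OF fb h(1) a] v_def h_def[symmetric])
        moreover have "bounded_fun (\<lambda>y. (h y + d * h (inv a \<otimes> y)) / 2)"
          by (rule bounded_fun_divide[OF bounded_fun_add[OF h(1) bounded_fun_mult[OF bounded_fun_const ha]]])
        ultimately show ?thesis using hom[of "\<lambda>y. (h y + d * h (inv a \<otimes> y)) / 2"] by simp
      qed
      have "s * (sq (\<lambda>y. (h y + c * h (inv a \<otimes> y)) / 2) + sq (\<lambda>y. (h y + - c * h (inv a \<otimes> y)) / 2)) = s * sq h"
        using parallelogram[OF h(1) inv_closed[OF a] c] by simp
      also have "\<dots> \<le> s" using h(2) s by simp
      finally show ?thesis using eq[of c] eq[of "- c"] by (simp add: distrib_left)
    qed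
    show ?thesis by (rule LIMSEQ_le_const2[OF tendsto_add[OF part part]]) (use le in blast)
  qed
  obtain ch where chi: "cfun ch" "\<And>x. x \<in> carrier G \<Longrightarrow> norm (ch x) = 1"
    "\<And>x y. x \<in> carrier G \<Longrightarrow> y \<in> carrier G \<Longrightarrow> ch (x \<otimes> y) = ch x * ch y"
    and eig: "\<And>a x. a \<in> carrier G \<Longrightarrow> x \<in> carrier G \<Longrightarrow> u (a \<otimes> x) = ch a * u x" and su: "sq u > 0"
    using translation_eigenfunction[OF uc s us ext] by metis
  have "ch b \<noteq> 1"
  proof
    assume b1: "ch b = 1"
    \<comment> \<open>Then \<open>u\<close> is \<open>b\<close>-invariant, so \<open>u0\<close> would grow linearly along the powers of \<open>b\<close>.\<close>
    obtain K where K: "\<And>x. x \<in> carrier G \<Longrightarrow> norm (u0 x) \<le> K"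
      using cfun_bounded[OF u0c] unfolding bounded_fun_def by blast
    have "u x = 0" if x: "x \<in> carrier G" for x
    proof -
      have step: "u0 (b [^] n \<otimes> x) = u0 x + of_nat n * u x \<and> u (b [^] n \<otimes> x) = u x" for n :: nat
      proof (induction n)
        case (Suc n)
        have y: "b [^] n \<otimes> x \<in> carrier G" using b x by simp
        have "b [^] Suc n \<otimes> x = b \<otimes> (b [^] n \<otimes> x)" using b x by (simp add: m_ac)
        moreover have "u0 (b \<otimes> (b [^] n \<otimes> x)) = u0 (b [^] n \<otimes> x) + u (b [^] n \<otimes> x)" by (simp add: u_def)
        moreover have "u (b \<otimes> (b [^] n \<otimes> x)) = u (b [^] n \<otimes> x)" using eig[OF b(1) y] b1 by simp
        ultimately show ?case using Suc by (simp add: algebra_simps)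
      qed (use x in simp)
      have "of_nat n * norm (u x) \<le> 2 * K" for n :: nat
      proof -
        have "of_nat n * u x = u0 (b [^] n \<otimes> x) - u0 x" using step[of n] by simp
        then have "norm (of_nat n * u x) \<le> K + K"
          using K[of "b [^] n \<otimes> x"] K[OF x] b x
          by (metis add_mono m_closed nat_pow_closed norm_triangle_ineq4 order_trans)
        then show ?thesis by (simp add: norm_mult)
      qed
      then show "u x = 0" by (metis ex_less_of_nat_mult linorder_not_le mult.commute zero_less_norm_iff)
    qed
    then have "sq u \<le> 0\<^sup>2" by (intro sq_le[OF ub]) auto
    then show False using su by simp
  qed
  then show ?thesis using that chi by blast
qed

end

subsection \<open>Kronecker approximation\<close>

lemma poly_times_power_tendsto_0:
  fixes q :: real
  assumes "0 \<le> q" "q < 1"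
  shows "(\<lambda>N. (real N + 1) ^ d * q ^ N) \<longlonglongrightarrow> 0"
proof (cases "q = 0 \<or> d = 0")
  case True
  then show ?thesis
  proof
    assume "q = 0"
    then have "\<forall>\<^sub>F N in sequentially. (real N + 1) ^ d * q ^ N = 0"
      by (auto simp: eventually_sequentially intro!: exI[of _ 1])
    then show ?thesis by (rule tendsto_eventually)
  qed (use assms in \<open>simp add: LIMSEQ_power_zero\<close>)
next
  case False
  \<comment> \<open>The \<open>d\<close>-th power of \<open>(N + 1) / x^(N + 1)\<close> is
    \<open>(N + 1)^d * q^(N + 1)\<close>, with \<open>x > 1\<close>; the factor \<open>1 / q\<close>
    makes up for the shifted exponent.\<close>
  define x where "x = root d (1 / q)"
  have "1 / q > 1" using assms False by simp
  then have x: "x > 1" using False by (auto simp: x_def)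
  have xd: "x ^ d = 1 / q" unfolding x_def using False assms by (intro real_root_pow_pos2) auto
  have "(\<lambda>N. real (Suc N) / x ^ (Suc N)) \<longlonglongrightarrow> 0"
    using lim_n_over_pown[of x] x by (intro LIMSEQ_Suc) auto
  then have "(\<lambda>N. (real (Suc N) / x ^ (Suc N)) ^ d * (1 / q)) \<longlonglongrightarrow> 0 ^ d * (1 / q)"
    by (intro tendsto_intros)
  moreover have "(real (Suc N) / x ^ (Suc N)) ^ d * (1 / q) = (real N + 1) ^ d * q ^ N" for N
  proof -
    have "(x ^ Suc N) ^ d = (1 / q) ^ Suc N"
      unfolding xd[symmetric] by (simp only: power_mult[symmetric] mult.commute)
    then show ?thesis using False by (simp add: power_divide add.commute)
  qed
  ultimately show ?thesis using False by (simp add: zero_power)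
qed

context mean
begin

lemma M_hom_0:
  assumes "\<And>x. x \<in> carrier G \<Longrightarrow> norm (ch x) = 1"
    and "\<And>x y. x \<in> carrier G \<Longrightarrow> y \<in> carrier G \<Longrightarrow> ch (x \<otimes> y) = ch x * ch y"
    and "a \<in> carrier G" "ch a \<noteq> 1"
  shows "M ch = 0"
proof -
  have b: "bounded_fun ch" using assms(1) by (intro bounded_funI[of _ 1]) simp
  have "M ch = M (\<lambda>x. ch (a \<otimes> x))" using M_inv[OF b assms(3)] by simp
  also have "\<dots> = M (\<lambda>x. ch a * ch x)" by (rule M_cong) (simp add: assms)
  also have "\<dots> = ch a * M ch" using b by (rule M_scale)
  finally have "(1 - ch a) * M ch = 0" by (simp add: algebra_simps)
  then show ?thesis using assms(4) by simp
qed

lemma ip_sum: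
  assumes "finite I" "\<And>i. i \<in> I \<Longrightarrow> bounded_fun (U i)"
  shows "ip (\<lambda>x. \<Sum>i\<in>I. of_real (c i) * U i x) (\<lambda>x. \<Sum>i\<in>I. of_real (c i) * U i x)
    = (\<Sum>i\<in>I. \<Sum>j\<in>I. of_real (c i * c j) * ip (U i) (U j))"
proof -
  have "ip (\<lambda>x. \<Sum>i\<in>I. of_real (c i) * U i x) (\<lambda>x. \<Sum>i\<in>I. of_real (c i) * U i x)
     = M (\<lambda>x. \<Sum>i\<in>I. \<Sum>j\<in>I. of_real (c i * c j) * (U i x * cnj (U j x)))"
    unfolding ip_def by (rule M_cong) (simp add: sum_product mult_ac)
  also have "\<dots> = (\<Sum>i\<in>I. \<Sum>j\<in>I. of_real (c i * c j) * ip (U i) (U j))"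
    unfolding ip_def using assms by (simp add: M_sum M_scale)
  finally show ?thesis .
qed

text \<open>By \<open>indep\<close>, every relation among the \<open>ch w\<close> has exponents
  divisible by the \<open>k w\<close>, and the targets \<open>t w\<close> satisfy all such
  relations. \<open>k w = 0\<close> stands for infinite order and an arbitrary target on the
  circle.\<close>

theorem kronecker:
  fixes ch :: "'w \<Rightarrow> 'a \<Rightarrow> complex" and k :: "'w \<Rightarrow> nat"
  assumes F: "finite F"
    and ch1: "\<And>w x. w \<in> F \<Longrightarrow> x \<in> carrier G \<Longrightarrow> norm (ch w x) = 1"
    and hom: "\<And>w x y. w \<in> F \<Longrightarrow> x \<in> carrier G \<Longrightarrow> y \<in> carrier G \<Longrightarrow> ch w (x \<otimes> y) = ch w x * ch w y"
    and indep: "\<And>n :: 'w \<Rightarrow> int. (\<And>x. x \<in> carrier G \<Longrightarrow> (\<Prod>w\<in>F. ch w x powi n w) = 1) \<Longrightarrow> \<forall>w\<in>F. int (k w) dvd n w"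
    and t: "\<And>w. w \<in> F \<Longrightarrow> norm (t w) = 1" "\<And>w. w \<in> F \<Longrightarrow> t w ^ k w = 1"
    and e: "\<epsilon> > 0"
  obtains x where "x \<in> carrier G" "\<And>w. w \<in> F \<Longrightarrow> norm (ch w x - t w) < \<epsilon>"
proof -
  define u where "u w x = cnj (t w) * ch w x" for w x
  have u1: "norm (u w x) = 1" if "w \<in> F" "x \<in> carrier G" for w x
    using that ch1 t by (simp add: u_def norm_mult)
  have ub: "bounded_fun (u w)" if "w \<in> F" for w using u1[OF that] by (intro bounded_funI[of _ 1]) simp
  define U where "U n x = (\<Prod>w\<in>F. u w x ^ n w)" for n :: "'w \<Rightarrow> nat" and x
  have Ub: "bounded_fun (U n)" for n
    unfolding U_def[abs_def] using ub by (intro bounded_fun_prod bounded_fun_power)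
  \<comment> \<open>All mixed moments of the \<open>u w\<close> are 0 or 1. Hence the mean of \<open>\<bar>g\<^sup>N\<bar>\<^sup>2\<close> is at least the sum of the
    squared coefficients of \<open>g\<^sup>N\<close>, which is too large if \<open>\<bar>g\<bar>\<close> stays away from its maximum \<open>2\<^sup>d\<close>.\<close>
  define d where "d = card F"
  define g where "g x = (\<Prod>w\<in>F. 1 + u w x)" for x
  have gb: "bounded_fun g" unfolding g_def[abs_def] using ub by (intro bounded_fun_prod bounded_fun_add bounded_fun_const)
  have ipU: "ip (U n) (U n') = 1 \<or> (ip (U n) (U n') = 0 \<and> n \<noteq> n')" for n n'
  proof -
    define m where "m w = int (n w) - int (n' w)" for w
    define X where "X x = (\<Prod>w\<in>F. ch w x powi m w)" for x
    define c where "c = (\<Prod>w\<in>F. cnj (t w) powi m w)"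
    have prod: "U n x * cnj (U n' x) = c * X x" if x: "x \<in> carrier G" for x
    proof -
      have "U n x * cnj (U n' x) = (\<Prod>w\<in>F. u w x ^ n w * cnj (u w x) ^ n' w)"
        by (simp add: U_def prod.distrib)
      also have "\<dots> = (\<Prod>w\<in>F. cnj (t w) powi m w * ch w x powi m w)"
      proof (rule prod.cong[OF refl])
        fix w assume w: "w \<in> F"
        have nz: "u w x \<noteq> 0" using u1[OF w x] by auto
        have "u w x * cnj (u w x) = 1" using u1[OF w x] complex_norm_square[of "u w x"] by simp
        then have "cnj (u w x) = inverse (u w x)" by (simp add: inverse_unique)
        then have "u w x ^ n w * cnj (u w x) ^ n' w = u w x powi m w"
          using nz by (simp add: m_def power_int_diff power_inverse divide_inverse)
        then show "u w x ^ n w * cnj (u w x) ^ n' w = cnj (t w) powi m w * ch w x powi m w"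
          by (simp add: u_def power_int_mult_distrib)
      qed
      finally show ?thesis by (simp add: c_def X_def prod.distrib)
    qed
    have X1: "norm (X x) = 1" if "x \<in> carrier G" for x
      unfolding X_def prod_norm[symmetric] using that ch1 by (intro prod.neutral) (auto simp: norm_power_int)
    have Xhom: "X (x \<otimes> y) = X x * X y" if "x \<in> carrier G" "y \<in> carrier G" for x y
      unfolding X_def prod.distrib[symmetric] using that hom by (intro prod.cong) (auto simp: power_int_mult_distrib)
    have "ip (U n) (U n') = M (\<lambda>x. c * X x)" unfolding ip_def by (rule M_cong) (rule prod)
    also have "\<dots> = c * M X" using X1 by (intro M_scale bounded_funI[of _ 1]) simp
    finally have ip: "ip (U n) (U n') = c * M X" .
    show ?thesis
    proof (cases "\<forall>x\<in>carrier G. X x = 1")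
      case True
      \<comment> \<open>The relation \<open>X = 1\<close> has exponents divisible by the
        \<open>k w\<close>, so the powers of the \<open>cnj (t w)\<close> are 1 as well.\<close>
      have "c = 1"
        unfolding c_def
      proof (rule prod.neutral, rule ballI)
        fix w assume w: "w \<in> F"
        have "int (k w) dvd m w" using indep[of m] True w by (auto simp: X_def)
        then obtain j where j: "m w = int (k w) * j" by (auto simp: dvd_def)
        have "cnj (t w) ^ k w = 1" using t(2)[OF w] by (metis complex_cnj_one complex_cnj_power)
        then show "cnj (t w) powi m w = 1" by (simp add: j power_int_mult)
      qed
      moreover have "M X = M (\<lambda>_. 1)" using True by (intro M_cong) auto
      ultimately show ?thesis using ip M_one by simp
    next
      case False
      then obtain a where "a \<in> carrier G" "X a \<noteq> 1" by blast
      then have "M X = 0" using M_hom_0[of X a] X1 Xhom by blast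
      moreover have "n \<noteq> n'" using False by (auto simp: X_def m_def)
      ultimately show ?thesis using ip by simp
    qed
  qed
  \<comment> \<open>The expansion of \<open>g^N\<close> has \<open>(N + 1)^d\<close> coefficients
    with sum \<open>2^(N * d)\<close>. Cauchy-Schwarz bounds the sum of their squares from below,
    and the off-diagonal moments only add to it.\<close>
  have lower: "4 ^ (N * d) \<le> (real N + 1) ^ d * sq (\<lambda>x. g x ^ N)" for N
  proof -
    define I where "I = PiE F (\<lambda>_. {..N})"
    have I: "finite I" "card I = (N + 1) ^ d"
      unfolding I_def d_def using F by (auto simp: finite_PiE card_PiE)
    define c where "c n = (\<Prod>w\<in>F. real (N choose n w))" for n
    have c0: "0 \<le> c n" for n unfolding c_def by (intro prod_nonneg) auto
    have gN: "g x ^ N = (\<Sum>n\<in>I. of_real (c n) * U n x)" for x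
    proof -
      have "g x ^ N = (\<Prod>w\<in>F. \<Sum>r\<in>{..N}. of_nat (N choose r) * u w x ^ r)"
        unfolding g_def prod_power_distrib
        by (intro prod.cong refl) (subst add.commute, subst binomial_ring, simp)
      also have "\<dots> = (\<Sum>n\<in>I. \<Prod>w\<in>F. of_nat (N choose n w) * u w x ^ n w)"
        unfolding I_def using F by (intro prod_sum_PiE) auto
      finally show ?thesis by (simp add: c_def U_def prod.distrib)
    qed
    have csum: "(\<Sum>n\<in>I. c n) = 2 ^ (N * d)"
    proof -
      have "(\<Sum>n\<in>I. c n) = (\<Prod>w\<in>F. \<Sum>r\<in>{..N}. real (N choose r))"
        unfolding I_def c_def using F by (intro prod_sum_PiE[symmetric]) auto
      also have "\<dots> = (\<Prod>w\<in>F. 2 ^ N)"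
        by (simp only: of_nat_sum[symmetric] choose_row_sum) simp
      finally show ?thesis by (simp add: d_def power_mult)
    qed
    have "sq (\<lambda>x. g x ^ N) = (\<Sum>i\<in>I. \<Sum>j\<in>I. (c i * c j) * Re (ip (U i) (U j)))"
      unfolding sq_def gN using ip_sum[OF I(1) Ub, of c] by simp
    moreover have "(\<Sum>i\<in>I. (c i)\<^sup>2) \<le> (\<Sum>i\<in>I. \<Sum>j\<in>I. (c i * c j) * Re (ip (U i) (U j)))"
    proof (rule sum_mono)
      fix i assume i: "i \<in> I"
      have pos: "0 \<le> Re (ip (U i) (U j))" for j using ipU[of i j] by auto
      have "(c i)\<^sup>2 = (c i * c i) * Re (ip (U i) (U i))" using ipU[of i i] by (simp add: power2_eq_square)
      also have "\<dots> \<le> (\<Sum>j\<in>I. (c i * c j) * Re (ip (U i) (U j)))"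
        using i I(1) pos c0 by (intro member_le_sum[where f = "\<lambda>j. (c i * c j) * Re (ip (U i) (U j))"]) auto
      finally show "(c i)\<^sup>2 \<le> (\<Sum>j\<in>I. (c i * c j) * Re (ip (U i) (U j)))" .
    qed
    ultimately have "(\<Sum>i\<in>I. (c i)\<^sup>2) \<le> sq (\<lambda>x. g x ^ N)" by simp
    then have "(\<Sum>i\<in>I. (c i)\<^sup>2) * real (card I) \<le> sq (\<lambda>x. g x ^ N) * real (card I)"
      by (intro mult_right_mono) auto
    moreover have "(\<Sum>i\<in>I. c i)\<^sup>2 \<le> (\<Sum>i\<in>I. (c i)\<^sup>2) * real (card I)"
      by (rule sum_squared_le_sum_of_squares)
    moreover have "(\<Sum>i\<in>I. c i)\<^sup>2 = 4 ^ (N * d)"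
    proof -
      have "(2 ^ m)\<^sup>2 = (4::real) ^ m" for m by (simp add: power2_eq_square flip: power_mult_distrib)
      then show ?thesis unfolding csum .
    qed
    ultimately have "4 ^ (N * d) \<le> sq (\<lambda>x. g x ^ N) * real (card I)" by linarith
    then show ?thesis by (simp add: I(2) mult.commute add.commute)
  qed
  show ?thesis
  proof (cases "\<exists>x\<in>carrier G. \<forall>w\<in>F. norm (ch w x - t w) < \<epsilon>")
    case True
    then show ?thesis using that by blast
  next
    case False
    \<comment> \<open>Where some \<open>ch w x\<close> misses its target by
      \<open>\<epsilon>\<close>, one factor of \<open>|g x|^2\<close> is at most
      \<open>4 * q\<close> instead of 4. The maximum with 0 covers large
      \<open>\<epsilon>\<close>.\<close>
    define q where "q = max 0 (1 - \<epsilon>\<^sup>2 / 4)"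
    have q: "0 \<le> q" "q < 1" using e by (auto simp: q_def)
    \<comment> \<open>The parallelogram identity for 1 and \<open>u w x\<close>, where
      \<open>|1 - u w x|\<close> is the distance of \<open>ch w x\<close> from
      \<open>t w\<close>.\<close>
    have factor: "(norm (1 + u w x))\<^sup>2 = 4 - (norm (ch w x - t w))\<^sup>2" if "w \<in> F" "x \<in> carrier G" for w x
    proof -
      have "(norm (1 + u w x))\<^sup>2 + (norm (1 - u w x))\<^sup>2 = 2 + 2 * (norm (u w x))\<^sup>2"
        unfolding cmod_power2 by (simp add: power2_eq_square algebra_simps)
      moreover have "norm (1 - u w x) = norm (t w) * norm (1 - u w x)" using t(1) that by simp
      moreover have "t w * (1 - u w x) = t w - (t w * cnj (t w)) * ch w x"
        by (simp add: u_def algebra_simps)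
      moreover have "t w * cnj (t w) = 1" using t(1)[OF that(1)] complex_norm_square[of "t w"] by simp
      ultimately show ?thesis using u1[OF that] by (simp add: norm_mult[symmetric] norm_minus_commute)
    qed
    have gle: "(norm (g x))\<^sup>2 \<le> 4 ^ d * q" if x: "x \<in> carrier G" for x
    proof -
      obtain w where w: "w \<in> F" "\<epsilon> \<le> norm (ch w x - t w)" using False x by (meson linorder_not_le)
      have "\<epsilon>\<^sup>2 \<le> (norm (ch w x - t w))\<^sup>2" using w e by (intro power_mono) auto
      then have "(norm (1 + u w x))\<^sup>2 \<le> 4 * q" unfolding factor[OF w(1) x] q_def by (auto simp: max_def)
      moreover have "(\<Prod>w\<in>F - {w}. (norm (1 + u w x))\<^sup>2) \<le> (\<Prod>w\<in>F - {w}. 4)"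
      proof (rule prod_mono, rule conjI)
        fix i assume "i \<in> F - {w}"
        then show "(norm (1 + u i x))\<^sup>2 \<le> 4" using factor[of i x] x by simp
      qed simp
      moreover have "(norm (g x))\<^sup>2 = (norm (1 + u w x))\<^sup>2 * (\<Prod>w\<in>F - {w}. (norm (1 + u w x))\<^sup>2)"
        unfolding g_def prod_norm[symmetric] prod_power_distrib using F w(1) by (rule prod.remove)
      ultimately have "(norm (g x))\<^sup>2 \<le> 4 * q * 4 ^ card (F - {w})"
        by (simp add: mult_mono' prod_nonneg)
      also have "\<dots> = 4 ^ d * q"
        unfolding d_def using F w(1) card_Suc_Diff1[of F w] by (metis mult.assoc mult.commute power_Suc)
      finally show ?thesis .
    qed
    have "1 \<le> (real N + 1) ^ d * q ^ N" for N
    proof -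
      have "sq (\<lambda>x. g x ^ N) \<le> (sqrt ((4 ^ d * q) ^ N))\<^sup>2"
      proof (rule sq_le)
        fix x assume x: "x \<in> carrier G"
        have "(norm (g x ^ N))\<^sup>2 = ((norm (g x))\<^sup>2) ^ N"
          by (simp add: norm_power power_mult[symmetric] mult.commute)
        also have "\<dots> \<le> (4 ^ d * q) ^ N" using gle[OF x] by (intro power_mono) auto
        finally show "norm (g x ^ N) \<le> sqrt ((4 ^ d * q) ^ N)" by (rule real_le_rsqrt)
      qed (use gb in auto)
      also have "\<dots> = 4 ^ (N * d) * q ^ N" using q by (simp add: power_mult_distrib power_mult[symmetric] mult.commute)
      finally have "(real N + 1) ^ d * sq (\<lambda>x. g x ^ N) \<le> (real N + 1) ^ d * (4 ^ (N * d) * q ^ N)"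
        by (intro mult_left_mono) auto
      also have "\<dots> = 4 ^ (N * d) * ((real N + 1) ^ d * q ^ N)" by (simp only: mult_ac)
      finally have "4 ^ (N * d) * 1 \<le> 4 ^ (N * d) * ((real N + 1) ^ d * q ^ N)"
        using order_trans[OF lower[of N]] by simp
      then show ?thesis by (subst (asm) mult_le_cancel_left_pos) auto
    qed
    then have "1 \<le> (0::real)"
      by (intro LIMSEQ_le_const[OF poly_times_power_tendsto_0[OF q, of d]]) auto
    then show ?thesis by simp
  qed
qed

end

subsection \<open>The dual group\<close>

context compact_abelian_group
begin

lemma cfun_mult: "cfun f \<Longrightarrow> cfun g \<Longrightarrow> cfun (\<lambda>x. f x * g x)"
proof -
  assume f: "cfun f" and g: "cfun g"
  have 1: "continuous_map T (prod_topology euclidean euclidean) (\<lambda>x. (f x, g x))"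
    using f g by (simp only: continuous_map_paired)
  have 2: "continuous_map (prod_topology euclidean euclidean) euclidean (\<lambda>p. fst p * snd p :: complex)"
    unfolding euclidean_product_topology by (simp add: continuous_on_mult continuous_on_fst continuous_on_snd)
  show ?thesis using continuous_map_compose[OF 1 2] by (simp add: o_def)
qed

lemma cfun_cnj: "cfun f \<Longrightarrow> cfun (\<lambda>x. cnj (f x))"
  using continuous_map_compose[of T euclidean f euclidean cnj]
  by (simp add: o_def continuous_on_cnj)

lemma cfun_cong: "cfun f \<Longrightarrow> (\<And>x. x \<in> carrier G \<Longrightarrow> f x = g x) \<Longrightarrow> cfun g"
  using continuous_map_eq topspace by metis

text \<open>The Pontryagin dual without its topology. Characters are extensional, so that those
  agreeing on the carrier are equal and the cardinality of sets of characters is meaningful.\<close>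

definition dual :: "('a \<Rightarrow> complex) monoid" where
  "dual = \<lparr>carrier = {ch \<in> extensional (carrier G). cfun ch \<and> (\<forall>x\<in>carrier G. norm (ch x) = 1) \<and>
              (\<forall>x\<in>carrier G. \<forall>y\<in>carrier G. ch (x \<otimes> y) = ch x * ch y)},
           monoid.mult = (\<lambda>ch ch'. \<lambda>x\<in>carrier G. ch x * ch' x), one = (\<lambda>x\<in>carrier G. 1)\<rparr>"

lemma dual_carrier: "ch \<in> carrier dual \<longleftrightarrow> ch \<in> extensional (carrier G) \<and> cfun ch \<and> (\<forall>x\<in>carrier G. norm (ch x) = 1) \<and>
              (\<forall>x\<in>carrier G. \<forall>y\<in>carrier G. ch (x \<otimes> y) = ch x * ch y)"
  by (simp add: dual_def)

lemma dual_mult: "x \<in> carrier G \<Longrightarrow> (ch \<otimes>\<^bsub>dual\<^esub> ch') x = ch x * ch' x"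
  by (simp add: dual_def)

lemma dual_one: "x \<in> carrier G \<Longrightarrow> \<one>\<^bsub>dual\<^esub> x = 1"
  by (simp add: dual_def)

lemma dual_ext: "f \<in> carrier dual \<Longrightarrow> g \<in> carrier dual \<Longrightarrow> (\<And>x. x \<in> carrier G \<Longrightarrow> f x = g x) \<Longrightarrow> f = g"
  by (auto simp: dual_carrier intro: extensionalityI)

lemma cfun_restrict: "cfun f \<Longrightarrow> cfun (\<lambda>x\<in>carrier G. f x)"
  by (erule cfun_cong) simp

lemma comm_group_dual: "comm_group dual"
proof (rule comm_groupI)
  fix f g assume fg: "f \<in> carrier dual" "g \<in> carrier dual"
  show "f \<otimes>\<^bsub>dual\<^esub> g \<in> carrier dual"
    using fg unfolding dual_carrier
    by (auto simp: dual_def norm_mult intro!: cfun_restrict cfun_mult)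
  show "f \<otimes>\<^bsub>dual\<^esub> g = g \<otimes>\<^bsub>dual\<^esub> f" by (simp add: dual_def mult.commute)
  show "(f \<otimes>\<^bsub>dual\<^esub> g) \<otimes>\<^bsub>dual\<^esub> h = f \<otimes>\<^bsub>dual\<^esub> (g \<otimes>\<^bsub>dual\<^esub> h)" for h
    by (auto simp: dual_def restrict_def)
next
  show "\<one>\<^bsub>dual\<^esub> \<in> carrier dual" unfolding dual_carrier by (auto simp: dual_def intro!: cfun_restrict)
  fix f assume f: "f \<in> carrier dual"
  then show "\<one>\<^bsub>dual\<^esub> \<otimes>\<^bsub>dual\<^esub> f = f"
    by (auto simp: dual_def restrict_def extensional_def)
  show "\<exists>g\<in>carrier dual. g \<otimes>\<^bsub>dual\<^esub> f = \<one>\<^bsub>dual\<^esub>"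
  proof
    show "(\<lambda>x\<in>carrier G. cnj (f x)) \<in> carrier dual"
      using f unfolding dual_carrier by (auto intro!: cfun_restrict cfun_cnj)
    have "cnj (f x) * f x = 1" if "x \<in> carrier G" for x
      using that f complex_norm_square[of "f x"] by (simp add: dual_carrier mult.commute)
    then show "(\<lambda>x\<in>carrier G. cnj (f x)) \<otimes>\<^bsub>dual\<^esub> f = \<one>\<^bsub>dual\<^esub>"
      by (auto simp: dual_def restrict_def)
  qed
qed

sublocale dual: comm_group dual by (rule comm_group_dual)

lemma dual_nat_pow: "x \<in> carrier G \<Longrightarrow> (f [^]\<^bsub>dual\<^esub> (n::nat)) x = f x ^ n"
  by (induction n) (simp_all add: dual_one dual_mult mult.commute)

lemma dual_inv:
  assumes f: "f \<in> carrier dual" and x: "x \<in> carrier G" shows "(inv\<^bsub>dual\<^esub> f) x = inverse (f x)"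
proof -
  have "(inv\<^bsub>dual\<^esub> f) x * f x = 1"
    using dual_mult[OF x, of "inv\<^bsub>dual\<^esub> f" f] f dual_one[OF x] by simp
  then show ?thesis by (metis inverse_unique mult.commute)
qed

lemma dual_int_pow: "f \<in> carrier dual \<Longrightarrow> x \<in> carrier G \<Longrightarrow> (f [^]\<^bsub>dual\<^esub> (n::int)) x = f x powi n"
  using dual_inv[of "f [^]\<^bsub>dual\<^esub> nat (- n)" x] dual_nat_pow[of x f] dual.nat_pow_closed[of f]
  by (simp only: int_pow_def2 power_int_def power_inverse split: if_split) simp

lemma dual_finprod:
  "finite F \<Longrightarrow> f \<in> F \<rightarrow> carrier dual \<Longrightarrow> x \<in> carrier G \<Longrightarrow> (finprod dual f F) x = (\<Prod>i\<in>F. f i x)"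
  by (induction F rule: finite_induct) (auto simp: dual_one dual_mult)

lemma dual_pow:
  assumes "f \<in> carrier dual" "x \<in> carrier G" shows "f (x [^] (n::nat)) = f x ^ n"
proof (induction n)
  case 0
  have hom: "\<forall>x\<in>carrier G. \<forall>y\<in>carrier G. f (x \<otimes> y) = f x * f y" and "norm (f \<one>) = 1"
    using assms(1) by (simp_all add: dual_carrier)
  then have "f \<one> * 1 = f \<one> * f \<one>" "f \<one> \<noteq> 0"
    using hom[rule_format, OF one_closed one_closed] by auto
  then show ?case by simp
next
  case (Suc n)
  then show ?case using assms by (simp add: dual_carrier mult.commute)
qed

theorem dual_separates:
  assumes "x \<in> carrier G" "y \<in> carrier G" "x \<noteq> y"
  shows "\<exists>ch\<in>carrier dual. ch x \<noteq> ch y"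
proof -
  obtain M where "mean G M" using ex_mean by blast
  then interpret compact_mean G T M
    by (simp add: compact_mean_def compact_abelian_group_axioms)
  have b: "x \<otimes> inv y \<in> carrier G" "x \<otimes> inv y \<noteq> \<one>"
    using assms inv_solve_right'[of \<one> x y] by auto
  obtain ch where ch: "cfun ch" "\<And>x. x \<in> carrier G \<Longrightarrow> norm (ch x) = 1"
    "\<And>x y. x \<in> carrier G \<Longrightarrow> y \<in> carrier G \<Longrightarrow> ch (x \<otimes> y) = ch x * ch y" "ch (x \<otimes> inv y) \<noteq> 1"
    using ex_separating_character[OF b] by metis
  have r: "restrict ch (carrier G) \<in> carrier dual"
    using ch unfolding dual_carrier by (auto intro: cfun_restrict)
  have "ch x \<noteq> ch y"
  proof
    assume eq: "ch x = ch y"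
    have "ch x = ch (x \<otimes> inv y) * ch y" using assms by (subst ch(3)[symmetric]) (auto simp: m_assoc)
    moreover have "ch y \<noteq> 0" using ch(2)[OF assms(2)] by auto
    ultimately show False using ch(4) eq by simp
  qed
  then show ?thesis using r assms by (intro bexI[OF _ r]) auto
qed

end

subsection \<open>Sets of bounded cardinality\<close>

lemma small_subset: "A \<subseteq> B \<Longrightarrow> |B| \<le>o \<alpha> \<Longrightarrow> |A| \<le>o \<alpha>"
  using card_of_mono1 ordLeq_transitive by blast

lemma small_image: "|A| \<le>o \<alpha> \<Longrightarrow> |f ` A| \<le>o \<alpha>"
  using card_of_image ordLeq_transitive by blast

lemma small_inj: "inj_on f A \<Longrightarrow> f ` A \<subseteq> B \<Longrightarrow> |B| \<le>o \<alpha> \<Longrightarrow> |A| \<le>o \<alpha>"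
  using card_of_ordLeq[of A B] ordLeq_transitive by blast

context
  fixes \<alpha> :: "'c rel"
  assumes \<alpha>: "Cinfinite \<alpha>"
begin

lemma small_finite: "finite A \<Longrightarrow> |A| \<le>o \<alpha>"
proof -
  assume A: "finite A"
  have "Well_order \<alpha>" using \<alpha> card_order_on_well_order_on by blast
  moreover have "\<not> finite (Field \<alpha>)" using \<alpha> unfolding cinfinite_def by blast
  moreover have "finite (Field |A| )" using A unfolding Field_card_of .
  ultimately have "|A| <o \<alpha>" using finite_ordLess_infinite[OF card_of_Well_order] by blast
  then show ?thesis by (rule ordLess_imp_ordLeq)
qed

lemma small_Un: "|A| \<le>o \<alpha> \<Longrightarrow> |B| \<le>o \<alpha> \<Longrightarrow> |A \<union> B| \<le>o \<alpha>"
  using \<alpha> by (intro card_of_Un_ordLeq_infinite_Field) (auto simp: cinfinite_def)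

lemma small_UN: "|I| \<le>o \<alpha> \<Longrightarrow> (\<And>i. i \<in> I \<Longrightarrow> |A i| \<le>o \<alpha>) \<Longrightarrow> |\<Union>i\<in>I. A i| \<le>o \<alpha>"
  using \<alpha> by (intro card_of_UNION_ordLeq_infinite_Field) (auto simp: cinfinite_def)

lemma small_Times: "|A| \<le>o \<alpha> \<Longrightarrow> |B| \<le>o \<alpha> \<Longrightarrow> |A \<times> B| \<le>o \<alpha>"
  using \<alpha> by (intro card_of_Times_ordLeq_infinite_Field) (auto simp: cinfinite_def)

lemma small_countable: "countable (A :: 'd set) \<Longrightarrow> |A| \<le>o \<alpha>"
proof -
  assume "countable A"
  then obtain f :: "'d \<Rightarrow> nat" where f: "inj_on f A" by (auto simp: countable_def)
  have "|A| \<le>o |UNIV :: nat set|" using f by (auto simp: card_of_ordLeq[symmetric])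
  moreover have "|UNIV :: nat set| \<le>o \<alpha>"
    using natLeq_ordLeq_cinfinite[OF \<alpha>] card_of_nat ordIso_ordLeq_trans by blast
  ultimately show ?thesis by (rule ordLeq_transitive)
qed

lemma small_Fpow: "|A| \<le>o \<alpha> \<Longrightarrow> |Fpow A| \<le>o \<alpha>"
proof (cases "finite A")
  case True
  then have "finite (Fpow A)" by (auto simp: Fpow_def intro: finite_subset[of _ "Pow A"])
  then show ?thesis by (rule small_finite)
next
  case False
  assume "|A| \<le>o \<alpha>"
  then show ?thesis using card_of_Fpow_infinite[OF False] ordIso_ordLeq_trans by blast
qed

end

lemma ex_maximal_element:
  assumes "Linear_order r" "finite A" "A \<noteq> {}" "A \<subseteq> Field r"
  shows "\<exists>a\<in>A. \<forall>b\<in>A. (b, a) \<in> r"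
  using assms(2-4)
proof (induction A rule: finite_ne_induct)
  case (singleton x)
  then show ?case using assms(1) by (auto simp: order_on_defs refl_on_def)
next
  case (insert x F)
  then obtain a where a: "a \<in> F" "\<forall>b\<in>F. (b, a) \<in> r" by auto
  have rx: "(x, x) \<in> r" using assms(1) insert.prems by (auto simp: order_on_defs refl_on_def)
  have tr: "trans r" using assms(1) by (auto simp: order_on_defs)
  have "(x, a) \<in> r \<or> (a, x) \<in> r"
    using assms(1) a(1) insert by (auto simp: order_on_defs total_on_def)
  then show ?case
  proof
    assume "(x, a) \<in> r"
    then show ?thesis using a by auto
  next
    assume "(a, x) \<in> r"
    then have "\<forall>b\<in>F. (b, x) \<in> r" using a(2) tr by (meson transD)
    then show ?thesis using rx by auto
  qed
qed

subsection \<open>Independent elements of prescribed orders\<close>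

context comm_group
begin

definition has_order :: "'a \<Rightarrow> nat \<Rightarrow> bool" where
  "has_order x k \<longleftrightarrow> x \<in> carrier G \<and> (\<forall>n::int. x [^] n = \<one> \<longleftrightarrow> int k dvd n)"

text \<open>Elements of infinite order have order \<open>0\<close>.\<close>

definition ample :: "'c rel \<Rightarrow> nat \<Rightarrow> bool" where
  "ample \<alpha> k \<longleftrightarrow> (\<forall>P. |P| \<le>o \<alpha> \<longrightarrow> (\<exists>x. has_order x k \<and> (\<forall>n::int. x [^] n \<in> P \<longrightarrow> x [^] n = \<one>)))"

text \<open>Division by one solution \<open>z0\<close> maps the solutions of \<open>z^n = c\<close>
  injectively into the kernel.\<close>

lemma large_kernel:
  assumes H: "subgroup H G" and c: "\<not> |{z \<in> H. z [^] (n::int) = c}| \<le>o \<alpha>" and \<alpha>: "Cinfinite \<alpha>"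
  shows "\<not> |{z \<in> H. z [^] n = \<one>}| \<le>o \<alpha>"
proof
  assume s: "|{z \<in> H. z [^] n = \<one>}| \<le>o \<alpha>"
  have "{z \<in> H. z [^] n = c} \<noteq> {}" using c small_finite[OF \<alpha> finite.emptyI] by metis
  then obtain z0 where z0: "z0 \<in> H" "z0 [^] n = c" by blast
  interpret H: subgroup H G by (rule H)
  have "|{z \<in> H. z [^] n = c}| \<le>o \<alpha>"
  proof (rule small_inj[OF _ _ s])
    show "inj_on (\<lambda>z. z \<otimes> inv z0) {z \<in> H. z [^] n = c}"
      using z0 by (auto intro!: inj_onI)
    show "(\<lambda>z. z \<otimes> inv z0) ` {z \<in> H. z [^] n = c} \<subseteq> {z \<in> H. z [^] n = \<one>}"
      using z0 by (auto simp: int_pow_mult_distrib m_comm int_pow_inv)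
  qed
  with c show False by blast
qed

text \<open>For \<open>N = p * N'\<close> the \<open>p\<close>-th powers of \<open>N\<close>-torsion
  elements are \<open>N'\<close>-torsion. Either the \<open>N'\<close>-torsion is large and the
  induction applies, or some fibre of the \<open>p\<close>-th power map is large, and then so is its
  kernel.\<close>

lemma large_prime_torsion:
  assumes H: "subgroup H G" and \<alpha>: "Cinfinite \<alpha>"
  shows "N > 0 \<Longrightarrow> \<not> |{z \<in> H. z [^] (int N) = \<one>}| \<le>o \<alpha> \<Longrightarrow> \<exists>p. prime p \<and> \<not> |{z \<in> H. z [^] (int p) = \<one>}| \<le>o \<alpha>"
proof (induction N rule: less_induct)
  case (less N)
  interpret H: subgroup H G by (rule H)
  show ?case
  proof (cases "N = 1")
    case True
    have "{z \<in> H. z [^] (int N) = \<one>} \<subseteq> {\<one>}" using True by auto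
    then have "|{z \<in> H. z [^] (int N) = \<one>}| \<le>o \<alpha>" by (intro small_finite[OF \<alpha>]) (auto intro: finite_subset)
    then show ?thesis using less.prems by blast
  next
    case False
    then obtain p N' where p: "prime p" and N: "N = p * N'" using prime_factor_nat by (metis dvdE)
    have N': "0 < N'" "N' < N" using less.prems(1) N prime_gt_1_nat[OF p] by auto
    let ?Y = "{y \<in> H. y [^] (int N') = \<one>}"
    show ?thesis
    proof (cases "|?Y| \<le>o \<alpha>")
      case False
      then show ?thesis using less.IH[OF N'(2,1)] by blast
    next
      case True
      have "z [^] int p \<in> ?Y" if "z \<in> H" "z [^] int N = \<one>" for z
        using that by (auto simp: N int_pow_pow intro: subgroup_int_pow_closed[OF H])
      then have sub: "{z \<in> H. z [^] (int N) = \<one>} \<subseteq> (\<Union>c\<in>?Y. {z \<in> H. z [^] (int p) = c})" by blast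
      have "\<exists>c. \<not> |{z \<in> H. z [^] (int p) = c}| \<le>o \<alpha>"
      proof (rule ccontr)
        assume "\<nexists>c. \<not> |{z \<in> H. z [^] (int p) = c}| \<le>o \<alpha>"
        then have "|\<Union>c\<in>?Y. {z \<in> H. z [^] (int p) = c}| \<le>o \<alpha>" by (intro small_UN[OF \<alpha> True]) blast
        then show False using small_subset[OF sub] less.prems(2) by blast
      qed
      then show ?thesis using large_kernel[OF H _ \<alpha>] p by blast
    qed
  qed
qed

lemma subgroup_nat_powers: "subgroup ((\<lambda>x. x [^] (m::nat)) ` carrier G) G"
proof
  fix x y assume "x \<in> (\<lambda>x. x [^] m) ` carrier G" "y \<in> (\<lambda>x. x [^] m) ` carrier G"
  then obtain a b where "x = a [^] m" "y = b [^] m" "a \<in> carrier G" "b \<in> carrier G" by blast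
  then show "x \<otimes> y \<in> (\<lambda>x. x [^] m) ` carrier G" by (metis imageI m_closed nat_pow_distrib)
next
  show "\<one> \<in> (\<lambda>x. x [^] m) ` carrier G" by (metis imageI nat_pow_one one_closed)
  fix x assume "x \<in> (\<lambda>x. x [^] m) ` carrier G"
  then obtain a where "x = a [^] m" "a \<in> carrier G" by blast
  then have "inv x = inv a [^] m" "inv a \<in> carrier G" by (simp_all add: nat_pow_inv)
  then show "inv x \<in> (\<lambda>x. x [^] m) ` carrier G" by blast
qed auto

text \<open>If order 0 is not ample, a small set \<open>Q\<close> contains some power with non-zero
  exponent of every element. The \<open>m\<close>-th powers are then covered by at most
  \<open>\<alpha>\<close> fibres of such power maps, so one fibre is large, hence one kernel, hence
  the torsion for some prime.\<close>

lemma large_multiples_cases: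
  assumes \<alpha>: "Cinfinite \<alpha>" and large: "\<not> |(\<lambda>x. x [^] (m::nat)) ` carrier G| \<le>o \<alpha>"
  shows "ample \<alpha> 0 \<or> (\<exists>p. prime p \<and> \<not> |{z \<in> (\<lambda>x. x [^] (m::nat)) ` carrier G. z [^] (int p) = \<one>}| \<le>o \<alpha>)"
proof (cases "ample \<alpha> 0")
  case False
  let ?H = "(\<lambda>x. x [^] m) ` carrier G"
  have H: "subgroup ?H G" by (rule subgroup_nat_powers)
  obtain P where P: "|P| \<le>o \<alpha>" "\<And>x. has_order x 0 \<Longrightarrow> \<exists>n::int. x [^] n \<in> P \<and> x [^] n \<noteq> \<one>"
    using False by (auto simp: ample_def)
  define Q where "Q = insert \<one> P"
  have Q: "|Q| \<le>o \<alpha>" unfolding Q_def using small_Un[OF \<alpha> small_finite[OF \<alpha>, of "{\<one>}"] P(1)] by simp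
  have ex: "\<exists>n::int. n \<noteq> 0 \<and> x [^] n \<in> Q" if x: "x \<in> carrier G" for x
  proof (cases "has_order x 0")
    case True
    then obtain n :: int where "x [^] n \<in> P" "x [^] n \<noteq> \<one>" using P(2) by blast
    then show ?thesis by (intro exI[of _ n]) (auto simp: Q_def)
  next
    case False
    then obtain n :: int where "(x [^] n = \<one>) \<noteq> (n = 0)" using x by (auto simp: has_order_def)
    then show ?thesis by (intro exI[of _ n]) (auto simp: Q_def)
  qed
  have sub: "?H \<subseteq> (\<Union>q\<in>UNIV \<times> Q. if fst q = 0 then {} else {z \<in> ?H. z [^] (fst q :: int) = snd q})" (is "_ \<subseteq> ?R")
  proof
    fix z assume z: "z \<in> ?H"
    then obtain n :: int where "n \<noteq> 0" "z [^] n \<in> Q" using ex[of z] by auto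
    then show "z \<in> ?R" using z by (intro UN_I[of "(n, z [^] n)"]) auto
  qed
  have "\<exists>n c. n \<noteq> 0 \<and> \<not> |{z \<in> ?H. z [^] (n::int) = c}| \<le>o \<alpha>"
  proof (rule ccontr)
    assume *: "\<not> ?thesis"
    have "|if fst q = 0 then {} else {z \<in> ?H. z [^] (fst q :: int) = snd q}| \<le>o \<alpha>" for q
      using * small_finite[OF \<alpha> finite.emptyI] by (cases "fst q = 0") auto
    then have "|?R| \<le>o \<alpha>"
      by (intro small_UN[OF \<alpha>] small_Times[OF \<alpha>] Q) (auto intro: small_countable[OF \<alpha> countableI_type])
    then show False using small_subset[OF sub] large by blast
  qed
  then obtain n :: int and c where n: "n \<noteq> 0" "\<not> |{z \<in> ?H. z [^] n = c}| \<le>o \<alpha>" by blast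
  have "\<not> |{z \<in> ?H. z [^] n = \<one>}| \<le>o \<alpha>" by (rule large_kernel[OF H n(2) \<alpha>])
  moreover have "{z \<in> ?H. z [^] n = \<one>} = {z \<in> ?H. z [^] int (nat \<bar>n\<bar>) = \<one>}"
    by (auto simp: abs_if int_pow_neg inv_eq_1_iff)
  ultimately show ?thesis using large_prime_torsion[OF H \<alpha>, of "nat \<bar>n\<bar>"] n(1) by auto
qed simp

text \<open>Unless 0 is ample, \<open>k\<close> is the first power not dividing \<open>m\<close> of
  a prime \<open>p\<close> for which the \<open>m\<close>-th powers have large
  \<open>p\<close>-torsion.\<close>

lemma ex_ample:
  assumes \<alpha>: "Cinfinite \<alpha>" and m: "m > 0" and large: "\<not> |(\<lambda>x. x [^] (m::nat)) ` carrier G| \<le>o \<alpha>"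
  shows "\<exists>k. ample \<alpha> k \<and> \<not> k dvd m"
proof (cases "ample \<alpha> 0")
  case True
  then show ?thesis using m by (intro exI[of _ 0]) auto
next
  case False
  let ?H = "(\<lambda>x. x [^] m) ` carrier G"
  obtain p where p: "prime p" and big: "\<not> |{z \<in> ?H. z [^] (int p) = \<one>}| \<le>o \<alpha>"
    using large_multiples_cases[OF \<alpha> large] False by blast
  define e where "e = multiplicity p m"
  obtain m' where m': "m = p ^ e * m'" using multiplicity_dvd[of p m] by (auto simp: e_def dvd_def)
  define k where "k = p ^ Suc e"
  have kdvd: "\<not> k dvd m"
    unfolding k_def e_def using m p by (subst power_dvd_iff_le_multiplicity) (auto simp: not_prime_unit)
  \<comment> \<open>An \<open>m\<close>-th power of prime order \<open>p\<close> outside a given small set is itself a power of an element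
    of order \<open>k\<close>, and it lies in every non-trivial subgroup generated by powers of that element.\<close>
  have "ample \<alpha> k"
    unfolding ample_def
  proof (intro allI impI)
    fix P :: "'a set" assume P: "|P| \<le>o \<alpha>"
    \<comment> \<open>All powers of elements of \<open>P\<close> are excluded, because
      \<open>x^m\<close> will be a power of each non-trivial \<open>y^n\<close>: if
      \<open>y^n\<close> lay in \<open>P\<close>, then \<open>x^m\<close> would lie in
      \<open>Q\<close>.\<close>
    define Q where "Q = insert \<one> ((\<lambda>q. fst q [^] (snd q :: int)) ` (P \<times> UNIV))"
    have "|(\<lambda>q. fst q [^] (snd q :: int)) ` (P \<times> UNIV)| \<le>o \<alpha>"
      by (intro small_image small_Times[OF \<alpha>] P small_countable[OF \<alpha>]) auto
    then have Q: "|Q| \<le>o \<alpha>" unfolding Q_def using small_Un[OF \<alpha> small_finite[OF \<alpha>, of "{\<one>}"]] by simp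
    have "\<not> {z \<in> ?H. z [^] (int p) = \<one>} \<subseteq> Q" using big small_subset[OF _ Q] by blast
    then obtain x where x: "x \<in> carrier G" "(x [^] m) [^] int p = \<one>" "x [^] m \<notin> Q" by blast
    define y where "y = x [^] m'"
    have y: "y \<in> carrier G" using x by (simp add: y_def)
    have ye: "y [^] int (p ^ e) = x [^] m"
      using x by (simp only: y_def int_pow_int nat_pow_pow m' mult.commute)
    have yk: "y [^] int k = \<one>"
    proof -
      have "y [^] int k = (y [^] int (p ^ e)) [^] int p" using y by (simp only: k_def int_pow_pow power_Suc2 of_nat_mult)
      then show ?thesis using ye x(2) by simp
    qed
    have key: "\<exists>a::int. (y [^] n) [^] a = x [^] m" if n: "\<not> int k dvd n" for n :: int
    proof -
      \<comment> \<open>The gcd is a power of \<open>p\<close> properly dividing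
        \<open>k = p^(e + 1)\<close>, so it divides \<open>p^e\<close>; Bezout then writes
        \<open>p^e\<close> as a multiple of \<open>n\<close> modulo \<open>k\<close>.\<close>
      have "nat (gcd n (int k)) dvd k" by (metis gcd_dvd2 gcd_ge_0_int int_nat_eq int_dvd_int_iff)
      then obtain i where i: "i \<le> Suc e" "nat (gcd n (int k)) = p ^ i"
        unfolding k_def using divides_primepow_nat[OF p] by blast
      then have gi: "gcd n (int k) = int (p ^ i)" by (metis gcd_ge_0_int int_nat_eq)
      have "i \<noteq> Suc e" using n gi by (metis gcd_dvd1 k_def)
      then have "p ^ i dvd p ^ e" using i(1) by (simp add: le_imp_power_dvd)
      then have "gcd n (int k) dvd int (p ^ e)" unfolding gi by (simp only: int_dvd_int_iff)
      then obtain c where c: "int (p ^ e) = gcd n (int k) * c" by (auto simp: dvd_def)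
      obtain u v where uv: "u * n + v * int k = gcd n (int k)" using bezout_int by blast
      have "(y [^] n) [^] (u * c) = y [^] (n * (u * c))" using y by (simp add: int_pow_pow)
      also have "\<dots> = y [^] (n * (u * c)) \<otimes> (y [^] int k) [^] (v * c)" using y by (simp add: yk)
      also have "\<dots> = y [^] (n * (u * c) + int k * (v * c))" using y by (simp add: int_pow_pow int_pow_mult)
      also have "n * (u * c) + int k * (v * c) = (u * n + v * int k) * c" by (simp add: algebra_simps)
      also have "\<dots> = int (p ^ e)" using uv c by simp
      finally have "(y [^] n) [^] (u * c) = x [^] m" unfolding ye .
      then show ?thesis by (rule exI)
    qed
    have ord: "y [^] n = \<one> \<longleftrightarrow> int k dvd n" for n :: int
    proof
      assume 1: "y [^] n = \<one>"
      show "int k dvd n"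
      proof (rule ccontr)
        assume "\<not> int k dvd n"
        then obtain a :: int where "(y [^] n) [^] a = x [^] m" using key by blast
        then show False using 1 x(3) by (simp add: Q_def)
      qed
    next
      assume "int k dvd n"
      then obtain j where "n = int k * j" by (auto simp: dvd_def)
      then have "y [^] n = (y [^] int k) [^] j" using y by (simp only: int_pow_pow)
      then show "y [^] n = \<one>" using yk by simp
    qed
    have "y [^] n = \<one>" if n: "y [^] n \<in> P" for n :: int
    proof (rule ccontr)
      assume "y [^] n \<noteq> \<one>"
      then obtain a :: int where "(y [^] n) [^] a = x [^] m" using key ord by blast
      then have "x [^] m \<in> Q" unfolding Q_def using n by (intro insertI2 image_eqI[of _ _ "(y [^] n, a)"]) auto
      then show False using x(3) by blast
    qed
    then show "\<exists>x. has_order x k \<and> (\<forall>n::int. x [^] n \<in> P \<longrightarrow> x [^] n = \<one>)"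
      using y ord by (auto simp: has_order_def)
  qed
  then show ?thesis using kdvd by blast
qed

text \<open>Transfinite recursion along a well-order of \<open>W\<close> whose proper initial
  segments have at most \<open>\<alpha>\<close> elements. The products of powers of earlier choices
  then form a small set, and ampleness supplies an element of the prescribed order whose cyclic
  group meets it trivially.\<close>

lemma ex_independent_family:
  fixes W :: "'w set" and ordr :: "'w \<Rightarrow> nat"
  assumes \<alpha>: "Cinfinite \<alpha>" and W: "|W| \<le>o cardSuc \<alpha>" and k: "\<And>w. w \<in> W \<Longrightarrow> ample \<alpha> (ordr w)"
  obtains x where "\<And>w. w \<in> W \<Longrightarrow> has_order (x w) (ordr w)"
    "\<And>F (n :: 'w \<Rightarrow> int). finite F \<Longrightarrow> F \<subseteq> W \<Longrightarrow> finprod G (\<lambda>w. x w [^] n w) F = \<one> \<Longrightarrow> \<forall>w\<in>F. int (ordr w) dvd n w"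
proof -
  define r where "r = |W|"
  have Cr: "Card_order r" and Fr: "Field r = W" by (auto simp: r_def card_of_Card_order Field_card_of)
  have wo: "Well_order r" by (simp add: r_def card_of_Well_order)
  have lin: "Linear_order r" using wo by (simp add: well_order_on_def)
  have seg: "|underS r w| \<le>o \<alpha>" if w: "w \<in> W" for w
  proof -
    have "|underS r w| <o r" using card_of_underS[OF Cr] w Fr by blast
    then have "|underS r w| <o cardSuc \<alpha>" using W ordLess_ordLeq_trans unfolding r_def by blast
    then show ?thesis using cardSuc_ordLeq_ordLess[of \<alpha> "|underS r w|"] \<alpha> card_of_Card_order by blast
  qed
  \<comment> \<open>The demand that the values lie in the carrier is there because the recursion
    meets arbitrary functions \<open>x\<close>.\<close>
  define Gen where "Gen x w = {finprod G (\<lambda>v. x v [^] n v) F | F (n :: 'w \<Rightarrow> int). finite F \<and> F \<subseteq> underS r w \<and> x ` F \<subseteq> carrier G}"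
    for x :: "'w \<Rightarrow> 'a" and w
  have Gen_small: "|Gen x w| \<le>o \<alpha>" if w: "w \<in> W" for x w
  proof -
    have "Gen x w \<subseteq> (\<lambda>S. finprod G (\<lambda>q. x (fst q) [^] (snd q :: int)) S) ` Fpow (underS r w \<times> UNIV)"
    proof
      fix g assume "g \<in> Gen x w"
      then obtain F and n :: "'w \<Rightarrow> int" where g: "g = finprod G (\<lambda>v. x v [^] n v) F"
        and F: "finite F" "F \<subseteq> underS r w" "x ` F \<subseteq> carrier G" unfolding Gen_def by blast
      have "finprod G (\<lambda>q. x (fst q) [^] (snd q :: int)) ((\<lambda>v. (v, n v)) ` F) = g"
        unfolding g using F by (subst finprod_reindex) (auto simp: inj_on_def)
      moreover have "(\<lambda>v. (v, n v)) ` F \<in> Fpow (underS r w \<times> UNIV)" using F by (auto simp: Fpow_def)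
      ultimately show "g \<in> (\<lambda>S. finprod G (\<lambda>q. x (fst q) [^] (snd q :: int)) S) ` Fpow (underS r w \<times> UNIV)" by blast
    qed
    moreover have "|(\<lambda>S. finprod G (\<lambda>q. x (fst q) [^] (snd q :: int)) S) ` Fpow (underS r w \<times> UNIV)| \<le>o \<alpha>"
      by (intro small_image small_Fpow[OF \<alpha>] small_Times[OF \<alpha>] seg w small_countable[OF \<alpha>]) auto
    ultimately show ?thesis by (rule small_subset)
  qed
  \<comment> \<open>Outside \<open>W\<close> the requirement is void, because the recursion runs
    over the whole type. Inverses are avoided since a relation equates a power of its last element
    with the inverse of the product of the others.\<close>
  define R where "R x w y \<longleftrightarrow> (w \<in> W \<longrightarrow> has_order y (ordr w) \<and> (\<forall>n::int. y [^] n \<in> (\<lambda>g. inv g) ` Gen x w \<longrightarrow> y [^] n = \<one>))"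
    for x w y
  have "\<exists>x. \<forall>w. R x w (x w)"
  proof (rule dependent_wf_choice)
    show "wf (r - Id)" using wo by (simp add: well_order_on_def)
    fix x z :: "'w \<Rightarrow> 'a" and w y assume eq: "\<And>v. (v, w) \<in> r - Id \<Longrightarrow> x v = z v"
    have "Gen x w \<subseteq> Gen z w" if eq: "\<And>v. (v, w) \<in> r - Id \<Longrightarrow> x v = z v" for x z :: "'w \<Rightarrow> 'a"
    proof
      fix g assume "g \<in> Gen x w"
      then obtain F and n :: "'w \<Rightarrow> int" where g: "g = finprod G (\<lambda>v. x v [^] n v) F"
        and F: "finite F" "F \<subseteq> underS r w" "x ` F \<subseteq> carrier G" unfolding Gen_def by blast
      have xz: "x v = z v" if "v \<in> F" for v using eq that F(2) by (auto simp: underS_def)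
      then have "g = finprod G (\<lambda>v. z v [^] n v) F" unfolding g using F by (intro finprod_cong') auto
      moreover have "z ` F \<subseteq> carrier G" using xz F(3) by auto
      ultimately show "g \<in> Gen z w" unfolding Gen_def using F by blast
    qed
    then have "Gen x w = Gen z w" using eq by (metis subset_antisym)
    then show "R x w y = R z w y" by (simp add: R_def)
  next
    fix w and x :: "'w \<Rightarrow> 'a"
    show "\<exists>y. R x w y"
    proof (cases "w \<in> W")
      case True
      have "|(\<lambda>g. inv g) ` Gen x w| \<le>o \<alpha>" by (intro small_image Gen_small True)
      then show ?thesis using k[OF True] unfolding R_def ample_def by blast
    qed (simp add: R_def)
  qed
  then obtain x where x: "\<And>w. R x w (x w)" by blast
  have ord: "has_order (x w) (ordr w)" if "w \<in> W" for w using x[of w] that by (simp add: R_def)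
  have xc: "x w \<in> carrier G" if "w \<in> W" for w using ord[OF that] by (simp add: has_order_def)
  have xpow: "x w [^] n = \<one> \<longleftrightarrow> int (ordr w) dvd n" if "w \<in> W" for w and n :: int
    using ord[OF that] by (simp add: has_order_def)
  have indep: "\<forall>w\<in>F. int (ordr w) dvd n w"
    if F: "finite F" "F \<subseteq> W" and one: "finprod G (\<lambda>w. x w [^] n w) F = \<one>" for F and n :: "'w \<Rightarrow> int"
  proof (rule ccontr)
    assume *: "\<not> ?thesis"
    \<comment> \<open>The trivial factors are dropped. For the last remaining \<open>w\<close> the
      relation makes its power the inverse of an element of \<open>Gen x w\<close>, hence trivial,
      contrary to \<open>w\<close> being in \<open>F'\<close>.\<close>
    define F' where "F' = {w\<in>F. \<not> int (ordr w) dvd n w}"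
    have F': "finite F'" "F' \<noteq> {}" "F' \<subseteq> Field r" "F' \<subseteq> F" using F * by (auto simp: F'_def Fr)
    obtain w where w: "w \<in> F'" "\<forall>v\<in>F'. (v, w) \<in> r" using ex_maximal_element[OF lin F'(1-3)] by blast
    have wW: "w \<in> W" using w(1) F'(3) Fr by blast
    have cl: "(\<lambda>w. x w [^] n w) \<in> F \<rightarrow> carrier G" using xc F(2) by auto
    have "finprod G (\<lambda>w. x w [^] n w) F' = finprod G (\<lambda>w. x w [^] n w) F"
      by (rule finprod_mono_neutral_cong_left) (use F F' xpow xc in \<open>auto simp: F'_def\<close>)
    then have "finprod G (\<lambda>w. x w [^] n w) (insert w (F' - {w})) = \<one>" using one w(1) by (simp add: insert_absorb)
    then have mul: "x w [^] n w \<otimes> finprod G (\<lambda>w. x w [^] n w) (F' - {w}) = \<one>"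
      using F'(1) cl F'(4) w(1) by (subst (asm) finprod_insert) auto
    let ?g = "finprod G (\<lambda>w. x w [^] n w) (F' - {w})"
    have gc: "?g \<in> carrier G" using cl F'(4) by (intro finprod_closed) auto
    have "F' - {w} \<subseteq> underS r w" using w(2) by (auto simp: underS_def)
    moreover have "x ` (F' - {w}) \<subseteq> carrier G" using xc F'(3) Fr by auto
    ultimately have "?g \<in> Gen x w" unfolding Gen_def using F'(1) by blast
    moreover have "x w [^] n w = inv ?g" using mul gc xc[OF wW] by (simp add: inv_equality)
    ultimately have "x w [^] n w = \<one>" using x[of w] wW unfolding R_def by blast
    then show False using xpow[OF wW] w(1) by (simp add: F'_def)
  qed
  show ?thesis by (rule that[OF ord indep])
qed

end

subsection \<open>Weight\<close>

lemma weight_minimal: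
  obtains \<D> where "base_of_topology X \<D>" "weight X = |\<D>|" "\<And>\<C>. base_of_topology X \<C> \<Longrightarrow> |\<D>| \<le>o |\<C>|"
proof -
  let ?R = "{|\<C>| | \<C>. base_of_topology X \<C>}"
  have "base_of_topology X {V. openin X V}" by (auto simp: base_of_topology_def)
  then have "?R \<noteq> {}" by blast
  moreover have "\<forall>r\<in>?R. Card_order r" using card_of_Card_order by blast
  ultimately have "\<exists>r\<in>?R. \<forall>r'\<in>?R. r \<le>o r'" by (rule exists_minim_Card_order)
  then have "\<exists>\<B>. base_of_topology X \<B> \<and> (\<forall>\<C>. base_of_topology X \<C> \<longrightarrow> |\<B>| \<le>o |\<C>| )" by blast
  from someI_ex[OF this] that show ?thesis unfolding weight_def by blast
qed

lemma weight_le: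
  assumes "base_of_topology X \<B>" "|\<B>| \<le>o r"
  shows "weight X \<le>o r"
proof -
  obtain \<D> where D: "weight X = |\<D>|" "|\<D>| \<le>o |\<B>|" using weight_minimal[of X] assms(1) by metis
  show ?thesis unfolding D(1) using D(2) assms(2) by (rule ordLeq_transitive)
qed

text \<open>Finite intersections of preimages of a countable base of the plane form a base: a point
  of \<open>U\<close> is separated from each point outside \<open>U\<close> by disjoint preimages,
  and finitely many of these cover the compact complement of \<open>U\<close>.\<close>

lemma weight_le_of_separating_functions:
  fixes g :: "'i \<Rightarrow> 'x \<Rightarrow> complex"
  assumes \<alpha>: "Cinfinite \<alpha>" and X: "compact_space X" and A: "|A| \<le>o \<alpha>"
    and cont: "\<And>i. i \<in> A \<Longrightarrow> continuous_map X euclidean (g i)"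
    and sep: "\<And>x y. x \<in> topspace X \<Longrightarrow> y \<in> topspace X \<Longrightarrow> x \<noteq> y \<Longrightarrow> \<exists>i\<in>A. g i x \<noteq> g i y"
  shows "weight X \<le>o \<alpha>"
proof -
  obtain \<B> :: "complex set set" where B: "countable \<B>" "topological_basis \<B>" using ex_countable_basis by blast
  define S where "S q = {x \<in> topspace X. g (fst q) x \<in> snd q}" for q :: "'i \<times> complex set"
  define W where "W F = topspace X \<inter> (\<Inter>q\<in>F. S q)" for F
  have So: "openin X (S q)" if "q \<in> A \<times> \<B>" for q
    unfolding S_def using that cont topological_basis_open[OF B(2)]
    by (intro openin_continuous_map_preimage[of X euclidean]) (auto simp: open_openin[symmetric])
  have Wo: "openin X (W F)" if "F \<in> Fpow (A \<times> \<B>)" for F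
  proof (cases "F = {}")
    case False
    then have "openin X (\<Inter>q\<in>F. S q)" using that So by (intro openin_INT2) (auto simp: Fpow_def)
    then show ?thesis unfolding W_def by (intro openin_Int) auto
  qed (simp add: W_def)
  have "base_of_topology X (W ` Fpow (A \<times> \<B>))"
    unfolding base_of_topology_def
  proof (intro conjI allI impI ballI)
    fix V assume "V \<in> W ` Fpow (A \<times> \<B>)"
    then show "openin X V" using Wo by blast
  next
    fix U x assume U: "openin X U \<and> x \<in> U"
    then have xX: "x \<in> topspace X" using openin_subset by blast
    have ex: "\<exists>q q'. q \<in> A \<times> \<B> \<and> q' \<in> A \<times> \<B> \<and> x \<in> S q \<and> y \<in> S q' \<and> S q \<inter> S q' = {}"
      if y: "y \<in> topspace X - U" for y
    proof -
      have "x \<noteq> y" using y U by blast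
      then obtain i where i: "i \<in> A" "g i x \<noteq> g i y" using sep[OF xX, of y] y by blast
      obtain P Q where PQ: "open P" "open Q" "g i x \<in> P" "g i y \<in> Q" "P \<inter> Q = {}"
        using hausdorff[OF i(2)] by blast
      obtain P' where P': "P' \<in> \<B>" "g i x \<in> P'" "P' \<subseteq> P" using topological_basisE[OF B(2) PQ(1,3)] .
      obtain Q' where Q': "Q' \<in> \<B>" "g i y \<in> Q'" "Q' \<subseteq> Q" using topological_basisE[OF B(2) PQ(2,4)] .
      show ?thesis
        by (rule exI[of _ "(i, P')"], rule exI[of _ "(i, Q')"]) (use i P' Q' PQ(5) xX y in \<open>auto simp: S_def\<close>)
    qed
    then obtain q q' where q: "\<And>y. y \<in> topspace X - U \<Longrightarrow> q y \<in> A \<times> \<B> \<and> q' y \<in> A \<times> \<B> \<and> x \<in> S (q y) \<and> y \<in> S (q' y) \<and> S (q y) \<inter> S (q' y) = {}"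
      by metis
    have "closedin X (topspace X - U)" using U by (simp add: closedin_diff)
    then have "compactin X (topspace X - U)" using X closedin_compact_space by blast
    then have "\<exists>\<F>. finite \<F> \<and> \<F> \<subseteq> (\<lambda>y. S (q' y)) ` (topspace X - U) \<and> topspace X - U \<subseteq> \<Union>\<F>"
    proof (rule compactinD)
      fix V assume "V \<in> (\<lambda>y. S (q' y)) ` (topspace X - U)"
      then obtain y where "y \<in> topspace X - U" "V = S (q' y)" by blast
      then show "openin X V" using q So by blast
    qed (use q in auto)
    then obtain Y where Y: "finite Y" "Y \<subseteq> topspace X - U" "topspace X - U \<subseteq> (\<Union>y\<in>Y. S (q' y))"
      by (metis finite_subset_image)
    have "q ` Y \<subseteq> A \<times> \<B>" using Y(2) q by blast
    then have F: "q ` Y \<in> Fpow (A \<times> \<B>)" using Y(1) by (simp add: Fpow_def)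
    have "x \<in> W (q ` Y)" using xX Y(2) q unfolding W_def by blast
    moreover have "W (q ` Y) \<subseteq> U"
    proof
      fix z assume z: "z \<in> W (q ` Y)"
      show "z \<in> U"
      proof (rule ccontr)
        assume "z \<notin> U"
        then obtain y where y: "y \<in> Y" "z \<in> S (q' y)" using z Y(3) by (auto simp: W_def)
        moreover have "z \<in> S (q y)" using z y(1) by (auto simp: W_def)
        ultimately show False using q[of y] Y(2) by blast
      qed
    qed
    ultimately show "\<exists>V\<in>W ` Fpow (A \<times> \<B>). x \<in> V \<and> V \<subseteq> U" using F by blast
  qed
  moreover have "|W ` Fpow (A \<times> \<B>)| \<le>o \<alpha>"
    by (intro small_image small_Fpow[OF \<alpha>] small_Times[OF \<alpha>] A small_countable[OF \<alpha>] B(1))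
  ultimately show ?thesis by (rule weight_le)
qed

text \<open>Coordinates are indexed by pairs of members of a minimal base; each carries, if there is
  one, a continuous function that is 0 on the first member and 1 on the second. Other pairs get the
  constant 0.\<close>

lemma embedding_of_weight_le:
  fixes X :: "'x topology"
  assumes \<alpha>: "Cinfinite \<alpha>" and X: "completely_regular_space X" "Hausdorff_space X" and w: "weight X \<le>o \<alpha>"
  obtains e where "continuous_map X (product_topology (\<lambda>_. euclideanreal) (Field \<alpha>)) e" "inj_on e (topspace X)"
proof (cases "topspace X = {}")
  case True
  show ?thesis
    by (rule that[of "\<lambda>_. \<lambda>i\<in>Field \<alpha>. 0"]) (use True in \<open>auto simp: continuous_map_componentwise_UNIV continuous_map_on_empty\<close>)
next
  case False
  obtain \<C> where C: "base_of_topology X \<C>" "weight X = |\<C>|" using weight_minimal[of X] by metis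
  have "\<C> \<noteq> {}" using False C(1) unfolding base_of_topology_def by (metis all_not_in_conv openin_topspace)
  have "|\<C> \<times> \<C>| \<le>o \<alpha>" using w unfolding C(2) by (intro small_Times[OF \<alpha>])
  then have "|\<C> \<times> \<C>| \<le>o |Field \<alpha>|"
    using \<alpha> card_of_Field_ordIso ordIso_symmetric ordLeq_ordIso_trans by blast
  then obtain \<sigma> where \<sigma>: "\<sigma> ` Field \<alpha> = \<C> \<times> \<C>"
    using card_of_ordLeq2[of "\<C> \<times> \<C>" "Field \<alpha>"] \<open>\<C> \<noteq> {}\<close> by auto
  define sepf where "sepf B B' f \<longleftrightarrow> continuous_map X euclideanreal f \<and> (\<forall>x\<in>B. f x = 0) \<and> (\<forall>x\<in>B'. f x = 1)"
    for B B' and f :: "'x \<Rightarrow> real"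
  define g where "g p = (if \<exists>f. sepf (fst p) (snd p) f then SOME f. sepf (fst p) (snd p) f else (\<lambda>_. 0))" for p
  have g: "sepf (fst p) (snd p) (g p)" if "\<exists>f. sepf (fst p) (snd p) f" for p
    unfolding g_def using that someI_ex[OF that] by simp
  have gc: "continuous_map X euclideanreal (g p)" for p
  proof (cases "\<exists>f. sepf (fst p) (snd p) f")
    case True
    then show ?thesis using g[OF True] by (simp add: sepf_def)
  next
    case False
    then show ?thesis by (simp add: g_def)
  qed
  define e where "e x = (\<lambda>i\<in>Field \<alpha>. g (\<sigma> i) x)" for x
  show ?thesis
  proof (rule that[of e])
    show "continuous_map X (product_topology (\<lambda>_. euclideanreal) (Field \<alpha>)) e"
      unfolding continuous_map_componentwise e_def using gc by auto
    show "inj_on e (topspace X)"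
    proof (rule inj_onI, rule ccontr)
      fix x y assume xy: "x \<in> topspace X" "y \<in> topspace X" "e x = e y" "x \<noteq> y"
      have "closedin X {y}" using X(2) xy(2) by (simp add: closedin_Hausdorff_singleton)
      moreover have "x \<in> topspace X - {y}" using xy by blast
      ultimately obtain \<phi> where phi: "continuous_map X (top_of_set {0..1::real}) \<phi>" "\<phi> x = 0" "\<phi> ` {y} \<subseteq> {1}"
        using X(1) unfolding completely_regular_space_def by metis
      have pc: "continuous_map X euclideanreal \<phi>" using phi(1) by (rule continuous_map_into_fulltopology)
      \<comment> \<open>Truncation turns a function separating two points into one that is constant
        near each of them, hence on members of the base.\<close>
      define f where "f x = max 0 (min 1 (3 * \<phi> x - 1))" for x
      have "continuous_map X euclideanreal ((\<lambda>t. max 0 (min 1 (3 * t - 1))) \<circ> \<phi>)"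
        by (rule continuous_map_compose[OF pc]) (auto intro!: continuous_intros)
      then have fc: "continuous_map X euclideanreal f" by (simp add: f_def[abs_def] o_def)
      have "openin X {z \<in> topspace X. \<phi> z \<in> {..<1/3}}" "openin X {z \<in> topspace X. \<phi> z \<in> {2/3<..}}"
        by (rule openin_continuous_map_preimage[OF pc], simp add: open_openin[symmetric])+
      moreover have "x \<in> {z \<in> topspace X. \<phi> z \<in> {..<1/3}}" "y \<in> {z \<in> topspace X. \<phi> z \<in> {2/3<..}}"
        using xy phi by auto
      ultimately obtain B B' where B: "B \<in> \<C>" "x \<in> B" "B \<subseteq> {z \<in> topspace X. \<phi> z \<in> {..<1/3}}"
        and B': "B' \<in> \<C>" "y \<in> B'" "B' \<subseteq> {z \<in> topspace X. \<phi> z \<in> {2/3<..}}"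
        using C(1) unfolding base_of_topology_def by meson
      have "sepf B B' f" unfolding sepf_def using fc B(3) B'(3) by (auto simp: f_def)
      then have s: "sepf B B' (g (B, B'))" using g[of "(B, B')"] by auto
      obtain i where i: "i \<in> Field \<alpha>" "\<sigma> i = (B, B')" using \<sigma> B(1) B'(1) by (metis SigmaI imageE)
      have "g (B, B') x = g (B, B') y" using xy(3) i unfolding e_def by (metis restrict_apply')
      then show False using s B(2) B'(2) by (simp add: sepf_def)
    qed
  qed
qed

subsection \<open>Singular groups are extremal\<close>

text \<open>The relation \<open>y^m = \<one>\<close> makes every non-empty set dependent, so the
  maximal independent set chosen in \<open>free_rank\<close> is empty.\<close>

lemma free_rank_bounded:
  fixes G :: "('a, 'b) monoid_scheme"
  assumes "comm_group G" "m > 0" "\<And>x. x \<in> carrier G \<Longrightarrow> x [^]\<^bsub>G\<^esub> (m::nat) = \<one>\<^bsub>G\<^esub>"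
  shows "free_rank G = |{}|"
proof -
  interpret comm_group G by fact
  have empty: "Y = {}" if Y: "independent_in G Y" for Y
  proof (rule ccontr)
    assume "Y \<noteq> {}"
    then obtain y where y: "y \<in> Y" by blast
    then have yc: "y \<in> carrier G" using Y by (auto simp: independent_in_def)
    have "finprod G (\<lambda>x. x [^]\<^bsub>G\<^esub> (\<lambda>_. int m) x) {y} = \<one>\<^bsub>G\<^esub>"
      using yc assms(3)[OF yc] by (simp add: int_pow_int)
    moreover have "\<forall>F (n :: 'a \<Rightarrow> int). finite F \<and> F \<subseteq> Y \<and> finprod G (\<lambda>x. x [^]\<^bsub>G\<^esub> n x) F = \<one>\<^bsub>G\<^esub> \<longrightarrow> (\<forall>x\<in>F. n x = 0)"
      using Y unfolding independent_in_def by (rule conjunct2)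
    ultimately have "int m = 0" using y by (auto dest!: spec[of _ "{y}"] spec[of _ "\<lambda>_. int m"])
    then show False using assms(2) by simp
  qed
  have "independent_in G {}" by (auto simp: independent_in_def)
  then have "(SOME X. independent_in G X \<and> (\<forall>Y. independent_in G Y \<and> X \<subseteq> Y \<longrightarrow> Y = X)) = {}"
    using empty by (intro some_equality) blast+
  then show ?thesis unfolding free_rank_def by simp
qed

lemma compact_space_alpha_pseudocompact: "compact_space X \<Longrightarrow> alpha_pseudocompact \<alpha> X"
  unfolding alpha_pseudocompact_def compact_space_def using image_compactin by blast

context compact_abelian_group
begin

lemma nat_pow_cont: "continuous_map T T (\<lambda>x. x [^] (m::nat))"
proof (induction m)
  case (Suc m)
  then show ?case using mult_cont2[OF Suc continuous_map_id[unfolded id_def]] by simp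
qed (simp add: topspace)

theorem singular_imp_extremal:
  assumes \<alpha>: "Cinfinite \<alpha>" and sing: "alpha_singular \<alpha> G T"
  shows "c_extremal \<alpha> G T"
  unfolding c_extremal_def
proof (intro conjI allI impI)
  show "topological_abelian_group G T" by (rule top_ab)
  show "alpha_pseudocompact \<alpha> T" using compact by (rule compact_space_alpha_pseudocompact)
  fix D assume D: "subgroup D G \<and> T closure_of D = topspace T \<and> alpha_pseudocompact \<alpha> (subtopology T D)"
  obtain m :: nat where m: "m > 0" and w: "weight (subtopology T ((\<lambda>x. x [^] m) ` carrier G)) \<le>o \<alpha>"
    using sing unfolding alpha_singular_def by blast
  let ?Y = "(\<lambda>x. x [^] m) ` carrier G" and ?P = "product_topology (\<lambda>_. euclideanreal) (Field \<alpha>)"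
  let ?X = "subtopology T ?Y"
  have Ysub: "?Y \<subseteq> carrier G" by auto
  have tY: "topspace ?X = ?Y" using Ysub by (simp add: topspace inf_absorb2)
  have DG: "D \<subseteq> carrier G" using D subgroup.subset by blast
  obtain e where e: "continuous_map ?X ?P e" "inj_on e (topspace ?X)"
    using embedding_of_weight_le[OF \<alpha> completely_regular_space_subtopology[OF creg] Hausdorff_space_subtopology[OF Hausdorff] w] .
  have pc: "continuous_map T ?X (\<lambda>x. x [^] m)"
    using nat_pow_cont by (simp add: continuous_map_in_subtopology topspace)
  have fc: "continuous_map T ?P (\<lambda>x. e (x [^] m))"
    using continuous_map_compose[OF pc e(1)] by (simp add: o_def)
  let ?Z = "(\<lambda>x. e (x [^] m)) ` D"
  have "continuous_map (subtopology T D) ?P (\<lambda>x. e (x [^] m))"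
    using fc by (rule continuous_map_from_subtopology)
  then have "compactin ?P ((\<lambda>x. e (x [^] m)) ` topspace (subtopology T D))"
    using D unfolding alpha_pseudocompact_def by blast
  moreover have "topspace (subtopology T D) = D" using DG by (simp add: topspace inf_absorb2)
  ultimately have "compactin ?P ?Z" by simp
  then have "closedin ?P ?Z"
    by (intro compactin_imp_closedin) (auto simp: Hausdorff_space_product_topology)
  \<comment> \<open>The preimage of \<open>?Z\<close> is closed and contains the dense
    \<open>D\<close>, so it is everything: each \<open>m\<close>-th power has the same image under
    \<open>e\<close> as the \<open>m\<close>-th power of an element of \<open>D\<close>.\<close>
  then have "closedin T {x \<in> topspace T. e (x [^] m) \<in> ?Z}" using fc by (rule closedin_continuous_map_preimage[rotated])
  moreover have "D \<subseteq> {x \<in> topspace T. e (x [^] m) \<in> ?Z}" using DG by (auto simp: topspace)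
  ultimately have "T closure_of D \<subseteq> {x \<in> topspace T. e (x [^] m) \<in> ?Z}" by (rule closure_of_minimal[rotated])
  then have all: "e (x [^] m) \<in> ?Z" if "x \<in> carrier G" for x using that D topspace by auto
  have powD: "x [^] m \<in> D" if x: "x \<in> carrier G" for x
  proof -
    obtain d where d: "d \<in> D" "e (x [^] m) = e (d [^] m)" using all[OF x] by blast
    then have "x [^] m = d [^] m" using e(2) x DG unfolding tY inj_on_def by blast
    then show ?thesis using d(1) D using subgroup_int_pow_closed[of D d "int m"] by (simp add: int_pow_int)
  qed
  interpret D: normal D G using D by (intro subgroup_imp_normal) blast
  have "free_rank (G Mod D) = |{}|"
  proof (rule free_rank_bounded[OF abelian_FactGroup m])
    show "subgroup D G" using D by blast
    fix X assume "X \<in> carrier (G Mod D)"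
    then obtain x where x: "x \<in> carrier G" "X = D #> x" by (auto simp: carrier_FactGroup)
    have "X [^]\<^bsub>G Mod D\<^esub> m = D #> (x [^] m)" using x D.FactGroup_pow by simp
    also have "\<dots> = D" using powD[OF x(1)] x(1) D by (intro coset_join2) auto
    finally show "X [^]\<^bsub>G Mod D\<^esub> m = \<one>\<^bsub>G Mod D\<^esub>" by simp
  qed
  moreover have "|{}| <o ctwo ^c \<alpha>"
    using small_finite[OF \<alpha> finite.emptyI] ordLess_ctwo_cexp[of \<alpha>] \<alpha> ordLeq_ordLess_trans by blast
  ultimately show "free_rank (G Mod D) <o ctwo ^c \<alpha>" by simp
qed

end

subsection \<open>Free rank\<close>

context comm_group
begin

lemma independentI:
  assumes "Z \<subseteq> carrier G"
    "\<And>F (n :: 'a \<Rightarrow> int) x. finite F \<Longrightarrow> F \<subseteq> Z \<Longrightarrow> finprod G (\<lambda>x. x [^] n x) F = \<one> \<Longrightarrow> x \<in> F \<Longrightarrow> n x = 0"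
  shows "independent_in G Z"
  unfolding independent_in_def
  by (intro conjI allI impI ballI assms(1)) (elim conjE, erule (3) assms(2))

text \<open>Independence has finite character, so Zorn's lemma applies; this makes the choice in
  \<open>free_rank\<close> meaningful.\<close>

lemma ex_maximal_independent:
  "\<exists>X. independent_in G X \<and> (\<forall>Y. independent_in G Y \<and> X \<subseteq> Y \<longrightarrow> Y = X)"
proof -
  let ?A = "{X. independent_in G X}"
  have "\<exists>M\<in>?A. \<forall>X\<in>?A. M \<subseteq> X \<longrightarrow> X = M"
  proof (rule subset_Zorn')
    fix C assume C: "subset.chain ?A C"
    then have CA: "C \<subseteq> ?A" by (simp add: subset.chain_def)
    have sub: "F = {} \<or> (\<exists>X\<in>C. F \<subseteq> X)" if F: "finite F" "F \<subseteq> \<Union>C" for F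
    proof (cases "C = {}")
      case False
      then show ?thesis using finite_subset_Union_chain[OF F False C] by metis
    qed (use F in auto)
    have "independent_in G (\<Union>C)"
      unfolding independent_in_def
    proof (intro conjI allI impI)
      show "\<Union>C \<subseteq> carrier G" using CA by (auto simp: independent_in_def)
      fix F and n :: "'a \<Rightarrow> int"
      assume F: "finite F \<and> F \<subseteq> \<Union>C \<and> finprod G (\<lambda>x. x [^] n x) F = \<one>"
      show "\<forall>x\<in>F. n x = 0"
      proof (cases "F = {}")
        case False
        then obtain X where X: "X \<in> C" "F \<subseteq> X" using sub F by blast
        then have "independent_in G X" using CA by blast
        then show ?thesis using F X(2) unfolding independent_in_def by blast
      qed simp
    qed
    then show "\<Union>C \<in> ?A" by simp
  qed
  then show ?thesis by blast
qed

text \<open>By maximality of the chosen \<open>X\<close>, each \<open>y\<close> has a power with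
  non-zero exponent whose product with some product over \<open>X\<close> is \<open>\<one>\<close>.
  On the independent set \<open>Y\<close> the data of this relation determine \<open>y\<close>, so
  \<open>|Y|\<close> would be below \<open>\<beta>\<close> if \<open>|X|\<close> were.\<close>

lemma free_rank_ge:
  assumes \<beta>: "Cinfinite \<beta>" and \<alpha>: "Cinfinite \<alpha>" "\<alpha> <o \<beta>" and Y: "independent_in G Y" "\<beta> \<le>o |Y|"
  shows "\<not> free_rank G <o \<beta>"
proof
  assume fr: "free_rank G <o \<beta>"
  define X where "X = (SOME X. independent_in G X \<and> (\<forall>Y. independent_in G Y \<and> X \<subseteq> Y \<longrightarrow> Y = X))"
  have X: "independent_in G X" "\<And>Y. independent_in G Y \<Longrightarrow> X \<subseteq> Y \<Longrightarrow> Y = X"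
    using someI_ex[OF ex_maximal_independent] unfolding X_def by blast+
  have XG: "X \<subseteq> carrier G" and YG: "Y \<subseteq> carrier G" using X(1) Y(1) by (auto simp: independent_in_def)
  have indD: "n x = 0" if "independent_in G Z" "finite F" "F \<subseteq> Z" "finprod G (\<lambda>x. x [^] n x) F = \<one>" "x \<in> F"
    for Z F x and n :: "'a \<Rightarrow> int"
    using that unfolding independent_in_def by blast
  \<comment> \<open>A finite set of pairs of base and exponent encodes a product, so that products
    can be counted by \<open>Fpow\<close>.\<close>
  let ?P = "\<lambda>S. finprod G (\<lambda>q. fst q [^] (snd q :: int)) S"
  have graph: "?P ((\<lambda>x. (x, n x)) ` F) = finprod G (\<lambda>x. x [^] n x) F" if "F \<subseteq> carrier G" for F and n :: "'a \<Rightarrow> int"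
    using that by (subst finprod_reindex) (auto simp: inj_on_def)
  have ex: "\<exists>n S. n \<noteq> 0 \<and> S \<in> Fpow (X \<times> UNIV) \<and> y [^] (n::int) \<otimes> ?P S = \<one>" if y: "y \<in> carrier G" for y
  proof (cases "y \<in> X")
    case True
    have "?P {(y, - 1)} = y [^] (- 1 :: int)" using graph[of "{y}" "\<lambda>_. - 1"] y by simp
    then have "y [^] (1::int) \<otimes> ?P {(y, - 1)} = y [^] (1 + - 1 :: int)" using y by (simp only: int_pow_mult)
    then have "y [^] (1::int) \<otimes> ?P {(y, - 1)} = \<one>" by simp
    moreover have "{(y, - 1)} \<in> Fpow (X \<times> UNIV)" using True by (simp add: Fpow_def)
    ultimately show ?thesis by (metis zero_neq_one)
  next
    case False
    then have dep: "\<not> independent_in G (insert y X)" using X(2)[of "insert y X"] by blast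
    have "\<exists>F (n :: 'a \<Rightarrow> int) x0. finite F \<and> F \<subseteq> insert y X \<and> finprod G (\<lambda>x. x [^] n x) F = \<one> \<and> x0 \<in> F \<and> n x0 \<noteq> 0"
    proof (rule ccontr)
      assume *: "\<not> ?thesis"
      have "independent_in G (insert y X)"
      proof (rule independentI)
        show "insert y X \<subseteq> carrier G" using y XG by blast
        fix F x and n :: "'a \<Rightarrow> int"
        assume "finite F" "F \<subseteq> insert y X" "finprod G (\<lambda>x. x [^] n x) F = \<one>" "x \<in> F"
        then show "n x = 0" using * by meson
      qed
      then show False using dep by blast
    qed
    then obtain F and n :: "'a \<Rightarrow> int" and x0 where F: "finite F" "F \<subseteq> insert y X" "finprod G (\<lambda>x. x [^] n x) F = \<one>"
      and x0: "x0 \<in> F" "n x0 \<noteq> 0"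
      by (elim exE conjE)
    have yF: "y \<in> F"
    proof (rule ccontr)
      assume "y \<notin> F"
      then have "F \<subseteq> X" using F(2) by blast
      then show False using indD[OF X(1) F(1) _ F(3) x0(1)] x0(2) by blast
    qed
    have FG: "F \<subseteq> carrier G" using F(2) y XG by blast
    have FX: "F - {y} \<subseteq> X" using F(2) by blast
    have "finprod G (\<lambda>x. x [^] n x) (insert y (F - {y})) = \<one>" using F(3) yF by (simp add: insert_absorb)
    then have eq: "y [^] n y \<otimes> finprod G (\<lambda>x. x [^] n x) (F - {y}) = \<one>"
      using F(1) FG y by (subst (asm) finprod_insert) auto
    have "n y \<noteq> 0"
    proof
      assume 0: "n y = 0"
      have "finprod G (\<lambda>x. x [^] n x) (F - {y}) \<in> carrier G" using FG by (intro finprod_closed) auto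
      then have "finprod G (\<lambda>x. x [^] n x) (F - {y}) = \<one>" using eq 0 by simp
      moreover have "x0 \<in> F - {y}" using x0 0 by auto
      ultimately show False using indD[OF X(1) _ FX, of n x0] F(1) x0(2) by simp
    qed
    moreover have "(\<lambda>x. (x, n x)) ` (F - {y}) \<in> Fpow (X \<times> UNIV)" using F(1) FX by (auto simp: Fpow_def)
    moreover have "y [^] n y \<otimes> ?P ((\<lambda>x. (x, n x)) ` (F - {y})) = \<one>" using eq FG by (subst graph) auto
    ultimately show ?thesis by blast
  qed
  define good where "good y p \<longleftrightarrow> fst p \<noteq> 0 \<and> snd p \<in> Fpow (X \<times> UNIV) \<and> y [^] (fst p :: int) \<otimes> ?P (snd p) = \<one>" for y p
  have "\<exists>p. good y p" if "y \<in> carrier G" for y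
    using ex[OF that] by (simp add: good_def)
  then have "\<exists>p. y \<in> carrier G \<longrightarrow> good y p" for y by blast
  then obtain p where p: "\<And>y. y \<in> carrier G \<Longrightarrow> good y (p y)" by metis
  define n where "n y = fst (p y)" for y
  define S where "S y = snd (p y)" for y
  have nS: "n y \<noteq> 0" "S y \<in> Fpow (X \<times> UNIV)" "y [^] n y \<otimes> ?P (S y) = \<one>" if "y \<in> carrier G" for y
    using p[OF that] by (simp_all add: good_def n_def S_def)
  have inj: "inj_on (\<lambda>y. (n y, S y)) Y"
  proof (rule inj_onI, rule ccontr)
    fix y z assume yz: "y \<in> Y" "z \<in> Y" "(n y, S y) = (n z, S z)" "y \<noteq> z"
    have c: "y \<in> carrier G" "z \<in> carrier G" using yz YG by auto
    have "S y \<subseteq> X \<times> UNIV" using nS(2)[OF c(1)] by (simp add: Fpow_def)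
    then have P: "?P (S y) \<in> carrier G" using XG by (intro finprod_closed) auto
    have "y [^] n y = inv (?P (S y))" using nS(3)[OF c(1)] c P by (simp add: inv_equality)
    moreover have "z [^] n y = inv (?P (S y))" using nS(3)[OF c(2)] yz(3) c P by (simp add: inv_equality)
    \<comment> \<open>Equal data force equal powers of \<open>y\<close> and \<open>z\<close>, a
      non-trivial relation between two elements of \<open>Y\<close>.\<close>
    ultimately have eq: "y [^] n y = z [^] n y" by simp
    have "y [^] n y \<otimes> inv (z [^] n y) = \<one>" unfolding eq using c by simp
    then have "finprod G (\<lambda>x. x [^] (if x = y then n y else - n y)) {y, z} = \<one>"
      using yz(4) c by (simp add: int_pow_neg)
    then have "(if y = y then n y else - n y) = 0"
      by (rule indD[OF Y(1), rotated 2]) (use yz in auto)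
    then show False using nS(1)[OF c(1)] by simp
  qed
  \<comment> \<open>The summand \<open>Field \<alpha>\<close> makes the bound infinite even for
    finite \<open>X\<close>, and it stays below \<open>\<beta>\<close>.\<close>
  define Z where "Z = X <+> Field \<alpha>"
  have "|X| <o \<beta>" using fr unfolding free_rank_def X_def .
  moreover have "|Field \<alpha>| <o \<beta>" using \<alpha> card_of_Field_ordIso ordIso_ordLess_trans by blast
  ultimately have Z: "|Z| <o \<beta>"
    unfolding Z_def using \<beta> by (intro card_of_Plus_ordLess_infinite_Field) (auto simp: cinfinite_def)
  have "infinite (Field \<alpha>)" using \<alpha>(1) by (simp add: cinfinite_def)
  then have CZ: "Cinfinite |Z|" unfolding Z_def by (simp add: cinfinite_def Field_card_of card_of_Card_order)
  have XZ: "|X| \<le>o |Z|" unfolding Z_def by (rule card_of_Plus1)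
  have "|(UNIV :: int set) \<times> Fpow (X \<times> (UNIV :: int set))| \<le>o |Z|"
    by (intro small_Times[OF CZ] small_Fpow[OF CZ] XZ small_countable[OF CZ] countableI_type)
  then have "|Y| \<le>o |Z|" by (rule small_inj[OF inj, rotated]) (use nS(2) YG in auto)
  then have "|Y| <o \<beta>" using Z ordLeq_ordLess_trans by blast
  then show False using Y(2) not_ordLess_ordLeq by blast
qed

end

subsection \<open>Powers obstruct extremality\<close>

text \<open>There are at most \<open>\<alpha>\<close> rational boxes on finitely many coordinates.
  One point for each box that meets the image of \<open>X\<close> gives a set \<open>Q\<close> with
  dense image, and a compact \<open>C\<close> containing \<open>Q\<close> has closed image, hence
  the same image as \<open>X\<close>.\<close>

lemma alpha_pseudocompact_if_bounded:
  fixes X :: "'x topology"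
  assumes \<alpha>: "Cinfinite \<alpha>"
    and bd: "\<And>A. A \<subseteq> topspace X \<Longrightarrow> |A| \<le>o \<alpha> \<Longrightarrow> \<exists>C. A \<subseteq> C \<and> compactin X C"
  shows "alpha_pseudocompact \<alpha> X"
  unfolding alpha_pseudocompact_def
proof (intro allI impI)
  let ?P = "product_topology (\<lambda>_. euclideanreal) (Field \<alpha>)"
  fix f assume f: "continuous_map X ?P f"
  define box where "box p = {z. \<forall>(i, a, b)\<in>p. real_of_rat a < z i \<and> z i < real_of_rat b}" for p :: "('a \<times> rat \<times> rat) set"
  define q where "q p = (SOME x. x \<in> topspace X \<and> f x \<in> box p)" for p
  define Q where "Q = q ` {p \<in> Fpow (Field \<alpha> \<times> UNIV). \<exists>x. x \<in> topspace X \<and> f x \<in> box p}"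
  have q: "q p \<in> topspace X \<and> f (q p) \<in> box p" if "\<exists>x. x \<in> topspace X \<and> f x \<in> box p" for p
    unfolding q_def using someI_ex[OF that] .
  have QX: "Q \<subseteq> topspace X" unfolding Q_def using q by blast
  have Fa: "|Field \<alpha>| \<le>o \<alpha>" using \<alpha> card_of_Field_ordIso ordIso_imp_ordLeq by blast
  have "|Fpow (Field \<alpha> \<times> (UNIV :: (rat \<times> rat) set))| \<le>o \<alpha>"
    by (intro small_Fpow[OF \<alpha>] small_Times[OF \<alpha>] Fa small_countable[OF \<alpha>] countableI_type)
  then have "|{p \<in> Fpow (Field \<alpha> \<times> (UNIV :: (rat \<times> rat) set)). \<exists>x. x \<in> topspace X \<and> f x \<in> box p}| \<le>o \<alpha>"
    by (rule small_subset[rotated]) blast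
  then have "|Q| \<le>o \<alpha>" unfolding Q_def by (rule small_image)
  then obtain C where C: "Q \<subseteq> C" "compactin X C" using bd QX by blast
  have fC: "compactin ?P (f ` C)" using C(2) f by (rule image_compactin)
  then have closed: "closedin ?P (f ` C)"
    by (intro compactin_imp_closedin) (auto simp: Hausdorff_space_product_topology)
  have "f ` topspace X \<subseteq> ?P closure_of (f ` Q)"
  proof
    fix z assume "z \<in> f ` topspace X"
    then obtain x where x: "x \<in> topspace X" "z = f x" by blast
    have zP: "z \<in> topspace ?P" using x f continuous_map_image_subset_topspace by blast
    show "z \<in> ?P closure_of (f ` Q)"
      unfolding in_closure_of
    proof (intro conjI zP allI impI)
      fix V assume V: "z \<in> V \<and> openin ?P V"
      then obtain U where U: "finite {i \<in> Field \<alpha>. U i \<noteq> topspace euclideanreal}" "\<And>i. i \<in> Field \<alpha> \<Longrightarrow> openin euclideanreal (U i)"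
        "z \<in> PiE (Field \<alpha>) U" "PiE (Field \<alpha>) U \<subseteq> V"
        unfolding openin_product_topology_alt by meson
      define J where "J = {i \<in> Field \<alpha>. U i \<noteq> UNIV}"
      have J: "finite J" using U(1) by (simp add: J_def)
      have "\<exists>a b. real_of_rat a < z i \<and> z i < real_of_rat b \<and> {real_of_rat a<..<real_of_rat b} \<subseteq> U i" if "i \<in> J" for i
      proof -
        have iF: "i \<in> Field \<alpha>" using that by (simp add: J_def)
        have "open (U i)" using U(2)[OF iF] by (rule open_openin[THEN iffD2])
        moreover have "z i \<in> U i" using U(3) iF by (rule PiE_mem)
        ultimately obtain e where e: "e > 0" "ball (z i) e \<subseteq> U i" using open_contains_ball by blast
        obtain a where a: "z i - e < real_of_rat a" "real_of_rat a < z i" using of_rat_dense[of "z i - e" "z i"] e(1) by auto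
        obtain b where b: "z i < real_of_rat b" "real_of_rat b < z i + e" using of_rat_dense[of "z i" "z i + e"] e(1) by auto
        have "{real_of_rat a<..<real_of_rat b} \<subseteq> ball (z i) e" using a b by (auto simp: dist_real_def)
        then show ?thesis using a b e by blast
      qed
      then obtain a b where ab: "\<And>i. i \<in> J \<Longrightarrow> real_of_rat (a i) < z i \<and> z i < real_of_rat (b i) \<and> {real_of_rat (a i)<..<real_of_rat (b i)} \<subseteq> U i"
        by metis
      define p where "p = (\<lambda>i. (i, a i, b i)) ` J"
      have "p \<in> Fpow (Field \<alpha> \<times> UNIV)" using J by (auto simp: p_def Fpow_def J_def)
      moreover have ex: "\<exists>x. x \<in> topspace X \<and> f x \<in> box p"
        using x ab by (intro exI[of _ x]) (auto simp: box_def p_def)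
      ultimately have "q p \<in> Q" unfolding Q_def by blast
      moreover have "f (q p) \<in> V"
      proof -
        have "f (q p) \<in> topspace ?P" using q[OF ex] f continuous_map_image_subset_topspace by blast
        then have ext: "f (q p) \<in> extensional (Field \<alpha>)" by (simp add: PiE_def)
        have "f (q p) i \<in> U i" if i: "i \<in> Field \<alpha>" for i
        proof (cases "i \<in> J")
          case True
          then have "f (q p) i \<in> {real_of_rat (a i)<..<real_of_rat (b i)}" using q[OF ex] by (auto simp: box_def p_def)
          then show ?thesis using ab[OF True] by blast
        next
          case False
          then show ?thesis using i by (simp add: J_def)
        qed
        then show ?thesis using U(4) ext by (auto simp: PiE_def)
      qed
      ultimately show "\<exists>y. y \<in> f ` Q \<and> y \<in> V" by blast
    qed
  qed
  also have "\<dots> \<subseteq> f ` C" using C(1) closed by (intro closure_of_minimal) auto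
  finally have "f ` topspace X = f ` C" using compactin_subset_topspace[OF C(2)] by blast
  then show "compactin ?P (f ` topspace X)" using fC by simp
qed

text \<open>The second component of a bijection from \<open>I\<close> to \<open>I \<times> B\<close>
  has fibres as large as \<open>I\<close>.\<close>

lemma ex_large_fibres:
  assumes \<alpha>: "Cinfinite \<alpha>" "\<alpha> <o |I|" and B: "|B| \<le>o \<alpha>" "B \<noteq> {}"
  shows "\<exists>\<rho>. \<forall>j\<in>B. \<not> |{i \<in> I. \<rho> i = j}| \<le>o \<alpha>"
proof -
  have "infinite I"
  proof
    assume "finite I"
    then have "|I| \<le>o \<alpha>" by (rule small_finite[OF \<alpha>(1)])
    then show False using \<alpha>(2) not_ordLess_ordLeq by blast
  qed
  moreover have "|B| \<le>o |I|" using B(1) ordLess_imp_ordLeq[OF \<alpha>(2)] by (rule ordLeq_transitive)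
  ultimately have "|I \<times> B| =o |I|" using card_of_Times_infinite[of I B] B(2) by blast
  then have "|I| =o |I \<times> B|" by (rule ordIso_symmetric)
  then obtain \<phi> where \<phi>: "bij_betw \<phi> I (I \<times> B)" using card_of_ordIso by blast
  have "\<not> |{i \<in> I. snd (\<phi> i) = j}| \<le>o \<alpha>" if j: "j \<in> B" for j
  proof
    assume small: "|{i \<in> I. snd (\<phi> i) = j}| \<le>o \<alpha>"
    define \<psi> where "\<psi> i = inv_into I \<phi> (i, j)" for i
    have \<psi>: "\<psi> i \<in> I" "\<phi> (\<psi> i) = (i, j)" if "i \<in> I" for i
    proof -
      have "(i, j) \<in> \<phi> ` I" using that j \<phi> by (simp add: bij_betw_def)
      then show "\<psi> i \<in> I" "\<phi> (\<psi> i) = (i, j)" unfolding \<psi>_def by (rule inv_into_into, rule f_inv_into_f)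
    qed
    have "inj_on \<psi> I" by (rule inj_onI) (metis \<psi>(2) fst_conv)
    moreover have "\<psi> ` I \<subseteq> {i \<in> I. snd (\<phi> i) = j}" using \<psi> by auto
    ultimately have "|I| \<le>o \<alpha>" using small by (rule small_inj)
    then show False using \<alpha>(2) not_ordLess_ordLeq by blast
  qed
  then show ?thesis by (intro exI[of _ "\<lambda>i. snd (\<phi> i)"]) blast
qed

lemma (in comm_group) finprod_FactGroup:
  assumes D: "subgroup D G" and x: "\<And>a. a \<in> A \<Longrightarrow> x a \<in> carrier G" and A: "finite A"
  shows "finprod (G Mod D) (\<lambda>a. (D #> x a) [^]\<^bsub>G Mod D\<^esub> (n a :: int)) A = D #> finprod G (\<lambda>a. x a [^] n a) A"
  using A x
proof (induction A rule: finite_induct)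
  interpret D: normal D G using D by (rule subgroup_imp_normal)
  interpret Q: comm_group "G Mod D" using D by (rule abelian_FactGroup)
  {
    case empty
    then show ?case using D subgroup.subset[OF D] by (simp add: coset_mult_one)
  next
    case (insert a A)
    have c: "D #> x b \<in> carrier (G Mod D)" if "b \<in> insert a A" for b
      using insert.prems that by (auto simp: carrier_FactGroup)
    have "finprod (G Mod D) (\<lambda>a. (D #> x a) [^]\<^bsub>G Mod D\<^esub> n a) (insert a A)
        = (D #> x a) [^]\<^bsub>G Mod D\<^esub> n a \<otimes>\<^bsub>G Mod D\<^esub> finprod (G Mod D) (\<lambda>a. (D #> x a) [^]\<^bsub>G Mod D\<^esub> n a) A"
      using insert.hyps c by (intro Q.finprod_insert) (auto intro!: Q.int_pow_closed)
    also have "\<dots> = (D #> x a [^] n a) <#> (D #> finprod G (\<lambda>a. x a [^] n a) A)"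
      using insert by (simp add: D.FactGroup_int_pow)
    also have "\<dots> = D #> (x a [^] n a \<otimes> finprod G (\<lambda>a. x a [^] n a) A)"
      using insert.prems by (intro D.rcos_sum) (auto intro!: finprod_closed)
    also have "x a [^] n a \<otimes> finprod G (\<lambda>a. x a [^] n a) A = finprod G (\<lambda>a. x a [^] n a) (insert a A)"
      using insert by (subst finprod_insert) auto
    finally show ?case .
  }
qed

context compact_abelian_group
begin

theorem power_imp_not_extremal:
  fixes S :: "('s, 'd) monoid_scheme" and I :: "'i set"
  assumes \<alpha>: "Cinfinite \<alpha>" "\<alpha> <o |I|"
    and S: "topological_abelian_group S U" "non_torsion S"
    and h: "cont_hom_onto_power G T S U I h"
  shows "\<not> c_extremal \<alpha> G T"
proof -
  interpret S: comm_group S using S(1) by (simp add: topological_abelian_group_def)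
  have HU: "Hausdorff_space U" and tU: "topspace U = carrier S"
    using S(1) by (auto simp: topological_abelian_group_def tychonoff_space_def)
  let ?P = "product_topology (\<lambda>_. U) I"
  have hh: "h \<in> hom G (product_group I (\<lambda>_. S))" and hc: "continuous_map T ?P h"
    and hs: "h ` carrier G = PiE I (\<lambda>_. carrier S)"
    using h by (auto simp: cont_hom_onto_power_def)
  have hcar: "h x i \<in> carrier S" if "x \<in> carrier G" "i \<in> I" for x i
    using hs that by (auto simp: PiE_iff dest!: equalityD1)
  have hci: "continuous_map T U (\<lambda>x. h x i)" if "i \<in> I" for i
    using hc that by (simp add: continuous_map_componentwise)
  have hom_i: "(\<lambda>x. h x i) \<in> hom G S" if i: "i \<in> I" for i
  proof (rule homI)
    fix x y assume xy: "x \<in> carrier G" "y \<in> carrier G"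
    show "h x i \<in> carrier S" using hcar xy i by blast
    have "h (x \<otimes> y) = (\<lambda>i\<in>I. h x i \<otimes>\<^bsub>S\<^esub> h y i)" using hom_mult[OF hh xy] by simp
    then show "h (x \<otimes> y) i = h x i \<otimes>\<^bsub>S\<^esub> h y i" using i by simp
  qed
  have gh: "group_hom G S (\<lambda>x. h x i)" if "i \<in> I" for i
    using hom_i[OF that] by (simp add: group_hom_def group_hom_axioms_def)
  have hmult: "h (x \<otimes> y) i = h x i \<otimes>\<^bsub>S\<^esub> h y i" if "i \<in> I" "x \<in> carrier G" "y \<in> carrier G" for i x y
    using group_hom.hom_mult[OF gh[OF that(1)]] that by simp
  have hone: "h \<one> i = \<one>\<^bsub>S\<^esub>" if "i \<in> I" for i using group_hom.hom_one[OF gh[OF that]] .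
  have hinv: "h (inv x) i = inv\<^bsub>S\<^esub> (h x i)" if "i \<in> I" "x \<in> carrier G" for i x
    using group_hom.hom_inv[OF gh[OF that(1)] that(2)] .
  have hpow: "h (x [^] n) i = h x i [^]\<^bsub>S\<^esub> n" if "i \<in> I" "x \<in> carrier G" for i x and n :: int
    using group_hom.hom_int_pow[OF gh[OF that(1)] that(2)] .
  have hprod: "h (finprod G f A) i = finprod S (\<lambda>a. h (f a) i) A"
    if i: "i \<in> I" and A: "finite A" and f: "f \<in> A \<rightarrow> carrier G" for i f and A :: "'z set"
    using A f
  proof (induction A rule: finite_induct)
    case (insert a A)
    have c: "f a \<in> carrier G" "finprod G f A \<in> carrier G" using insert.prems by (auto intro!: finprod_closed)
    have "h (finprod G f (insert a A)) i = h (f a \<otimes> finprod G f A) i"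
      using insert by (subst finprod_insert) auto
    also have "\<dots> = h (f a) i \<otimes>\<^bsub>S\<^esub> h (finprod G f A) i" by (rule hmult[OF i c])
    also have "h (finprod G f A) i = finprod S (\<lambda>a. h (f a) i) A" using insert by auto
    also have "h (f a) i \<otimes>\<^bsub>S\<^esub> finprod S (\<lambda>a. h (f a) i) A = finprod S (\<lambda>a. h (f a) i) (insert a A)"
      using insert i hcar by (subst S.finprod_insert) auto
    finally show ?case .
  qed (use i hone in simp)
  define supp where "supp x = {i \<in> I. h x i \<noteq> \<one>\<^bsub>S\<^esub>}" for x
  define D where "D = {x \<in> carrier G. |supp x| \<le>o \<alpha>}"
  have DG: "D \<subseteq> carrier G" by (auto simp: D_def)
  have D: "subgroup D G"
  proof
    fix x y assume xy: "x \<in> D" "y \<in> D"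
    have "supp (x \<otimes> y) \<subseteq> supp x \<union> supp y"
      using xy DG by (auto simp: supp_def hmult subset_iff)
    moreover have "|supp x \<union> supp y| \<le>o \<alpha>" using xy by (intro small_Un[OF \<alpha>(1)]) (auto simp: D_def)
    ultimately have "|supp (x \<otimes> y)| \<le>o \<alpha>" by (rule small_subset)
    then show "x \<otimes> y \<in> D" using xy DG by (auto simp: D_def)
  next
    have "supp \<one> = {}" by (auto simp: supp_def hone)
    then show "\<one> \<in> D" using small_finite[OF \<alpha>(1) finite.emptyI] by (simp add: D_def)
    fix x assume x: "x \<in> D"
    then have "supp (inv x) \<subseteq> supp x" using DG by (auto simp: supp_def hinv)
    then have "|supp (inv x)| \<le>o \<alpha>" using x by (intro small_subset[of "supp (inv x)" "supp x"]) (auto simp: D_def)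
    then show "inv x \<in> D" using x DG by (auto simp: D_def)
  qed (use DG in auto)
  have Dsmall: "|supp x| \<le>o \<alpha>" if "x \<in> D" for x using that unfolding D_def by blast
  have DI: "x \<in> D" if "x \<in> carrier G" "|supp x| \<le>o \<alpha>" for x using that unfolding D_def by blast
  have bounded: "\<exists>C. A \<subseteq> C \<and> compactin (subtopology T D) C" if A: "A \<subseteq> topspace (subtopology T D)" "|A| \<le>o \<alpha>" for A
  proof -
    have AD: "A \<subseteq> D" using A(1) by simp
    define J where "J = (\<Union>x\<in>A. supp x)"
    have "|supp x| \<le>o \<alpha>" if "x \<in> A" for x
      using that AD Dsmall by blast
    then have J: "|J| \<le>o \<alpha>" unfolding J_def by (rule small_UN[OF \<alpha>(1) A(2)])
    \<comment> \<open>The elements with support in \<open>J\<close>: a closed set, by continuity of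
      the coordinates, and part of \<open>D\<close>, because \<open>J\<close> is small.\<close>
    define C where "C = topspace T - (\<Union>i\<in>I - J. {x \<in> topspace T. h x i \<in> topspace U - {\<one>\<^bsub>S\<^esub>}})"
    have oU: "openin U (topspace U - {\<one>\<^bsub>S\<^esub>})"
      using HU by (intro openin_diff openin_topspace closedin_Hausdorff_singleton) (auto simp: tU)
    have "openin T {x \<in> topspace T. h x i \<in> topspace U - {\<one>\<^bsub>S\<^esub>}}" if "i \<in> I" for i
      by (rule openin_continuous_map_preimage[OF hci[OF that] oU])
    then have "openin T (\<Union>i\<in>I - J. {x \<in> topspace T. h x i \<in> topspace U - {\<one>\<^bsub>S\<^esub>}})"
      by (intro openin_Union) blast
    then have "closedin T C" unfolding C_def by (intro closedin_diff) auto
    then have "compactin T C" using compact by (rule closedin_compact_space[rotated])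
    moreover have CD: "C \<subseteq> D"
    proof
      fix x assume x: "x \<in> C"
      then have xG: "x \<in> carrier G" by (simp add: C_def topspace)
      have "supp x \<subseteq> J" using x xG hcar by (auto simp: supp_def C_def topspace tU)
      then show "x \<in> D" using xG small_subset[OF _ J] DI by blast
    qed
    moreover have "A \<subseteq> C" using AD DG by (auto simp: C_def topspace J_def supp_def)
    ultimately show ?thesis by (intro exI[of _ C]) (simp add: compactin_subtopology)
  qed
  have pc: "alpha_pseudocompact \<alpha> (subtopology T D)"
    by (rule alpha_pseudocompact_if_bounded[OF \<alpha>(1) bounded])
  define E where "E = T closure_of D"
  have EG: "E \<subseteq> carrier G" unfolding E_def using closure_of_subset_topspace topspace by metis
  have DE: "D \<subseteq> E" unfolding E_def using DG topspace by (simp add: closure_of_subset)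
  have Ec: "closedin T E" unfolding E_def by simp
  \<comment> \<open>Density of \<open>D\<close> takes two steps. First its closure \<open>E\<close>
    maps onto the whole power: the image is compact and contains all points of finite support, which
    are dense.\<close>
  have hE: "h ` E = PiE I (\<lambda>_. carrier S)"
  proof
    show "h ` E \<subseteq> PiE I (\<lambda>_. carrier S)" using EG hs by blast
    have "compactin T E" using compact Ec by (rule closedin_compact_space)
    then have "compactin ?P (h ` E)" using hc by (rule image_compactin)
    then have cl: "closedin ?P (h ` E)" using HU by (intro compactin_imp_closedin) (auto simp: Hausdorff_space_product_topology)
    show "PiE I (\<lambda>_. carrier S) \<subseteq> h ` E"
    proof
      fix y assume y: "y \<in> PiE I (\<lambda>_. carrier S)"
      have "y \<in> ?P closure_of (h ` D)"
        unfolding in_closure_of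
      proof (intro conjI allI impI)
        show "y \<in> topspace ?P" using y by (simp add: tU)
        fix V assume V: "y \<in> V \<and> openin ?P V"
        then have "\<exists>W. finite {i \<in> I. W i \<noteq> topspace U} \<and> (\<forall>i\<in>I. openin U (W i)) \<and> y \<in> PiE I W \<and> PiE I W \<subseteq> V"
          unfolding openin_product_topology_alt by blast
        then obtain W where W: "finite {i \<in> I. W i \<noteq> topspace U}" "y \<in> PiE I W" "PiE I W \<subseteq> V" by blast
        define y' where "y' = (\<lambda>i\<in>I. if W i \<noteq> topspace U then y i else \<one>\<^bsub>S\<^esub>)"
        have y'V: "y' \<in> PiE I W" using W(2) by (auto simp: y'_def PiE_iff tU)
        have "y' \<in> PiE I (\<lambda>_. carrier S)" using y by (auto simp: y'_def PiE_iff)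
        then obtain x where x: "x \<in> carrier G" "h x = y'" using hs by (metis imageE)
        have "supp x \<subseteq> {i \<in> I. W i \<noteq> topspace U}" unfolding supp_def x(2) by (auto simp: y'_def)
        then have "finite (supp x)" using W(1) finite_subset by blast
        then have "x \<in> D" using DI[OF x(1)] small_finite[OF \<alpha>(1)] by blast
        then show "\<exists>z. z \<in> h ` D \<and> z \<in> V" using x(2) y'V W(3) by blast
      qed
      then show "y \<in> h ` E" using closure_of_minimal[OF image_mono[OF DE] cl] by blast
    qed
  qed
  \<comment> \<open>Now every \<open>x\<close> is \<open>d \<otimes> e\<close> with \<open>e\<close>
    in \<open>E\<close> and \<open>d\<close> in the kernel of \<open>h\<close>, which is part of
    \<open>D\<close>. Translation by \<open>d\<close> maps \<open>D\<close> into \<open>E\<close>,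
    hence also the closure \<open>E\<close> of \<open>D\<close>.\<close>
  have dense: "T closure_of D = topspace T"
  proof -
    have "x \<in> E" if x: "x \<in> carrier G" for x
    proof -
      have "h x \<in> h ` E" unfolding hE using x hs by blast
      then obtain e where e: "e \<in> E" "h x = h e" by blast
      have eG: "e \<in> carrier G" using e(1) EG by blast
      define d where "d = x \<otimes> inv e"
      have dG: "d \<in> carrier G" "d \<otimes> e = x" using x eG by (auto simp: d_def m_assoc)
      have "supp d = {}" using x eG e(2) hcar by (auto simp: supp_def d_def hmult hinv)
      then have dD: "d \<in> D" using DI[OF dG(1)] small_finite[OF \<alpha>(1) finite.emptyI] by simp
      have "closedin T {z \<in> topspace T. d \<otimes> z \<in> E}"
        by (rule closedin_continuous_map_preimage[OF translate_cont[OF dG(1)] Ec])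
      moreover have "D \<subseteq> {z \<in> topspace T. d \<otimes> z \<in> E}" using subgroup.m_closed[OF D dD] DE DG by (auto simp: topspace)
      ultimately have "E \<subseteq> {z \<in> topspace T. d \<otimes> z \<in> E}" unfolding E_def by (rule closure_of_minimal[rotated])
      then show "x \<in> E" using e(1) dG(2) by auto
    qed
    then show ?thesis using EG unfolding E_def topspace by blast
  qed
  obtain s where s: "s \<in> carrier S" "\<And>n::nat. n > 0 \<Longrightarrow> s [^]\<^bsub>S\<^esub> n \<noteq> \<one>\<^bsub>S\<^esub>"
    using S(2) by (auto simp: non_torsion_def)
  have s0: "n = 0" if n: "s [^]\<^bsub>S\<^esub> (n::int) = \<one>\<^bsub>S\<^esub>" for n
  proof (rule ccontr)
    assume "n \<noteq> 0"
    have "s [^]\<^bsub>S\<^esub> nat \<bar>n\<bar> = \<one>\<^bsub>S\<^esub>"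
      using n s(1) S.int_pow_neg[of s n] by (cases "n \<ge> 0") (auto simp: int_pow_int[symmetric])
    then show False using s(2)[of "nat \<bar>n\<bar>"] \<open>n \<noteq> 0\<close> by simp
  qed
  \<comment> \<open>Labels for the coordinates: a finite window and a possible trace of a set on it.
    There are at most \<open>\<alpha>\<close> labels, so each can own more than
    \<open>\<alpha>\<close> coordinates.\<close>
  let ?B = "Fpow (Field \<alpha>) \<times> Fpow (Field \<alpha>)"
  have "|Field \<alpha>| \<le>o \<alpha>" using \<alpha>(1) card_of_Field_ordIso ordIso_imp_ordLeq by blast
  then have B1: "|?B| \<le>o \<alpha>" by (intro small_Times[OF \<alpha>(1)] small_Fpow[OF \<alpha>(1)])
  have B2: "?B \<noteq> {}" by (auto simp: Fpow_def)
  obtain \<rho> where \<rho>: "\<forall>j\<in>?B. \<not> |{i \<in> I. \<rho> i = j}| \<le>o \<alpha>"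
    using ex_large_fibres[OF \<alpha> B1 B2] by (elim exE)
  define y where "y A = (\<lambda>i\<in>I. if A \<inter> fst (\<rho> i) = snd (\<rho> i) then s else \<one>\<^bsub>S\<^esub>)" for A
  have "\<exists>x\<in>carrier G. h x = y A" for A
  proof -
    have "y A \<in> PiE I (\<lambda>_. carrier S)" using s(1) by (auto simp: y_def)
    then show ?thesis using hs by (metis imageE)
  qed
  then obtain x where x: "\<And>A. x A \<in> carrier G" "\<And>A. h (x A) = y A" by metis
  have key: "n A1 = 0"
    if AA: "finite \<A>" "\<A> \<subseteq> Pow (Field \<alpha>)" and prod: "finprod G (\<lambda>A. x A [^] n A) \<A> \<in> D" and A1: "A1 \<in> \<A>"
    for \<A> A1 and n :: "'c set \<Rightarrow> int"
  proof -
    \<comment> \<open>Points distinguishing the other members of the family from \<open>A1\<close>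
      make up a window \<open>F\<close> on which only \<open>A1\<close> has the trace
      \<open>A1 \<inter> F\<close>. At the coordinates with this label the product equals
      \<open>s\<close> to the power \<open>n A1\<close>, and one of them lies outside its small
      support.\<close>
    have "\<exists>d. (d \<in> A \<longleftrightarrow> d \<notin> A1) \<and> d \<in> A \<union> A1" if "A \<in> \<A> - {A1}" for A using that by blast
    then obtain d where d: "\<And>A. A \<in> \<A> - {A1} \<Longrightarrow> (d A \<in> A \<longleftrightarrow> d A \<notin> A1) \<and> d A \<in> A \<union> A1" by metis
    define F where "F = d ` (\<A> - {A1})"
    have F: "finite F" "F \<subseteq> Field \<alpha>" using AA d A1 by (auto simp: F_def)
    have j: "(F, A1 \<inter> F) \<in> ?B" using F by (auto simp: Fpow_def)
    have sepA: "A \<inter> F = A1 \<inter> F \<longleftrightarrow> A = A1" if A: "A \<in> \<A>" for A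
    proof
      assume eq: "A \<inter> F = A1 \<inter> F"
      show "A = A1"
      proof (rule ccontr)
        assume "A \<noteq> A1"
        then have "A \<in> \<A> - {A1}" using A by blast
        then have "d A \<in> F" "d A \<in> A \<longleftrightarrow> d A \<notin> A1" using d by (auto simp: F_def)
        then show False using eq by blast
      qed
    qed simp
    let ?p = "finprod G (\<lambda>A. x A [^] n A) \<A>"
    have "\<not> {i \<in> I. \<rho> i = (F, A1 \<inter> F)} \<subseteq> supp ?p"
    proof
      assume "{i \<in> I. \<rho> i = (F, A1 \<inter> F)} \<subseteq> supp ?p"
      moreover have "|supp ?p| \<le>o \<alpha>" using prod by (rule Dsmall)
      ultimately have "|{i \<in> I. \<rho> i = (F, A1 \<inter> F)}| \<le>o \<alpha>" by (rule small_subset)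
      then show False using bspec[OF \<rho> j] by blast
    qed
    then obtain i where i: "i \<in> I" "\<rho> i = (F, A1 \<inter> F)" "i \<notin> supp ?p" by blast
    have "\<one>\<^bsub>S\<^esub> = h ?p i" using i(1,3) by (simp add: supp_def)
    also have "\<dots> = finprod S (\<lambda>A. h (x A [^] n A) i) \<A>" using x(1) by (intro hprod[OF i(1) AA(1)]) auto
    also have "\<dots> = finprod S (\<lambda>A. if A1 = A then s [^]\<^bsub>S\<^esub> n A else \<one>\<^bsub>S\<^esub>) \<A>"
    proof (rule S.finprod_cong')
      fix A assume A: "A \<in> \<A>"
      have "h (x A) i = (if A1 = A then s else \<one>\<^bsub>S\<^esub>)"
        using i(1,2) sepA[OF A] by (auto simp: x(2) y_def)
      then show "h (x A [^] n A) i = (if A1 = A then s [^]\<^bsub>S\<^esub> n A else \<one>\<^bsub>S\<^esub>)"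
        using hpow[OF i(1) x(1)] by simp
    qed (use s(1) in auto)
    also have "\<dots> = s [^]\<^bsub>S\<^esub> n A1" using A1 AA(1) s(1) by (intro S.finprod_singleton) auto
    finally show ?thesis using s0 by simp
  qed
  interpret Q: comm_group "G Mod D" using D by (rule abelian_FactGroup)
  define q where "q A = D #> x A" for A
  have qprod: "finprod (G Mod D) (\<lambda>A. q A [^]\<^bsub>G Mod D\<^esub> n A) \<A> = D #> finprod G (\<lambda>A. x A [^] n A) \<A>"
    if "finite \<A>" for \<A> and n :: "'c set \<Rightarrow> int"
    unfolding q_def by (rule finprod_FactGroup[OF D x(1) that])
  have qc: "q A \<in> carrier (G Mod D)" for A using x(1) by (auto simp: q_def carrier_FactGroup)
  have qkey: "n A1 = 0"
    if AA: "finite \<A>" "\<A> \<subseteq> Pow (Field \<alpha>)" "A1 \<in> \<A>" and one: "finprod (G Mod D) (\<lambda>A. q A [^]\<^bsub>G Mod D\<^esub> n A) \<A> = \<one>\<^bsub>G Mod D\<^esub>"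
    for \<A> A1 and n :: "'c set \<Rightarrow> int"
  proof (rule key[OF AA(1,2) _ AA(3)])
    have "D #> finprod G (\<lambda>A. x A [^] n A) \<A> = D" using one qprod[OF AA(1)] by simp
    then show "finprod G (\<lambda>A. x A [^] n A) \<A> \<in> D"
      by (rule coset_join1) (use x(1) D in \<open>auto intro!: finprod_closed\<close>)
  qed
  have inj: "inj_on q (Pow (Field \<alpha>))"
  proof (rule inj_onI, rule ccontr)
    fix A B assume AB: "A \<in> Pow (Field \<alpha>)" "B \<in> Pow (Field \<alpha>)" "q A = q B" "A \<noteq> B"
    \<comment> \<open>Equal cosets would give a relation with exponents 1 and -1.\<close>
    have eq: "finprod (G Mod D) (\<lambda>C. q C [^]\<^bsub>G Mod D\<^esub> (if C = A then 1 else - 1 :: int)) {A, B} = \<one>\<^bsub>G Mod D\<^esub>"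
      using AB(3,4) qc[of B] by (simp add: Q.int_pow_neg del: mult_FactGroup one_FactGroup)
    show False using qkey[OF _ _ _ eq, of A] AB by simp
  qed
  have ind: "independent_in (G Mod D) (q ` Pow (Field \<alpha>))"
  proof (rule Q.independentI)
    show "q ` Pow (Field \<alpha>) \<subseteq> carrier (G Mod D)" using qc by blast
    fix F z and n :: "'a set \<Rightarrow> int"
    assume F: "finite F" "F \<subseteq> q ` Pow (Field \<alpha>)" "finprod (G Mod D) (\<lambda>z. z [^]\<^bsub>G Mod D\<^esub> n z) F = \<one>\<^bsub>G Mod D\<^esub>" "z \<in> F"
    obtain \<A> where AA: "\<A> \<subseteq> Pow (Field \<alpha>)" "finite \<A>" "F = q ` \<A>" using finite_subset_image[OF F(1,2)] by blast
    have injA: "inj_on q \<A>" using inj AA(1) by (rule inj_on_subset)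
    have "finprod (G Mod D) (\<lambda>A. q A [^]\<^bsub>G Mod D\<^esub> n (q A)) \<A> = finprod (G Mod D) (\<lambda>z. z [^]\<^bsub>G Mod D\<^esub> n z) F"
      unfolding AA(3) using injA qc by (subst Q.finprod_reindex) (auto intro!: Q.int_pow_closed)
    then have one: "finprod (G Mod D) (\<lambda>A. q A [^]\<^bsub>G Mod D\<^esub> n (q A)) \<A> = \<one>\<^bsub>G Mod D\<^esub>" using F(3) by simp
    obtain A where "A \<in> \<A>" "z = q A" using F(4) AA(3) by blast
    then show "n z = 0" using qkey[OF AA(2,1) _ one] by simp
  qed
  have "ctwo ^c \<alpha> =o |Pow (Field \<alpha>)|"
    unfolding cexp_def ctwo_def Field_card_of using card_of_Pow_Func ordIso_symmetric by blast
  moreover have "|Pow (Field \<alpha>)| \<le>o |q ` Pow (Field \<alpha>)|"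
    using inj card_of_ordLeq[of "Pow (Field \<alpha>)" "q ` Pow (Field \<alpha>)"] by blast
  ultimately have big: "ctwo ^c \<alpha> \<le>o |q ` Pow (Field \<alpha>)|" by (rule ordIso_ordLeq_trans)
  have "Cinfinite (ctwo ^c \<alpha>)" using \<alpha>(1) by (intro Cinfinite_cexp ordLeq_refl Card_order_ctwo)
  moreover have "\<alpha> <o ctwo ^c \<alpha>" using \<alpha>(1) by (intro ordLess_ctwo_cexp) blast
  ultimately have "\<not> free_rank (G Mod D) <o ctwo ^c \<alpha>"
    by (rule Q.free_rank_ge[OF _ \<alpha>(1) _ ind big])
  then show ?thesis unfolding c_extremal_def using D dense pc by blast
qed

end

subsection \<open>Products of groups of roots of unity\<close>

lemma topological_abelian_group_product:
  assumes "\<And>i. i \<in> I \<Longrightarrow> topological_abelian_group (S i) (U i)"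
  shows "topological_abelian_group (product_group I S) (product_topology U I)"
proof -
  have S: "comm_group (S i)" "topspace (U i) = carrier (S i)" "completely_regular_space (U i)" "Hausdorff_space (U i)"
    and mc: "continuous_map (prod_topology (U i) (U i)) (U i) (\<lambda>(x, y). x \<otimes>\<^bsub>S i\<^esub> y)"
    and ic: "continuous_map (U i) (U i) (\<lambda>x. inv\<^bsub>S i\<^esub> x)" if "i \<in> I" for i
    using assms[OF that] by (auto simp: topological_abelian_group_def tychonoff_space_def)
  have grp: "group (S i)" if "i \<in> I" for i using S(1)[OF that] by (simp add: comm_group_def)
  let ?P = "product_topology U I"
  have proj: "continuous_map ?P (U i) (\<lambda>x. x i)" if "i \<in> I" for i
    using that by (rule continuous_map_product_projection)
  have tP: "topspace ?P = carrier (product_group I S)" using S(2) by (auto simp: PiE_iff)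
  have "comm_group (product_group I S)"
  proof (rule group.group_comm_groupI)
    show "group (product_group I S)" using grp by simp
    fix x y assume "x \<in> carrier (product_group I S)" "y \<in> carrier (product_group I S)"
    then show "x \<otimes>\<^bsub>product_group I S\<^esub> y = y \<otimes>\<^bsub>product_group I S\<^esub> x"
      using S(1) by (auto simp: PiE_iff comm_group_def comm_monoid.m_comm intro!: restrict_ext)
  qed
  moreover have "completely_regular_space ?P" using S(3) by (simp add: completely_regular_space_product_topology)
  moreover have "Hausdorff_space ?P" using S(4) by (simp add: Hausdorff_space_product_topology)
  moreover have "continuous_map (prod_topology ?P ?P) ?P (\<lambda>(x, y). x \<otimes>\<^bsub>product_group I S\<^esub> y)"
    unfolding continuous_map_componentwise case_prod_unfold
  proof (intro conjI ballI)
    fix i assume i: "i \<in> I"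
    have 1: "continuous_map (prod_topology ?P ?P) (U i) (\<lambda>p. fst p i)"
      using continuous_map_compose[OF continuous_map_fst proj[OF i]] by (simp add: o_def)
    have 2: "continuous_map (prod_topology ?P ?P) (U i) (\<lambda>p. snd p i)"
      using continuous_map_compose[OF continuous_map_snd proj[OF i]] by (simp add: o_def)
    have "continuous_map (prod_topology ?P ?P) (prod_topology (U i) (U i)) (\<lambda>p. (fst p i, snd p i))"
      using 1 2 by (simp only: continuous_map_paired)
    from continuous_map_compose[OF this mc[OF i]]
    show "continuous_map (prod_topology ?P ?P) (U i) (\<lambda>p. (fst p \<otimes>\<^bsub>product_group I S\<^esub> snd p) i)"
      using i by (simp add: o_def)
  qed auto
  moreover have "continuous_map ?P ?P (\<lambda>x. inv\<^bsub>product_group I S\<^esub> x)"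
  proof (rule continuous_map_eq)
    show "continuous_map ?P ?P (\<lambda>x. \<lambda>i\<in>I. inv\<^bsub>S i\<^esub> x i)"
      unfolding continuous_map_componentwise
    proof (intro conjI ballI)
      fix i assume i: "i \<in> I"
      show "continuous_map ?P (U i) (\<lambda>x. (\<lambda>i\<in>I. inv\<^bsub>S i\<^esub> x i) i)"
        using i continuous_map_compose[OF proj[OF i] ic[OF i]] by (simp add: o_def)
    qed auto
    fix x assume "x \<in> topspace ?P"
    then have "x \<in> (\<Pi>\<^sub>E i\<in>I. carrier (S i))" unfolding tP by simp
    then show "(\<lambda>i\<in>I. inv\<^bsub>S i\<^esub> x i) = inv\<^bsub>product_group I S\<^esub> x" using grp by simp
  qed
  ultimately show ?thesis using tP unfolding topological_abelian_group_def tychonoff_space_def by blast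
qed

definition roots_group :: "nat \<Rightarrow> complex monoid" where
  "roots_group k = \<lparr>carrier = {z. norm z = 1 \<and> z ^ k = 1}, monoid.mult = (*), one = 1\<rparr>"

text \<open>For \<open>k = 0\<close> the condition \<open>z ^ k = 1\<close> is void and the group is the whole circle.\<close>

lemma roots_group_simps [simp]:
  "z \<in> carrier (roots_group k) \<longleftrightarrow> norm z = 1 \<and> z ^ k = 1"
  "x \<otimes>\<^bsub>roots_group k\<^esub> y = x * y" "\<one>\<^bsub>roots_group k\<^esub> = 1"
  by (simp_all add: roots_group_def)

lemma comm_group_roots_group: "comm_group (roots_group k)"
proof (rule comm_groupI)
  fix x assume x: "x \<in> carrier (roots_group k)"
  then have "x \<noteq> 0" by auto
  with x show "\<exists>y\<in>carrier (roots_group k). y \<otimes>\<^bsub>roots_group k\<^esub> x = \<one>\<^bsub>roots_group k\<^esub>"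
    by (intro bexI[of _ "inverse x"]) (auto simp: norm_inverse power_inverse)
qed (auto simp: norm_mult power_mult_distrib)

lemma inv_roots_group: "x \<in> carrier (roots_group k) \<Longrightarrow> inv\<^bsub>roots_group k\<^esub> x = inverse x"
proof -
  interpret comm_group "roots_group k" by (rule comm_group_roots_group)
  assume x: "x \<in> carrier (roots_group k)"
  then have "x \<noteq> 0" by auto
  with x show ?thesis by (intro inv_equality) (auto simp: norm_inverse power_inverse)
qed

lemma topological_abelian_group_roots_group:
  "topological_abelian_group (roots_group k) (top_of_set (carrier (roots_group k)))"
proof -
  let ?C = "carrier (roots_group k)"
  interpret comm_group "roots_group k" by (rule comm_group_roots_group)
  have "continuous_map (prod_topology (top_of_set ?C) (top_of_set ?C)) (top_of_set ?C) (\<lambda>(x, y). x \<otimes>\<^bsub>roots_group k\<^esub> y)"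
  proof -
    have "continuous_on X (\<lambda>p. fst p * snd p)" for X :: "(complex \<times> complex) set" by (intro continuous_intros)
    then show ?thesis
      by (simp add: prod_topology_subtopology subtopology_subtopology case_prod_unfold continuous_map_in_subtopology
          euclidean_product_topology) (auto simp: norm_mult power_mult_distrib)
  qed
  moreover have "continuous_map (top_of_set ?C) (top_of_set ?C) (\<lambda>x. inv\<^bsub>roots_group k\<^esub> x)"
  proof (rule continuous_map_eq)
    have "continuous_on ?C inverse" by (intro continuous_intros) auto
    then show "continuous_map (top_of_set ?C) (top_of_set ?C) inverse"
      by (simp add: continuous_map_in_subtopology) (auto simp: norm_inverse power_inverse)
  qed (simp add: inv_roots_group)
  moreover have "completely_regular_space (top_of_set ?C)" "Hausdorff_space (top_of_set ?C)"
    by (simp_all add: completely_regular_space_subtopology metrizable_imp_completely_regular_space metrizable_space_euclidean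
        Hausdorff_space_subtopology)
  moreover have "topspace (top_of_set ?C) = ?C" by simp
  ultimately show ?thesis
    unfolding topological_abelian_group_def tychonoff_space_def using comm_group_axioms by blast
qed

lemma compact_roots_group: "compact_space (top_of_set (carrier (roots_group k)))"
proof -
  have "carrier (roots_group k) = sphere 0 1 \<inter> (\<lambda>z. z ^ k) -` {1}" by auto
  moreover have "closed ((\<lambda>z::complex. z ^ k) -` {1})" by (intro closed_vimage continuous_intros) 
  ultimately have "compact (carrier (roots_group k))" by (auto intro: compact_Int_closed)
  then show ?thesis by (simp add: compact_space_subtopology)
qed

text \<open>The circle is connected with more than one point, hence uncountable, while the roots of
  unity are countable.\<close>

lemma ex_infinite_order_circle: "\<exists>z::complex. norm z = 1 \<and> (\<forall>n>0. z ^ n \<noteq> 1)"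
proof (rule ccontr)
  assume *: "\<not> ?thesis"
  have "sphere 0 1 \<subseteq> (\<Union>n\<in>{1..}. {z::complex. z ^ n = 1})" using * by (force simp: Suc_le_eq)
  moreover have "countable (\<Union>n\<in>{1..}. {z::complex. z ^ n = 1})"
    by (rule countable_UN, simp, rule countable_finite, rule finite_roots_unity, simp)
  ultimately have "countable (sphere (0::complex) 1)" by (rule countable_subset)
  moreover have "connected (sphere (0::complex) 1)" by (rule connected_sphere) simp
  ultimately show False using connected_uncountable[of "sphere (0::complex) 1" 1 "- 1"] by auto
qed

text \<open>Take the point whose \<open>k\<close>-th component has order exactly \<open>k\<close>,
  infinite for \<open>k = 0\<close>; an exponent \<open>m > 0\<close> that kills it is a multiple of
  all \<open>k\<close> in \<open>K\<close>.\<close>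

lemma non_torsion_roots_product:
  assumes "\<And>m::nat. m > 0 \<Longrightarrow> \<exists>k\<in>K. \<not> k dvd m"
  shows "non_torsion (product_group K roots_group)"
proof -
  have "\<exists>z\<in>carrier (roots_group k). \<forall>m>0. z ^ m = 1 \<longrightarrow> k dvd m" for k
  proof (cases "k = 0")
    case True
    obtain z :: complex where "norm z = 1" "\<forall>n>0. z ^ n \<noteq> 1" using ex_infinite_order_circle by blast
    then show ?thesis using True by (intro bexI[of _ z]) auto
  next
    case False
    let ?z = "\<lambda>j. exp (2 * of_real pi * \<i> * of_nat j / of_nat k)"
    have pow: "?z 1 ^ m = ?z m" for m by (simp add: exp_of_nat_mult[symmetric] algebra_simps)
    have "?z 1 \<in> carrier (roots_group k)"
      using pow[of k] complex_root_unity_eq_1[of k k] False by (simp add: Suc_le_eq norm_exp_eq_Re)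
    moreover have "k dvd m" if "?z 1 ^ m = 1" for m
      using that complex_root_unity_eq_1[of k m] False unfolding pow by (simp add: Suc_le_eq)
    ultimately show ?thesis by blast
  qed
  then obtain z where z: "\<And>k. z k \<in> carrier (roots_group k)" "\<And>k m. m > 0 \<Longrightarrow> z k ^ m = 1 \<Longrightarrow> k dvd m" by metis
  define e where "e = (\<lambda>k\<in>K. z k)"
  have ec: "e \<in> carrier (product_group K roots_group)" using z(1) by (auto simp: e_def simp del: roots_group_simps)
  have pow: "(e [^]\<^bsub>product_group K roots_group\<^esub> m) k = z k ^ m" if k: "k \<in> K" for m :: nat and k
    using k by (induction m) (auto simp: e_def mult.commute)
  have "e [^]\<^bsub>product_group K roots_group\<^esub> m \<noteq> \<one>\<^bsub>product_group K roots_group\<^esub>" if m: "m > 0" for m :: nat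
  proof
    assume eq: "e [^]\<^bsub>product_group K roots_group\<^esub> m = \<one>\<^bsub>product_group K roots_group\<^esub>"
    obtain k where k: "k \<in> K" "\<not> k dvd m" using assms[OF m] by blast
    have "z k ^ m = 1" using pow[OF k(1), of m] eq k(1) by simp
    then show False using z(2)[OF m] k(2) by blast
  qed
  then show ?thesis unfolding non_torsion_def using ec by blast
qed

text \<open>A sequence is coded by the pairs \<open>(n, m)\<close> for which its \<open>n\<close>-th
  term lies in the \<open>m\<close>-th member of a countable base, and sets of naturals correspond
  to reals. This bounds the size of products of groups of roots.\<close>

lemma ex_inj_nat_complex_real: "\<exists>f :: (nat \<Rightarrow> complex) \<Rightarrow> real. inj f"
proof -
  obtain \<B> :: "complex set set" where B: "countable \<B>" "topological_basis \<B>" using ex_countable_basis by blast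
  define c where "c f = {prod_encode (n, m) | n m. f n \<in> from_nat_into \<B> m}" for f :: "nat \<Rightarrow> complex"
  have "inj c"
  proof (rule injI, rule ext, rule ccontr)
    fix f g n assume fg: "c f = c g" "f n \<noteq> g n"
    obtain P where P: "open P" "f n \<in> P" "g n \<notin> P" using t1_space[OF fg(2)] by blast
    obtain Q where Q: "Q \<in> \<B>" "f n \<in> Q" "Q \<subseteq> P" using topological_basisE[OF B(2) P(1,2)] .
    obtain m where m: "Q = from_nat_into \<B> m" using from_nat_into_surj[OF B(1) Q(1)] by metis
    have "prod_encode (n, m) \<in> c f" using Q(2) m by (auto simp: c_def)
    then have "prod_encode (n, m) \<in> c g" using fg(1) by simp
    then have "g n \<in> from_nat_into \<B> m" by (auto simp: c_def)
    then show False using m Q(3) P(3) by blast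
  qed
  moreover obtain r :: "nat set \<Rightarrow> real" where "bij r" using nat_sets_eqpoll_reals unfolding eqpoll_def by blast
  ultimately have "inj (r \<circ> c)" by (intro inj_compose) (auto simp: bij_is_inj)
  then show ?thesis by blast
qed

subsection \<open>Changing the underlying type\<close>

text \<open>Transport of structure along \<open>\<iota>\<close>, with the topology pulled back along
  its inverse \<open>\<kappa>\<close>, because the group in (c) has to live on the type
  \<open>'s\<close>.\<close>

lemma transport_power:
  fixes S0 :: "'z monoid" and \<iota> :: "'z \<Rightarrow> 's"
  assumes S0: "topological_abelian_group S0 U0" "compact_space U0" "metrizable_space U0" "non_torsion S0"
    and \<iota>: "inj_on \<iota> (carrier S0)" and h0: "cont_hom_onto_power K T S0 U0 I h0"
  shows "\<exists>(S :: 's monoid) U h. topological_abelian_group S U \<and> compact_space U \<and> metrizable_space U \<and>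
                 non_torsion S \<and> cont_hom_onto_power K T S U I h"
proof -
  interpret S0: comm_group S0 using S0(1) by (simp add: topological_abelian_group_def)
  have tU0: "topspace U0 = carrier S0" and mc: "continuous_map (prod_topology U0 U0) U0 (\<lambda>(x, y). x \<otimes>\<^bsub>S0\<^esub> y)"
    and ic: "continuous_map U0 U0 (\<lambda>x. inv\<^bsub>S0\<^esub> x)" and ty: "completely_regular_space U0" "Hausdorff_space U0"
    using S0(1) by (auto simp: topological_abelian_group_def tychonoff_space_def)
  define \<kappa> where "\<kappa> = inv_into (carrier S0) \<iota>"
  define C where "C = \<iota> ` carrier S0"
  have \<kappa>\<iota>: "\<kappa> (\<iota> x) = x" if "x \<in> carrier S0" for x unfolding \<kappa>_def using \<iota> that by (rule inv_into_f_f)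
  have \<kappa>C: "\<kappa> y \<in> carrier S0" "\<iota> (\<kappa> y) = y" if "y \<in> C" for y
    using that \<kappa>\<iota> unfolding C_def by auto
  define S :: "'s monoid" where "S = \<lparr>carrier = C, monoid.mult = (\<lambda>a b. \<iota> (\<kappa> a \<otimes>\<^bsub>S0\<^esub> \<kappa> b)), one = \<iota> \<one>\<^bsub>S0\<^esub>\<rparr>"
  have Ssimps: "carrier S = C" "a \<otimes>\<^bsub>S\<^esub> b = \<iota> (\<kappa> a \<otimes>\<^bsub>S0\<^esub> \<kappa> b)" "\<one>\<^bsub>S\<^esub> = \<iota> \<one>\<^bsub>S0\<^esub>" for a b
    by (simp_all add: S_def)
  have \<iota>C: "\<iota> x \<in> C" if "x \<in> carrier S0" for x using that by (simp add: C_def)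
  have cS: "comm_group S"
  proof (rule comm_groupI)
    fix x assume x: "x \<in> carrier S"
    show "\<exists>y\<in>carrier S. y \<otimes>\<^bsub>S\<^esub> x = \<one>\<^bsub>S\<^esub>"
      by (intro bexI[of _ "\<iota> (inv\<^bsub>S0\<^esub> (\<kappa> x))"]) (use x in \<open>auto simp: Ssimps \<kappa>\<iota> \<kappa>C \<iota>C\<close>)
  qed (auto simp: Ssimps \<kappa>\<iota> \<kappa>C \<iota>C S0.m_ac)
  then interpret S: comm_group S .
  define U where "U = pullback_topology C \<kappa> U0"
  have tU: "topspace U = C" unfolding U_def topspace_pullback_topology tU0 using \<kappa>C by auto
  have \<kappa>c: "continuous_map U U0 \<kappa>"
    using continuous_map_pullback[OF continuous_map_id, of C \<kappa> U0] by (simp add: U_def)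
  have \<iota>c: "continuous_map U0 U \<iota>"
    unfolding U_def
  proof (rule continuous_map_pullback')
    show "continuous_map U0 U0 (\<kappa> \<circ> \<iota>)"
      by (rule continuous_map_eq[OF continuous_map_id]) (simp add: tU0 \<kappa>\<iota>)
  qed (auto simp: tU0 \<iota>C)
  have "homeomorphic_maps U0 U \<iota> \<kappa>"
    unfolding homeomorphic_maps_def using \<kappa>c \<iota>c by (auto simp: tU tU0 \<kappa>\<iota> \<kappa>C)
  then have hom: "U0 homeomorphic_space U" unfolding homeomorphic_space_def by blast
  have inv: "inv\<^bsub>S\<^esub> y = \<iota> (inv\<^bsub>S0\<^esub> (\<kappa> y))" if "y \<in> C" for y
    by (rule S.inv_equality) (use that in \<open>auto simp: Ssimps \<kappa>\<iota> \<kappa>C \<iota>C\<close>)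
  have "topological_abelian_group S U"
    unfolding topological_abelian_group_def tychonoff_space_def
  proof (intro conjI cS)
    show "topspace U = carrier S" by (simp add: tU Ssimps)
    show "completely_regular_space U" using ty(1) hom homeomorphic_completely_regular_space by blast
    show "Hausdorff_space U" using ty(2) hom homeomorphic_Hausdorff_space by blast
    have 1: "continuous_map (prod_topology U U) U0 (\<lambda>p. \<kappa> (fst p))"
      using continuous_map_compose[OF continuous_map_fst \<kappa>c] by (simp add: o_def)
    have 2: "continuous_map (prod_topology U U) U0 (\<lambda>p. \<kappa> (snd p))"
      using continuous_map_compose[OF continuous_map_snd \<kappa>c] by (simp add: o_def)
    have 3: "continuous_map (prod_topology U U) (prod_topology U0 U0) (\<lambda>p. (\<kappa> (fst p), \<kappa> (snd p)))"
      using 1 2 by (simp only: continuous_map_paired)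
    show "continuous_map (prod_topology U U) U (\<lambda>(x, y). x \<otimes>\<^bsub>S\<^esub> y)"
      using continuous_map_compose[OF continuous_map_compose[OF 3 mc] \<iota>c]
      by (simp add: o_def Ssimps case_prod_unfold)
    show "continuous_map U U (\<lambda>x. inv\<^bsub>S\<^esub> x)"
    proof (rule continuous_map_eq)
      show "continuous_map U U (\<lambda>x. \<iota> (inv\<^bsub>S0\<^esub> (\<kappa> x)))"
        using continuous_map_compose[OF continuous_map_compose[OF \<kappa>c ic] \<iota>c] by (simp add: o_def)
    qed (simp add: tU inv)
  qed
  moreover have "compact_space U" using S0(2) hom homeomorphic_compact_space by blast
  moreover have "metrizable_space U" using S0(3) hom homeomorphic_metrizable_space by blast
  moreover have "non_torsion S"
  proof -
    obtain e where e: "e \<in> carrier S0" "\<And>n::nat. n > 0 \<Longrightarrow> e [^]\<^bsub>S0\<^esub> n \<noteq> \<one>\<^bsub>S0\<^esub>"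
      using S0(4) by (auto simp: non_torsion_def)
    have pow: "\<iota> e [^]\<^bsub>S\<^esub> n = \<iota> (e [^]\<^bsub>S0\<^esub> n)" for n :: nat
      by (induction n) (simp_all add: Ssimps \<kappa>\<iota> e(1))
    have "\<iota> e [^]\<^bsub>S\<^esub> n \<noteq> \<one>\<^bsub>S\<^esub>" if "n > 0" for n :: nat
    proof
      assume "\<iota> e [^]\<^bsub>S\<^esub> n = \<one>\<^bsub>S\<^esub>"
      then have "e [^]\<^bsub>S0\<^esub> n = \<one>\<^bsub>S0\<^esub>" using \<iota> e(1) unfolding pow Ssimps by (auto dest: inj_onD)
      then show False using e(2)[OF that] by blast
    qed
    then show ?thesis unfolding non_torsion_def using \<iota>C[OF e(1)] by (auto simp: Ssimps)
  qed
  moreover have "cont_hom_onto_power K T S U I (\<lambda>x. \<lambda>i\<in>I. \<iota> (h0 x i))"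
  proof -
    have hh: "h0 \<in> hom K (product_group I (\<lambda>_. S0))" and hc: "continuous_map T (product_topology (\<lambda>_. U0) I) h0"
      and hs: "h0 ` carrier K = PiE I (\<lambda>_. carrier S0)"
      using h0 by (auto simp: cont_hom_onto_power_def)
    have hcar: "h0 x \<in> PiE I (\<lambda>_. carrier S0)" if "x \<in> carrier K" for x using hs that by blast
    show ?thesis
      unfolding cont_hom_onto_power_def
    proof (intro conjI)
      show "(\<lambda>x. \<lambda>i\<in>I. \<iota> (h0 x i)) \<in> hom K (product_group I (\<lambda>_. S))"
      proof (rule homI)
        fix x assume x: "x \<in> carrier K"
        show "(\<lambda>i\<in>I. \<iota> (h0 x i)) \<in> carrier (product_group I (\<lambda>_. S))"
          using hcar[OF x] by (auto simp: Ssimps \<iota>C PiE_iff)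
        fix y assume y: "y \<in> carrier K"
        have eq: "h0 (x \<otimes>\<^bsub>K\<^esub> y) = (\<lambda>i\<in>I. h0 x i \<otimes>\<^bsub>S0\<^esub> h0 y i)" using hom_mult[OF hh x y] by simp
        show "(\<lambda>i\<in>I. \<iota> (h0 (x \<otimes>\<^bsub>K\<^esub> y) i)) = (\<lambda>i\<in>I. \<iota> (h0 x i)) \<otimes>\<^bsub>product_group I (\<lambda>_. S)\<^esub> (\<lambda>i\<in>I. \<iota> (h0 y i))"
          unfolding eq using hcar[OF x] hcar[OF y] by (auto simp: Ssimps \<kappa>\<iota> PiE_iff intro!: restrict_ext)
      qed
      show "continuous_map T (product_topology (\<lambda>_. U) I) (\<lambda>x. \<lambda>i\<in>I. \<iota> (h0 x i))"
        unfolding continuous_map_componentwise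
      proof (intro conjI ballI)
        fix i assume i: "i \<in> I"
        have "continuous_map T U0 (\<lambda>x. h0 x i)" using hc i by (simp add: continuous_map_componentwise)
        from continuous_map_compose[OF this \<iota>c]
        show "continuous_map T U (\<lambda>x. (\<lambda>i\<in>I. \<iota> (h0 x i)) i)" using i by (simp add: o_def)
      qed auto
      show "(\<lambda>x. \<lambda>i\<in>I. \<iota> (h0 x i)) ` carrier K = carrier (product_group I (\<lambda>_. S))"
      proof
        show "(\<lambda>x. \<lambda>i\<in>I. \<iota> (h0 x i)) ` carrier K \<subseteq> carrier (product_group I (\<lambda>_. S))"
          using hcar by (auto simp: Ssimps \<iota>C PiE_iff)
        show "carrier (product_group I (\<lambda>_. S)) \<subseteq> (\<lambda>x. \<lambda>i\<in>I. \<iota> (h0 x i)) ` carrier K"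
        proof
          fix y assume "y \<in> carrier (product_group I (\<lambda>_. S))"
          then have y: "y \<in> PiE I (\<lambda>_. C)" by (simp add: Ssimps)
          define y0 where "y0 = (\<lambda>i\<in>I. \<kappa> (y i))"
          have "y0 \<in> PiE I (\<lambda>_. carrier S0)" using y \<kappa>C by (auto simp: y0_def PiE_iff)
          then obtain x where x: "x \<in> carrier K" "h0 x = y0" using hs by (metis imageE)
          have "(\<lambda>i\<in>I. \<iota> (h0 x i)) = y"
            unfolding x(2) using y by (auto simp: y0_def \<kappa>C PiE_iff extensional_def fun_eq_iff)
          then show "y \<in> (\<lambda>x. \<lambda>i\<in>I. \<iota> (h0 x i)) ` carrier K" using x(1) by blast
        qed
      qed
    qed
  qed
  ultimately show ?thesis by blast
qed

subsection \<open>Non-singular groups map onto large powers\<close>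

context compact_abelian_group
begin

text \<open>A character takes at \<open>x^m\<close> the value of its \<open>m\<close>-th power at
  \<open>x\<close>, so its restriction to \<open>mK\<close> is determined by that power. With at
  most \<open>\<alpha>\<close> such powers, as many characters would separate the points of
  \<open>mK\<close> and bound its weight.\<close>

lemma dual_powers_large:
  assumes \<alpha>: "Cinfinite \<alpha>" and sing: "\<not> alpha_singular \<alpha> G T" and m: "m > 0"
  shows "\<not> |(\<lambda>ch. ch [^]\<^bsub>dual\<^esub> (m::nat)) ` carrier dual| \<le>o \<alpha>"
proof
  let ?A = "(\<lambda>ch. ch [^]\<^bsub>dual\<^esub> m) ` carrier dual"
  assume A: "|?A| \<le>o \<alpha>"
  let ?Y = "(\<lambda>x. x [^] m) ` carrier G"
  let ?X = "subtopology T ?Y"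
  have tX: "topspace ?X = ?Y" by (auto simp: topspace)
  have "compactin T (carrier G)" using compact by (simp add: compact_space_def topspace)
  then have "compactin T ?Y" using nat_pow_cont by (rule image_compactin)
  then have cX: "compact_space ?X" by (rule compact_space_subtopology)
  \<comment> \<open>One \<open>m\<close>-th root for each element of \<open>?A\<close>; all roots of
    the same element agree on \<open>mK\<close>.\<close>
  define g where "g xi = (SOME ch. ch \<in> carrier dual \<and> ch [^]\<^bsub>dual\<^esub> m = xi)" for xi
  have g: "g xi \<in> carrier dual \<and> g xi [^]\<^bsub>dual\<^esub> m = xi" if "xi \<in> ?A" for xi
  proof -
    have "\<exists>ch. ch \<in> carrier dual \<and> ch [^]\<^bsub>dual\<^esub> m = xi" using that by blast
    then show ?thesis unfolding g_def by (rule someI_ex)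
  qed
  have "weight ?X \<le>o \<alpha>"
  proof (rule weight_le_of_separating_functions[OF \<alpha> cX A])
    fix xi assume "xi \<in> ?A"
    then have "cfun (g xi)" using g by (simp add: dual_carrier)
    then show "continuous_map ?X euclidean (g xi)" by (rule continuous_map_from_subtopology)
  next
    fix y y' assume y: "y \<in> topspace ?X" "y' \<in> topspace ?X" "y \<noteq> y'"
    then obtain x x' where x: "x \<in> carrier G" "y = x [^] m" "x' \<in> carrier G" "y' = x' [^] m" unfolding tX by blast
    then obtain ch where ch: "ch \<in> carrier dual" "ch y \<noteq> ch y'" using dual_separates[of y y'] y(3) by auto
    let ?xi = "ch [^]\<^bsub>dual\<^esub> m"
    have xi: "?xi \<in> ?A" using ch(1) by blast
    have eq: "g ?xi (z [^] m) = ch (z [^] m)" if z: "z \<in> carrier G" for z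
    proof -
      have "g ?xi (z [^] m) = (g ?xi [^]\<^bsub>dual\<^esub> m) z"
        unfolding dual_nat_pow[OF z] using g[OF xi] z by (intro dual_pow) blast+
      also have "g ?xi [^]\<^bsub>dual\<^esub> m = ?xi" using g[OF xi] by blast
      also have "?xi z = ch (z [^] m)" using z ch(1) by (simp add: dual_pow dual_nat_pow)
      finally show ?thesis .
    qed
    have "g ?xi y \<noteq> g ?xi y'" using ch(2) x eq by simp
    then show "\<exists>i\<in>?A. g i y \<noteq> g i y'" using xi by blast
  qed
  then have "alpha_singular \<alpha> G T" unfolding alpha_singular_def using top_ab m by blast
  then show False using sing by blast
qed

text \<open>Kronecker's theorem approximates finitely many values at a time. The sets of approximate
  solutions are closed, and by compactness they have a common point, an exact solution.\<close>

lemma simultaneous_values: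
  fixes ch :: "'w \<Rightarrow> 'a \<Rightarrow> complex" and k :: "'w \<Rightarrow> nat"
  assumes ch: "\<And>w. w \<in> W \<Longrightarrow> ch w \<in> carrier dual"
    and indep: "\<And>F (n :: 'w \<Rightarrow> int). finite F \<Longrightarrow> F \<subseteq> W \<Longrightarrow> finprod dual (\<lambda>w. ch w [^]\<^bsub>dual\<^esub> n w) F = \<one>\<^bsub>dual\<^esub> \<Longrightarrow> \<forall>w\<in>F. int (k w) dvd n w"
    and t: "\<And>w. w \<in> W \<Longrightarrow> t w \<in> carrier (roots_group (k w))"
  shows "\<exists>x\<in>carrier G. \<forall>w\<in>W. ch w x = t w"
proof -
  obtain M where "mean G M" using ex_mean by blast
  then interpret compact_mean G T M
    by (simp add: compact_mean_def compact_abelian_group_axioms)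
  have finite_approx: "\<exists>x\<in>carrier G. \<forall>w\<in>F. norm (ch w x - t w) < \<epsilon>"
    if F: "finite F" "F \<subseteq> W" and e: "\<epsilon> > 0" for F \<epsilon>
  proof -
    have F': "\<And>w. w \<in> F \<Longrightarrow> ch w \<in> carrier dual" using F(2) ch by blast
    have ind: "\<forall>w\<in>F. int (k w) dvd n w"
      if one: "\<And>x. x \<in> carrier G \<Longrightarrow> (\<Prod>w\<in>F. ch w x powi n w) = 1" for n :: "'w \<Rightarrow> int"
    proof (rule indep[OF F])
      have cl: "(\<lambda>w. ch w [^]\<^bsub>dual\<^esub> n w) \<in> F \<rightarrow> carrier dual" using F' by auto
      show "finprod dual (\<lambda>w. ch w [^]\<^bsub>dual\<^esub> n w) F = \<one>\<^bsub>dual\<^esub>"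
      proof (rule dual_ext)
        fix x assume x: "x \<in> carrier G"
        have "finprod dual (\<lambda>w. ch w [^]\<^bsub>dual\<^esub> n w) F x = (\<Prod>w\<in>F. ch w x powi n w)"
          unfolding dual_finprod[OF F(1) cl x] using F' x by (intro prod.cong) (auto simp: dual_int_pow)
        then show "finprod dual (\<lambda>w. ch w [^]\<^bsub>dual\<^esub> n w) F x = \<one>\<^bsub>dual\<^esub> x"
          using one[OF x] dual_one[OF x] by simp
      qed (use cl in auto)
    qed
    show ?thesis
    proof (rule kronecker[OF F(1) _ _ ind _ _ e])
      fix w assume w: "w \<in> F"
      show "norm (ch w x) = 1" if "x \<in> carrier G" for x using F'[OF w] that by (simp add: dual_carrier)
      show "ch w (x \<otimes> y) = ch w x * ch w y" if "x \<in> carrier G" "y \<in> carrier G" for x y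
        using F'[OF w] that by (simp add: dual_carrier)
      show "norm (t w) = 1" "t w ^ k w = 1" using t[of w] w F(2) by auto
    qed blast+
  qed
  define C where "C p = {x \<in> topspace T. ch (fst p) x \<in> cball (t (fst p)) (1 / real (Suc (snd p)))}" for p
  \<comment> \<open>Adding the whole space keeps the intersection inside the carrier even when
    \<open>W\<close> is empty.\<close>
  let ?\<U> = "insert (topspace T) (C ` (W \<times> UNIV))"
  have closed: "closedin T (C p)" if "p \<in> W \<times> UNIV" for p
  proof -
    have "cfun (ch (fst p))" using ch[of "fst p"] that by (auto simp: dual_carrier)
    then show ?thesis unfolding C_def
      by (rule closedin_continuous_map_preimage) (simp add: closed_closedin[symmetric])
  qed
  have fip: "\<Inter>\<F> \<noteq> {}" if \<F>: "finite \<F>" "\<F> \<subseteq> ?\<U>" for \<F>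
  proof -
    have "finite (\<F> - {topspace T})" "\<F> - {topspace T} \<subseteq> C ` (W \<times> UNIV)" using \<F> by auto
    then obtain P where P: "finite P" "P \<subseteq> W \<times> UNIV" "\<F> - {topspace T} = C ` P"
      using finite_subset_image by metis
    define N where "N = Max (insert 0 (snd ` P))"
    have N: "snd p \<le> N" if "p \<in> P" for p unfolding N_def using P(1) that by (intro Max_ge) auto
    have "finite (fst ` P)" "fst ` P \<subseteq> W" using P(1,2) by auto
    then obtain x where x: "x \<in> carrier G" "\<And>w. w \<in> fst ` P \<Longrightarrow> norm (ch w x - t w) < 1 / real (Suc N)"
      using finite_approx[of "fst ` P" "1 / real (Suc N)"] by (auto simp del: of_nat_Suc)
    have xC: "x \<in> C p" if p: "p \<in> P" for p
    proof -
      have "norm (ch (fst p) x - t (fst p)) < 1 / real (Suc N)" using x(2) p by blast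
      also have "\<dots> \<le> 1 / real (Suc (snd p))" using N[OF p] by (intro divide_left_mono) auto
      finally show ?thesis using x(1) by (simp add: C_def topspace dist_norm norm_minus_commute)
    qed
    have "x \<in> B" if B: "B \<in> \<F>" for B
    proof (cases "B = topspace T")
      case True
      then show ?thesis using x(1) by (simp add: topspace)
    next
      case False
      then have "B \<in> C ` P" using B P(3) by blast
      then show ?thesis using xC by blast
    qed
    then show ?thesis by blast
  qed
  have "\<forall>B\<in>?\<U>. closedin T B" using closed by auto
  then have "\<Inter>?\<U> \<noteq> {}" using fip compact unfolding compact_space_fip by meson
  then obtain x where x: "x \<in> \<Inter>?\<U>" by blast
  have xG: "x \<in> carrier G" using InterD[OF x insertI1] unfolding topspace .
  have "ch w x = t w" if w: "w \<in> W" for w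
  proof -
    have le: "norm (ch w x - t w) \<le> inverse (real (Suc n))" for n
    proof -
      have "C (w, n) \<in> ?\<U>" using w by (intro insertI2 imageI) simp
      then have "x \<in> C (w, n)" by (rule InterD[OF x])
      then show ?thesis by (simp add: C_def dist_norm norm_minus_commute inverse_eq_divide)
    qed
    have "norm (ch w x - t w) \<le> 0"
      by (rule LIMSEQ_le_const[OF LIMSEQ_inverse_real_of_nat]) (use le in blast)
    then show ?thesis by simp
  qed
  then show ?thesis using xG by blast
qed

theorem not_singular_imp_power:
  fixes \<alpha> :: "'c rel"
  assumes \<alpha>: "Cinfinite \<alpha>" and sing: "\<not> alpha_singular \<alpha> G T"
    and large_s: "|UNIV :: real set| \<le>o |UNIV :: 's set|"
    and large_i: "\<alpha> <o |UNIV :: 'i set|"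
  shows "\<exists>(S :: 's monoid) U (I :: 'i set) h.
                 topological_abelian_group S U \<and> compact_space U \<and> metrizable_space U \<and>
                 non_torsion S \<and> \<alpha> <o |I| \<and> cont_hom_onto_power G T S U I h"
proof -
  let ?\<kappa> = "cardSuc \<alpha>"
  have C\<alpha>: "Card_order \<alpha>" using \<alpha> by blast
  have \<kappa>: "Cinfinite ?\<kappa>" using \<alpha> by (rule Cinfinite_cardSuc)
  have "?\<kappa> \<le>o |UNIV :: 'i set|" using cardSuc_least[OF C\<alpha> card_of_Card_order large_i] .
  then have "|Field ?\<kappa>| \<le>o |UNIV :: 'i set|" using \<kappa> card_of_Field_ordIso ordIso_ordLeq_trans by blast
  then obtain f :: "'c set \<Rightarrow> 'i" where f: "inj_on f (Field ?\<kappa>)" unfolding card_of_ordLeq[symmetric] by blast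
  \<comment> \<open>\<open>I\<close> has the cardinality of the successor of
    \<open>\<alpha>\<close>, the largest that \<open>ex_independent_family\<close> allows.\<close>
  define I where "I = f ` Field ?\<kappa>"
  have "|Field ?\<kappa>| =o |I|" unfolding I_def using f card_of_ordIsoI inj_on_imp_bij_betw by blast
  then have I: "?\<kappa> =o |I|" using \<kappa> card_of_Field_ordIso ordIso_symmetric ordIso_transitive by blast
  have \<alpha>I: "\<alpha> <o |I|" using cardSuc_greater[OF C\<alpha>] I by (rule ordLess_ordIso_trans)
  define K where "K = {k. dual.ample \<alpha> k}"
  have Kdvd: "\<exists>k\<in>K. \<not> k dvd m" if "m > 0" for m
    using dual.ex_ample[OF \<alpha> that dual_powers_large[OF \<alpha> sing that]] by (auto simp: K_def)
  have "|I| \<le>o ?\<kappa>" using I ordIso_symmetric ordIso_imp_ordLeq by blast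
  then have W: "|K \<times> I| \<le>o ?\<kappa>" by (rule small_Times[OF \<kappa> small_countable[OF \<kappa> countableI_type]])
  have amp: "dual.ample \<alpha> (fst w)" if "w \<in> K \<times> I" for w using that by (auto simp: K_def)
  obtain ch where ord: "\<And>w. w \<in> K \<times> I \<Longrightarrow> dual.has_order (ch w) (fst w)"
    and indep: "\<And>F (n :: nat \<times> 'i \<Rightarrow> int). finite F \<Longrightarrow> F \<subseteq> K \<times> I \<Longrightarrow>
       finprod dual (\<lambda>w. ch w [^]\<^bsub>dual\<^esub> n w) F = \<one>\<^bsub>dual\<^esub> \<Longrightarrow> \<forall>w\<in>F. int (fst w) dvd n w"
  proof (rule dual.ex_independent_family[OF \<alpha> W amp])
    fix x
    assume "\<And>w. w \<in> K \<times> I \<Longrightarrow> dual.has_order (x w) (fst w)"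
      and "\<And>F (n :: nat \<times> 'i \<Rightarrow> int). finite F \<Longrightarrow> F \<subseteq> K \<times> I \<Longrightarrow>
       finprod dual (\<lambda>w. x w [^]\<^bsub>dual\<^esub> n w) F = \<one>\<^bsub>dual\<^esub> \<Longrightarrow> \<forall>w\<in>F. int (fst w) dvd n w"
    then show thesis by (rule that)
  qed
  have chd: "ch w \<in> carrier dual" if "w \<in> K \<times> I" for w using ord[OF that] by (simp add: dual.has_order_def)
  have chr: "ch w x \<in> carrier (roots_group (fst w))" if w: "w \<in> K \<times> I" and x: "x \<in> carrier G" for w x
  proof -
    have "ch w [^]\<^bsub>dual\<^esub> int (fst w) = \<one>\<^bsub>dual\<^esub>" using ord[OF w] by (simp add: dual.has_order_def)
    then have "ch w x powi int (fst w) = 1" using dual_int_pow[OF chd[OF w] x] dual_one[OF x] by metis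
    then show ?thesis using chd[OF w] x by (simp add: dual_carrier)
  qed
  define S0 where "S0 = product_group K roots_group"
  define U0 where "U0 = product_topology (\<lambda>k. top_of_set (carrier (roots_group k))) K"
  \<comment> \<open>There is one character of order \<open>k\<close> for each ample \<open>k\<close>
    and each \<open>i\<close>; those with the same \<open>i\<close> make up the coordinate of
    \<open>h0\<close> at \<open>i\<close>.\<close>
  define h0 where "h0 x = (\<lambda>i\<in>I. \<lambda>k\<in>K. ch (k, i) x)" for x
  have S0: "topological_abelian_group S0 U0"
    unfolding S0_def U0_def by (rule topological_abelian_group_product) (rule topological_abelian_group_roots_group)
  have cU0: "compact_space U0" unfolding U0_def by (simp add: compact_space_product_topology compact_roots_group)
  \<comment> \<open>\<open>K\<close> is a set of naturals, so this is a countable product of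
    metrizable spaces.\<close>
  have mU0: "metrizable_space U0"
    unfolding U0_def by (simp add: metrizable_space_product_topology metrizable_space_subtopology metrizable_space_euclidean)
  have nt: "non_torsion S0" unfolding S0_def by (rule non_torsion_roots_product[OF Kdvd])
  have carS0: "carrier S0 = (\<Pi>\<^sub>E k\<in>K. carrier (roots_group k))" by (simp add: S0_def)
  have h0: "cont_hom_onto_power G T S0 U0 I h0"
    unfolding cont_hom_onto_power_def
  proof (intro conjI)
    have h0c: "h0 x \<in> (\<Pi>\<^sub>E i\<in>I. carrier S0)" if x: "x \<in> carrier G" for x
      unfolding h0_def carS0 using chr[OF _ x] by (auto simp del: roots_group_simps)
    show "h0 \<in> hom G (product_group I (\<lambda>_. S0))"
    proof (rule homI)
      fix x y assume xy: "x \<in> carrier G" "y \<in> carrier G"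
      show "h0 x \<in> carrier (product_group I (\<lambda>_. S0))" using h0c[OF xy(1)] by simp
      have "ch w (x \<otimes> y) = ch w x * ch w y" if "w \<in> K \<times> I" for w using chd[OF that] xy by (simp add: dual_carrier)
      then show "h0 (x \<otimes> y) = h0 x \<otimes>\<^bsub>product_group I (\<lambda>_. S0)\<^esub> h0 y"
        by (auto simp: h0_def S0_def intro!: restrict_ext)
    qed
    show "continuous_map T (product_topology (\<lambda>_. U0) I) h0"
      unfolding U0_def continuous_map_componentwise
    proof (intro conjI ballI)
      fix i k assume ik: "i \<in> I" "k \<in> K"
      have "cfun (ch (k, i))" using chd[of "(k, i)"] ik by (simp add: dual_carrier)
      moreover have "ch (k, i) ` topspace T \<subseteq> carrier (roots_group k)"
        using chr[of "(k, i)"] ik by (auto simp: topspace simp del: roots_group_simps)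
      ultimately have "continuous_map T (top_of_set (carrier (roots_group k))) (ch (k, i))"
        by (auto simp: continuous_map_in_subtopology simp del: roots_group_simps)
      then show "continuous_map T (top_of_set (carrier (roots_group k))) (\<lambda>x. h0 x i k)"
        using ik by (simp add: h0_def)
    qed (auto simp: h0_def)
    show "h0 ` carrier G = carrier (product_group I (\<lambda>_. S0))"
    proof
      show "h0 ` carrier G \<subseteq> carrier (product_group I (\<lambda>_. S0))" using h0c by auto
      show "carrier (product_group I (\<lambda>_. S0)) \<subseteq> h0 ` carrier G"
      proof
        fix y assume "y \<in> carrier (product_group I (\<lambda>_. S0))"
        then have y: "y \<in> (\<Pi>\<^sub>E i\<in>I. \<Pi>\<^sub>E k\<in>K. carrier (roots_group k))" by (simp add: carS0)
        \<comment> \<open>A point of the power prescribes a value for every character, and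
          independence lets a single \<open>x\<close> attain them all.\<close>
        define t where "t w = y (snd w) (fst w)" for w
        have t: "t w \<in> carrier (roots_group (fst w))" if "w \<in> K \<times> I" for w
          unfolding t_def using that by (intro PiE_mem[OF PiE_mem[OF y]]) auto
        have "\<exists>x\<in>carrier G. \<forall>w\<in>K \<times> I. ch w x = t w"
          by (rule simultaneous_values[where k = fst]) (erule chd, erule (2) indep, erule t)
        then obtain x where x: "x \<in> carrier G" "\<forall>w\<in>K \<times> I. ch w x = t w" by blast
        have "h0 x = y"
        proof (rule PiE_ext[OF h0c[OF x(1)] y[folded carS0]])
          fix i assume i: "i \<in> I"
          have "h0 x i \<in> (\<Pi>\<^sub>E k\<in>K. carrier (roots_group k))" using PiE_mem[OF h0c[OF x(1)] i] by (simp add: carS0)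
          moreover have "y i \<in> (\<Pi>\<^sub>E k\<in>K. carrier (roots_group k))" by (rule PiE_mem[OF y i])
          moreover have "h0 x i k = y i k" if "k \<in> K" for k using bspec[OF x(2), of "(k, i)"] i that by (simp add: h0_def t_def)
          ultimately show "h0 x i = y i" by (rule PiE_ext)
        qed
        then show "y \<in> h0 ` carrier G" using x(1) by blast
      qed
    qed
  qed
  \<comment> \<open>The elements of \<open>S0\<close> are functions from naturals to complex
    numbers, which inject into the reals and so, by \<open>large_s\<close>, into
    \<open>'s\<close>.\<close>
  obtain r :: "(nat \<Rightarrow> complex) \<Rightarrow> real" where "inj r" using ex_inj_nat_complex_real by blast
  moreover obtain \<sigma> :: "real \<Rightarrow> 's" where "inj \<sigma>" using large_s unfolding card_of_ordLeq[symmetric] by blast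
  ultimately have "inj (\<sigma> \<circ> r)" by (intro inj_compose)
  then have "inj_on (\<sigma> \<circ> r) (carrier S0)" by (rule inj_on_subset) simp
  from transport_power[OF S0 cU0 mU0 nt this h0]
  obtain S :: "'s monoid" and U h where "topological_abelian_group S U \<and> compact_space U \<and> metrizable_space U \<and>
      non_torsion S \<and> cont_hom_onto_power G T S U I h" by blast
  then show ?thesis using \<alpha>I by blast
qed

end

(* HOL cannot quantify over types inside a formula, so in (c) the group S and the index set I
   range over sets of elements of types 's and 'i, which are arbitrary apart from being
   large enough: every compact metrizable space has at most continuum many points, and 'i
   must have room for some index set of cardinality greater than alpha. *)
theorem theorem1p5:
  fixes \<alpha> :: "'a rel"
    and K :: "('k, 'b) monoid_scheme" and T :: "'k topology"
  assumes "Cinfinite \<alpha>"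
    and "topological_abelian_group K T" and "compact_space T"
    and large_s: "|UNIV :: real set| \<le>o |UNIV :: 's set|"
    and large_i: "\<alpha> <o |UNIV :: 'i set|"
  shows "(c_extremal \<alpha> K T \<longleftrightarrow> alpha_singular \<alpha> K T) \<and>
         (alpha_singular \<alpha> K T \<longleftrightarrow>
           \<not> (\<exists>(S :: 's monoid) U (I :: 'i set) h.
                 topological_abelian_group S U \<and> compact_space U \<and> metrizable_space U \<and>
                 non_torsion S \<and> \<alpha> <o |I| \<and> cont_hom_onto_power K T S U I h))"
proof -
  interpret compact_abelian_group K T
    using assms(2,3) by (simp add: compact_abelian_group_def compact_abelian_group_axioms_def topological_abelian_group_def)
  show ?thesis
    using singular_imp_extremal[OF assms(1)] power_imp_not_extremal[OF assms(1)]
      not_singular_imp_power[OF assms(1) _ large_s large_i] by blast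
qed

end
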